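(* Let $y\ge 2$. For every integer $k\ge1$ let $\Omega(n)$ denote the number of prime factors of $n$ counted with multiplicity, and define $$f_k=\sum_{\Omega(n)=k}\frac{1}{n\log n},\qquad f_{k,y}=\sum_{\substack{\Omega(n)=k\\ p\mid n\Rightarrow p>y}}\frac{1}{n\log n}.$$ Then for all sufficiently large $k$ (depending on $y$) we have $f_{k-1}<f_k$ and $f_{k-1,y}>f_{k,y}$.
   Context: $p$ always denotes a prime. The sum $f_{k,y}$ is over integers $n$ with exactly $k$ prime factors counted with multiplicity, all of which exceed $y$. *)

theory Defs
  imports "HOL-Analysis.Analysis" "HOL-Computational_Algebra.Primes"
begin

definition big_Omega :: "nat \<Rightarrow> nat" where
  "big_Omega n = size (prime_factorization n)"

text \<open>
  The condition \<open>n > 0\<close> is needed only because \<open>prime_factorization 0 = {#}\<close>.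
  For every \<open>k \<ge> 1\<close> both sums below converge (Erdos), so the real-valued \<open>infsum\<close>
  is then the actual value of the series; at \<open>k = 0\<close> they have no meaning, the only term
  being \<open>1 / (1 * ln 1)\<close>.
\<close>

definition f_sum :: "nat \<Rightarrow> real" where
  "f_sum k = (\<Sum>\<^sub>\<infinity>n\<in>{n. n > 0 \<and> big_Omega n = k}. 1 / (real n * ln (real n)))"

definition f_sum_rough :: "nat \<Rightarrow> real \<Rightarrow> real" where
  "f_sum_rough k y =
    (\<Sum>\<^sub>\<infinity>n\<in>{n. n > 0 \<and> big_Omega n = k \<and> (\<forall>p. prime p \<and> p dvd n \<longrightarrow> real p > y)}.
      1 / (real n * ln (real n)))"

end

theory Submission
  imports Defs "HOL-Real_Asymp.Real_Asymp"
begin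

text \<open>
  Write \<open>Z_k(t)\<close> for the sum of \<open>n powr - (1 + t)\<close> over the integers \<open>n\<close> of level \<open>k\<close> (that is,
  \<open>\<Omega>(n) = k\<close>) and \<open>L_j(t)\<close> for the sum of \<open>ln p * p powr - (j * (1 + t))\<close> over the admissible
  primes. Up to an error \<open>O(Z_k(d))\<close>, which is \<open>O((2/5)^k)\<close>, the sum \<open>f_k\<close> is the integral
  of \<open>Z_k\<close> over \<open>(0, d]\<close>. Integration by parts together with \<open>ln n = \<Sum>\<^bsub>p^j | n\<^esub> ln p\<close> turns this into
  the integral of \<open>t * (\<Sum>\<^bsub>j = 1..k\<^esub> L_j * Z_(k-j))\<close>. Near the pole \<open>L_1(t) = 1/t - c + o(1)\<close>, so
  \<open>f_(k-1) - f_k\<close> is governed by the moments \<open>X_k = \<integral> t * Z_k\<close>: it is about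
  \<open>c * X_(k-1) - (\<Sum>\<^bsub>j \<ge> 2\<^esub> L_j(0) * X_(k-j))\<close>.

  A second integration by parts gives \<open>X_(k-1) \<le> (2 + \<epsilon>) * X_k\<close>. If the prime 2 is excluded, the
  series over \<open>j\<close> therefore converges like a geometric one, and a numerical
  estimate shows that the difference is positive. If 2 is admitted, splitting off the powers of 2 shows
  that the terms with \<open>p = 2\<close> add up to a quantity of order \<open>k\<close> times \<open>X_(k-1)\<close>, which
  makes the difference negative.
\<close>

section \<open>The logarithmic convolution identity\<close>

text \<open>The proof compares exponential rates. The moments of odd integers of level k decay
  roughly like 2^(-k): the 2 is the exponent in the weight t^2, integrated by parts against a simple
  pole, so it is the same for every y. The boundary terms left at the cut-off d are governed by the
  smallest admissible prime, hence for odd primes by 3^(-k); 2/5 is a convenient value between 1/3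
  and 1/2. The prime 2 sits exactly on the critical rate: its powers contribute about ln 2 * 2^(-j)
  * X_(k-j), and since X_(k-j) grows with j about like 2^j, these contributions do not decay
  geometrically in j. This also explains why the two halves need different precision. For rough
  numbers the sign is that of a fixed constant, so the constant term of L_1 at the pole must be
  bounded explicitly. For all integers a linearly growing term decides, and any bound on c is
  enough. Sums that may diverge live in \<open>ennreal\<close>, so a difference is always expressed
  as an inequality with the negative part moved to the other side. The analytic input is the
  behaviour of zeta and its derivative along the real axis near the pole.\<close>

definition primes_above :: "real \<Rightarrow> nat set" where
  "primes_above y = {p. prime p \<and> real p > y}"

definition rough :: "real \<Rightarrow> nat set" where
  "rough y = {n. n > 0 \<and> (\<forall>p. prime p \<and> p dvd n \<longrightarrow> real p > y)}"

definition rough_level :: "real \<Rightarrow> nat \<Rightarrow> nat set" where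
  "rough_level y k = {n \<in> rough y. big_Omega n = k}"

text \<open>
  The variable \<open>t\<close> stands for \<open>s - 1\<close> throughout, so that the pole of zeta is at \<open>t = 0\<close>.
\<close>

definition zeta_level :: "real \<Rightarrow> nat \<Rightarrow> real \<Rightarrow> ennreal" where
  "zeta_level y k t = (\<integral>\<^sup>+n. ennreal (real n powr (- 1 - t)) \<partial>count_space (rough_level y k))"

definition log_zeta_level :: "real \<Rightarrow> nat \<Rightarrow> real \<Rightarrow> ennreal" where
  "log_zeta_level y k t =
     (\<integral>\<^sup>+n. ennreal (ln (real n)) * ennreal (real n powr (- 1 - t)) \<partial>count_space (rough_level y k))"

text \<open>The share of -zeta'/zeta at 1 + t that comes from the j-th powers of the admissible
  primes.\<close>

definition log_prime_zeta :: "real \<Rightarrow> nat \<Rightarrow> real \<Rightarrow> ennreal" where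
  "log_prime_zeta y j t =
     (\<integral>\<^sup>+p. ennreal (ln (real p) * real p powr - (real j * (1 + t))) \<partial>count_space (primes_above y))"

text \<open>Turning the index set into an indicator makes the sum a countable series over all
  naturals, for which measurability in the parameter is automatic.\<close>

lemma measurable_nn_integral_count_space_nat [measurable]:
  fixes f :: "nat \<Rightarrow> 'a \<Rightarrow> ennreal"
  assumes [measurable]: "\<And>n. f n \<in> borel_measurable M"
  shows "(\<lambda>t. \<integral>\<^sup>+n. f n t \<partial>count_space A) \<in> borel_measurable M"
proof -
  have "(\<lambda>t. \<integral>\<^sup>+n. f n t \<partial>count_space A) = (\<lambda>t. \<Sum>n. f n t * indicator A n)"
    by (subst nn_integral_count_space_nat [symmetric], cases "A = UNIV")
       (auto simp: nn_integral_count_space_indicator)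
  also have "\<dots> \<in> borel_measurable M" by measurable
  finally show ?thesis .
qed

lemma zeta_level_measurable [measurable]: "zeta_level y k \<in> borel_measurable borel"
  unfolding zeta_level_def by measurable

lemma log_prime_zeta_measurable [measurable]: "log_prime_zeta y j \<in> borel_measurable borel"
  unfolding log_prime_zeta_def by measurable

lemma big_Omega_mult: "m > 0 \<Longrightarrow> n > 0 \<Longrightarrow> big_Omega (m * n) = big_Omega m + big_Omega n"
  by (simp add: big_Omega_def prime_factorization_mult)

lemma big_Omega_prime_power: "prime p \<Longrightarrow> big_Omega (p ^ j) = j"
  by (simp add: big_Omega_def prime_factorization_prime_power)

lemma roughD: "n \<in> rough y \<Longrightarrow> p \<in> prime_factors n \<Longrightarrow> p \<in> primes_above y"
  by (auto simp: rough_def primes_above_def in_prime_factors_iff)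

lemma prime_power_mult_rough_iff:
  assumes "p \<in> primes_above y"
  shows "p ^ j * m \<in> rough y \<longleftrightarrow> m \<in> rough y"
proof -
  have p: "prime p" "real p > y" using assms by (auto simp: primes_above_def)
  have "real q > y" if "prime q" "q dvd p ^ j" for q
    using that p by (metis prime_dvd_power primes_dvd_imp_eq)
  then show ?thesis
    using prime_gt_0_nat [OF p(1)] by (auto simp: rough_def prime_dvd_mult_iff)
qed

text \<open>The identity log = 1 * Lambda. It is written as a double sum with an indicator, so that
  summing over n first becomes possible; restricting to primes above y loses nothing because n is
  rough.\<close>

lemma ln_eq_sum_prime_powers:
  assumes "n \<in> rough y"
  shows "ennreal (ln (real n)) =
    (\<integral>\<^sup>+p. \<integral>\<^sup>+j. ennreal (ln (real p)) * indicator {n. p ^ j dvd n} n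
       \<partial>count_space {1..} \<partial>count_space (primes_above y))"
proof -
  have n: "n > 0" using assms by (simp add: rough_def)
  have pos: "0 \<le> ln (real p)" if "p \<in> prime_factors n" for p
    using that prime_gt_0_nat by (auto simp: in_prime_factors_iff Suc_le_eq)
  have inner: "(\<integral>\<^sup>+j. ennreal (ln (real p)) * indicator {n. p ^ j dvd n} n \<partial>count_space {1..})
       = ennreal (real (multiplicity p n) * ln (real p))" if p: "p \<in> primes_above y" for p
  proof -
    have pp: "prime p" using p by (simp add: primes_above_def)
    then have dvd_iff: "p ^ j dvd n \<longleftrightarrow> j \<le> multiplicity p n" for j
      using n by (intro power_dvd_iff_le_multiplicity) auto
    have "(\<integral>\<^sup>+j. ennreal (ln (real p)) * indicator {n. p ^ j dvd n} n \<partial>count_space {1..})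
      = (\<Sum>j\<in>{1..multiplicity p n}. ennreal (ln (real p)) * indicator {n. p ^ j dvd n} n)"
      using n pp by (intro nn_integral_count_space')
        (auto simp: indicator_def dvd_iff)
    also have "\<dots> = (\<Sum>j\<in>{1..multiplicity p n}. ennreal (ln (real p)))"
      using n pp by (intro sum.cong refl)
        (auto simp: indicator_def dvd_iff)
    also have "\<dots> = ennreal (real (multiplicity p n) * ln (real p))"
      using pp by (simp add: ennreal_mult' ennreal_of_nat_eq_real_of_nat prime_ge_1_nat)
    finally show ?thesis .
  qed
  have "ln (real n) = ln (real (\<Prod>p\<in>prime_factors n. p ^ multiplicity p n))"
    using n by (subst prime_factorization_nat [symmetric]) auto
  also have "\<dots> = (\<Sum>p\<in>prime_factors n. real (multiplicity p n) * ln (real p))"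
    by (simp, subst ln_prod) (auto simp: in_prime_factors_iff ln_realpow prime_gt_0_nat)
  finally have "ennreal (ln (real n)) =
      (\<Sum>p\<in>prime_factors n. ennreal (real (multiplicity p n) * ln (real p)))"
    by (simp add: sum_ennreal pos)
  also have "\<dots> = (\<integral>\<^sup>+p. ennreal (real (multiplicity p n) * ln (real p)) \<partial>count_space (primes_above y))"
    using roughD [OF assms] n
    by (intro nn_integral_count_space' [symmetric])
       (auto simp: primes_above_def in_prime_factors_iff not_dvd_imp_multiplicity_0)
  also have "\<dots> = (\<integral>\<^sup>+p. \<integral>\<^sup>+j. ennreal (ln (real p)) * indicator {n. p ^ j dvd n} n
       \<partial>count_space {1..} \<partial>count_space (primes_above y))"
    by (intro nn_integral_cong) (simp only: inner space_count_space)
  finally show ?thesis .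
qed

lemma nn_integral_count_space_swap:
  fixes f :: "'a :: countable \<Rightarrow> 'b \<Rightarrow> ennreal"
  shows "(\<integral>\<^sup>+x. \<integral>\<^sup>+y. f x y \<partial>count_space B \<partial>count_space A) =
         (\<integral>\<^sup>+y. \<integral>\<^sup>+x. f x y \<partial>count_space A \<partial>count_space B)"
  by (rule nn_integral_count_space_nn_integral [symmetric]) auto

text \<open>After interchanging the sums, the multiples of p^j among the rough numbers are exactly
  p^j * m with m rough. The weight \<phi> is arbitrary because two instances are needed: one cut off
  to a single level, and one with \<open>y = 0\<close> for the zeta function itself.\<close>

lemma rough_log_convolution:
  fixes \<phi> :: "nat \<Rightarrow> ennreal"
  shows "(\<integral>\<^sup>+n. ennreal (ln (real n)) * \<phi> n \<partial>count_space (rough y)) =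
    (\<integral>\<^sup>+p. \<integral>\<^sup>+j. ennreal (ln (real p)) * (\<integral>\<^sup>+m. \<phi> (p ^ j * m) \<partial>count_space (rough y))
       \<partial>count_space {1..} \<partial>count_space (primes_above y))"
proof -
  have multiples: "(\<integral>\<^sup>+n. indicator {n. p ^ j dvd n} n * \<phi> n \<partial>count_space (rough y)) =
      (\<integral>\<^sup>+m. \<phi> (p ^ j * m) \<partial>count_space (rough y))" if p: "p \<in> primes_above y" for p j
  proof -
    have p0: "p > 0" using p by (auto simp: primes_above_def prime_gt_0_nat)
    have "(\<integral>\<^sup>+m. \<phi> (p ^ j * m) \<partial>count_space (rough y))
        = (\<integral>\<^sup>+n. \<phi> n \<partial>count_space {n \<in> rough y. p ^ j dvd n})"
      using p0 prime_power_mult_rough_iff [OF p]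
      by (intro nn_integral_bij_count_space) (auto simp: bij_betw_def inj_on_def)
    also have "\<dots> = (\<integral>\<^sup>+n. indicator {n. p ^ j dvd n} n * \<phi> n \<partial>count_space {n \<in> rough y. p ^ j dvd n})"
      by (intro nn_integral_cong) auto
    also have "\<dots> = (\<integral>\<^sup>+n. indicator {n. p ^ j dvd n} n * \<phi> n \<partial>count_space (rough y))"
      by (intro nn_integral_count_space_eq) auto
    finally show ?thesis ..
  qed
  have "(\<integral>\<^sup>+n. ennreal (ln (real n)) * \<phi> n \<partial>count_space (rough y)) =
    (\<integral>\<^sup>+n. \<integral>\<^sup>+p. \<integral>\<^sup>+j. ennreal (ln (real p)) * (indicator {n. p ^ j dvd n} n * \<phi> n)
       \<partial>count_space {1..} \<partial>count_space (primes_above y) \<partial>count_space (rough y))"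
    by (intro nn_integral_cong)
       (simp add: ln_eq_sum_prime_powers nn_integral_multc [symmetric] mult.assoc)
  also have "\<dots> = (\<integral>\<^sup>+p. \<integral>\<^sup>+j. \<integral>\<^sup>+n. ennreal (ln (real p)) * (indicator {n. p ^ j dvd n} n * \<phi> n)
       \<partial>count_space (rough y) \<partial>count_space {1..} \<partial>count_space (primes_above y))"
    by (subst nn_integral_count_space_swap, subst (2) nn_integral_count_space_swap) (rule refl)
  also have "\<dots> = (\<integral>\<^sup>+p. \<integral>\<^sup>+j. ennreal (ln (real p)) * (\<integral>\<^sup>+m. \<phi> (p ^ j * m) \<partial>count_space (rough y))
       \<partial>count_space {1..} \<partial>count_space (primes_above y))"
    by (intro nn_integral_cong) (simp add: nn_integral_cmult multiples)
  finally show ?thesis .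
qed

lemma count_space_filter:
  "(\<integral>\<^sup>+n. f n \<partial>count_space {n \<in> A. P n}) = (\<integral>\<^sup>+n. f n * indicator {n. P n} n \<partial>count_space A)"
proof -
  have "(\<integral>\<^sup>+n. f n \<partial>count_space {n \<in> A. P n})
      = (\<integral>\<^sup>+n. f n * indicator {n. P n} n \<partial>count_space {n \<in> A. P n})"
    by (intro nn_integral_cong) auto
  also have "\<dots> = (\<integral>\<^sup>+n. f n * indicator {n. P n} n \<partial>count_space A)"
    by (intro nn_integral_count_space_eq) auto
  finally show ?thesis .
qed

lemma powr_prime_power_mult:
  assumes "p > 0"
  shows "real (p ^ j * m) powr (- 1 - t) = real p powr - (real j * (1 + t)) * real m powr (- 1 - t)"
proof -
  have "real (p ^ j) = real p powr real j"
    using assms by (simp add: powr_realpow)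
  moreover have "real j * (- 1 - t) = - (real j * (1 + t))"
    by (simp add: algebra_simps)
  ultimately show ?thesis
    by (simp add: powr_mult powr_powr)
qed

text \<open>Multiplication by p^j raises the level by exactly j, so the convolution respects levels
  and stops at j = k. In generating functions this is the coefficient of z^k in the logarithmic
  derivative, with respect to s, of the Euler product weighted by z^\<Omega>(n).\<close>

lemma log_zeta_level_eq:
  "log_zeta_level y k t = (\<Sum>j=1..k. log_prime_zeta y j t * zeta_level y (k - j) t)"
proof -
  define \<phi> :: "nat \<Rightarrow> ennreal" where
    "\<phi> n = ennreal (real n powr (- 1 - t)) * indicator {n. big_Omega n = k} n" for n
  have shift: "(\<integral>\<^sup>+m. \<phi> (p ^ j * m) \<partial>count_space (rough y)) =
      (if j \<le> k then ennreal (real p powr - (real j * (1 + t))) * zeta_level y (k - j) t else 0)"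
    if p: "p \<in> primes_above y" for p j
  proof -
    have pp: "prime p" using p by (simp add: primes_above_def)
    have "(\<integral>\<^sup>+m. \<phi> (p ^ j * m) \<partial>count_space (rough y)) =
      (\<integral>\<^sup>+m. ennreal (real p powr - (real j * (1 + t))) *
         (if j \<le> k then ennreal (real m powr (- 1 - t)) * indicator {n. big_Omega n = k - j} m else 0)
         \<partial>count_space (rough y))"
    proof (rule nn_integral_cong)
      fix m assume "m \<in> space (count_space (rough y))"
      then have "m > 0" by (simp add: rough_def)
      with pp have "big_Omega (p ^ j * m) = j + big_Omega m"
        by (subst big_Omega_mult) (auto simp: big_Omega_prime_power prime_gt_0_nat)
      then show "\<phi> (p ^ j * m) = ennreal (real p powr - (real j * (1 + t))) *
         (if j \<le> k then ennreal (real m powr (- 1 - t)) * indicator {n. big_Omega n = k - j} m else 0)"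
        using powr_prime_power_mult [of p j m t] pp prime_gt_0_nat [OF pp]
        by (auto simp: \<phi>_def indicator_def ennreal_mult')
    qed
    then show ?thesis
      by (auto simp: nn_integral_cmult zeta_level_def rough_level_def count_space_filter)
  qed
  have "log_zeta_level y k t = (\<integral>\<^sup>+n. ennreal (ln (real n)) * \<phi> n \<partial>count_space (rough y))"
    by (simp add: log_zeta_level_def rough_level_def count_space_filter \<phi>_def mult.assoc)
  also have "\<dots> = (\<integral>\<^sup>+p. \<integral>\<^sup>+j. ennreal (ln (real p)) *
       (if j \<le> k then ennreal (real p powr - (real j * (1 + t))) * zeta_level y (k - j) t else 0)
       \<partial>count_space {1..} \<partial>count_space (primes_above y))"
    unfolding rough_log_convolution by (intro nn_integral_cong) (simp add: shift)
  also have "\<dots> = (\<integral>\<^sup>+p. (\<Sum>j=1..k. ennreal (ln (real p)) *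
       (ennreal (real p powr - (real j * (1 + t))) * zeta_level y (k - j) t))
       \<partial>count_space (primes_above y))"
    by (intro nn_integral_cong, subst nn_integral_count_space' [of "{1..k}"]) auto
  also have "\<dots> = (\<Sum>j=1..k. log_prime_zeta y j t * zeta_level y (k - j) t)"
  proof (subst nn_integral_sum, simp, intro sum.cong refl)
    fix j
    have "(\<integral>\<^sup>+p. ennreal (ln (real p)) * (ennreal (real p powr - (real j * (1 + t))) *
        zeta_level y (k - j) t) \<partial>count_space (primes_above y)) =
      (\<integral>\<^sup>+p. ennreal (ln (real p) * real p powr - (real j * (1 + t))) * zeta_level y (k - j) t
        \<partial>count_space (primes_above y))"
      by (intro nn_integral_cong) (simp add: ennreal_mult'' mult.assoc)
    then show "(\<integral>\<^sup>+p. ennreal (ln (real p)) * (ennreal (real p powr - (real j * (1 + t))) *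
        zeta_level y (k - j) t) \<partial>count_space (primes_above y)) =
        log_prime_zeta y j t * zeta_level y (k - j) t"
      by (simp add: nn_integral_multc log_prime_zeta_def)
  qed
  finally show ?thesis .
qed

section \<open>Integration over a short interval\<close>

text \<open>The point 0 is left out so that 1 / t may be used in pointwise estimates under the
  integral.\<close>

definition near_zero :: "real \<Rightarrow> real measure" where
  "near_zero d = restrict_space lborel {0<..d}"

lemma space_near_zero [simp]: "space (near_zero d) = {0<..d}"
  by (simp add: near_zero_def space_restrict_space)

lemma measurable_near_zero [measurable (raw)]:
  "f \<in> borel_measurable borel \<Longrightarrow> f \<in> borel_measurable (near_zero d)"
  unfolding near_zero_def by (intro measurable_restrict_space1) simp

lemma nn_integral_near_zero: "(\<integral>\<^sup>+t. f t \<partial>near_zero d) = (\<integral>\<^sup>+t. f t * indicator {0<..d} t \<partial>lborel)"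
  unfolding near_zero_def by (subst nn_integral_restrict_space) auto

text \<open>The derivative is given as a difference of two nonnegative functions because
  \<open>ennreal\<close> has no usable subtraction: \<open>h\<close> appears on the right as an
  added integral.\<close>

lemma nn_integral_near_zero_FTC:
  fixes F g h :: "real \<Rightarrow> real"
  assumes d: "0 \<le> d"
    and F: "\<And>t. (F has_real_derivative g t - h t) (at t)"
    and cont: "continuous_on UNIV g" "continuous_on UNIV h"
    and nonneg: "\<And>t. 0 \<le> t \<Longrightarrow> 0 \<le> g t" "\<And>t. 0 \<le> t \<Longrightarrow> 0 \<le> h t"
    and F_le: "F 0 \<le> F d"
  shows "(\<integral>\<^sup>+t. ennreal (g t) \<partial>near_zero d) = (\<integral>\<^sup>+t. ennreal (h t) \<partial>near_zero d) + ennreal (F d - F 0)"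
proof -
  have eq: "(\<integral>\<^sup>+t. ennreal (f t) \<partial>near_zero d) = ennreal (integral {0..d} f)"
    if "continuous_on UNIV f" "\<And>t. 0 \<le> t \<Longrightarrow> 0 \<le> f t" for f :: "real \<Rightarrow> real"
  proof -
    have "(f has_integral integral {0..d} f) {0..d}"
      using that by (intro integrable_integral integrable_continuous_real)
        (auto intro: continuous_on_subset)
    then have "(\<integral>\<^sup>+t\<in>{0..d}. ennreal (f t) \<partial>lborel) = ennreal (integral {0..d} f)"
      using that by (intro nn_integral_has_integral_lebesgue') auto
    moreover have "(\<integral>\<^sup>+t\<in>{0..d}. ennreal (f t) \<partial>lborel) = (\<integral>\<^sup>+t\<in>{0<..d}. ennreal (f t) \<partial>lborel)"
    proof (rule nn_integral_cong_AE)
      show "AE t in lborel. ennreal (f t) * indicator {0..d} t = ennreal (f t) * indicator {0<..d} t"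
        using AE_lborel_singleton [of 0] by eventually_elim (auto simp: indicator_def)
    qed
    ultimately show ?thesis by (simp add: nn_integral_near_zero)
  qed
  have "((\<lambda>t. g t - h t) has_integral (F d - F 0)) {0..d}"
    using d F by (intro fundamental_theorem_of_calculus)
      (auto simp: has_real_derivative_iff_has_vector_derivative [symmetric]
            intro: has_field_derivative_at_within)
  moreover have "((\<lambda>t. g t - h t) has_integral (integral {0..d} g - integral {0..d} h)) {0..d}"
    using cont by (intro has_integral_diff integrable_integral integrable_continuous_real)
        (auto intro: continuous_on_subset)
  ultimately have "integral {0..d} g = integral {0..d} h + (F d - F 0)"
    by (metis add.commute diff_add_cancel has_integral_unique)
  moreover have "integral {0..d} h \<ge> 0"
    using nonneg by (intro integral_nonneg integrable_continuous_real)
       (auto intro: continuous_on_subset cont)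
  ultimately show ?thesis
    using F_le by (simp add: eq cont nonneg ennreal_plus)
qed

lemma powr_term_derivative:
  assumes "n > 0"
  shows "((\<lambda>t. real n powr (- 1 - t)) has_real_derivative
           - (ln (real n) * real n powr (- 1 - t))) (at t)"
  using assms by (auto intro!: derivative_eq_intros)

lemma powr_term_continuous: "n > 0 \<Longrightarrow> continuous_on UNIV (\<lambda>t. real n powr (- 1 - t))"
  by (intro continuous_intros) auto

text \<open>Integration by parts with antiderivative t * n^(-1-t). The factor t removes the boundary
  term at 0, which would otherwise add up to a divergent series over n; only the term at d
  remains.\<close>

lemma powr_term_integral0:
  assumes "n > 0" "0 \<le> d"
  shows "(\<integral>\<^sup>+t. ennreal (real n powr (- 1 - t)) \<partial>near_zero d) =
    (\<integral>\<^sup>+t. ennreal (t * (ln (real n) * real n powr (- 1 - t))) \<partial>near_zero d)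
      + ennreal (d * real n powr (- 1 - d))"
proof -
  have "((\<lambda>t. t * real n powr (- 1 - t)) has_real_derivative
      real n powr (- 1 - t) - t * (ln (real n) * real n powr (- 1 - t))) (at t)" for t
    using DERIV_mult [OF DERIV_ident powr_term_derivative [OF assms(1)]]
    by (simp add: algebra_simps)
  from nn_integral_near_zero_FTC [OF assms(2) this] show ?thesis
    using assms by (simp add: continuous_on_mult continuous_on_id powr_term_continuous)
qed

lemma powr_term_integral1:
  assumes "n > 0" "0 \<le> d"
  shows "(\<integral>\<^sup>+t. ennreal (2 * (t * real n powr (- 1 - t))) \<partial>near_zero d) =
    (\<integral>\<^sup>+t. ennreal (t\<^sup>2 * (ln (real n) * real n powr (- 1 - t))) \<partial>near_zero d)
      + ennreal (d\<^sup>2 * real n powr (- 1 - d))"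
proof -
  have "((\<lambda>t. t\<^sup>2) has_real_derivative 2 * t) (at t)" for t :: real
    by (auto intro!: derivative_eq_intros)
  from DERIV_mult [OF this powr_term_derivative [OF assms(1)]]
  have "((\<lambda>t. t\<^sup>2 * real n powr (- 1 - t)) has_real_derivative
      2 * (t * real n powr (- 1 - t)) - t\<^sup>2 * (ln (real n) * real n powr (- 1 - t))) (at t)" for t
    by (simp add: algebra_simps)
  from nn_integral_near_zero_FTC [OF assms(2) this] show ?thesis
    using assms
    by (simp add: continuous_on_mult continuous_on_power continuous_on_id powr_term_continuous
          del: mult.left_commute)
qed

text \<open>Integrating n^(-1-t) over all t > 0 gives 1 / (n ln n); the second summand is the part
  beyond d.\<close>

lemma reciprocal_n_log_n:
  assumes "n > 1" "0 \<le> d"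
  shows "ennreal (1 / (real n * ln (real n))) =
    (\<integral>\<^sup>+t. ennreal (real n powr (- 1 - t)) \<partial>near_zero d) + ennreal (real n powr (- 1 - d) / ln (real n))"
proof -
  have ln: "ln (real n) > 0" using assms by simp
  have le: "real n powr (- 1 - d) / ln (real n) \<le> 1 / (real n * ln (real n))"
  proof -
    have "real n powr (- 1 - d) \<le> real n powr - 1"
      using assms by (intro powr_mono) auto
    also have "\<dots> = 1 / real n" by (simp add: powr_minus_divide)
    finally show ?thesis using ln by (simp add: field_simps)
  qed
  have "((\<lambda>t. - (real n powr (- 1 - t) / ln (real n))) has_real_derivative
      real n powr (- 1 - t) - 0) (at t)" for t
    using DERIV_minus [OF DERIV_cdivide [OF powr_term_derivative, of n "ln (real n)"]] assms ln
    by simp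
  from nn_integral_near_zero_FTC [OF assms(2) this]
  have "(\<integral>\<^sup>+t. ennreal (real n powr (- 1 - t)) \<partial>near_zero d) =
      ennreal (1 / (real n * ln (real n)) - real n powr (- 1 - d) / ln (real n))"
    using assms ln le powr_term_continuous [of n]
    by (simp add: powr_minus_divide)
  then show ?thesis using le ln by (simp add: ennreal_plus [symmetric] del: ennreal_plus)
qed

text \<open>With \<open>y = 1\<close> no prime is excluded, so both sums of the theorem are covered.
  Values in \<open>ennreal\<close> postpone the question of convergence to
  \<open>erdos_level_finite\<close>.\<close>

definition erdos_level :: "real \<Rightarrow> nat \<Rightarrow> ennreal" where
  "erdos_level y k = (\<integral>\<^sup>+n. ennreal (1 / (real n * ln (real n))) \<partial>count_space (rough_level y k))"

lemma rough_level_pos: "n \<in> rough_level y k \<Longrightarrow> n > 0"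
  by (simp add: rough_level_def rough_def)

lemma rough_level_gt_1: "n \<in> rough_level y k \<Longrightarrow> k > 0 \<Longrightarrow> n > 1"
  by (rule ccontr) (auto simp: rough_level_def rough_def big_Omega_def not_less le_Suc_eq)

lemma nn_integral_near_zero_swap:
  fixes f :: "nat \<Rightarrow> real \<Rightarrow> ennreal"
  assumes "\<And>n. f n \<in> borel_measurable borel"
  shows "(\<integral>\<^sup>+t. \<integral>\<^sup>+n. f n t \<partial>count_space A \<partial>near_zero d) = (\<integral>\<^sup>+n. \<integral>\<^sup>+t. f n t \<partial>near_zero d \<partial>count_space A)"
  by (rule nn_integral_count_space_nn_integral) (auto intro: measurable_near_zero assms)

text \<open>Valid even if both sides are infinite, which allows
  \<open>zeta_level_integral_finite\<close> to deduce finiteness from it.\<close>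

lemma zeta_level_integral:
  assumes "0 \<le> d"
  shows "(\<integral>\<^sup>+t. zeta_level y k t \<partial>near_zero d) =
    (\<integral>\<^sup>+t. ennreal t * log_zeta_level y k t \<partial>near_zero d) + ennreal d * zeta_level y k d"
proof -
  let ?A = "rough_level y k"
  have "(\<integral>\<^sup>+t. zeta_level y k t \<partial>near_zero d) =
      (\<integral>\<^sup>+n. \<integral>\<^sup>+t. ennreal (real n powr (- 1 - t)) \<partial>near_zero d \<partial>count_space ?A)"
    unfolding zeta_level_def by (rule nn_integral_near_zero_swap) measurable
  also have "\<dots> = (\<integral>\<^sup>+n. (\<integral>\<^sup>+t. ennreal (t * (ln (real n) * real n powr (- 1 - t))) \<partial>near_zero d)
      + ennreal d * ennreal (real n powr (- 1 - d)) \<partial>count_space ?A)"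
    using assms by (intro nn_integral_cong)
      (simp add: powr_term_integral0 rough_level_pos ennreal_mult)
  also have "\<dots> = (\<integral>\<^sup>+n. \<integral>\<^sup>+t. ennreal (t * (ln (real n) * real n powr (- 1 - t))) \<partial>near_zero d
      \<partial>count_space ?A) + ennreal d * zeta_level y k d"
    unfolding zeta_level_def by (subst nn_integral_add) (auto simp: nn_integral_cmult)
  also have "(\<integral>\<^sup>+n. \<integral>\<^sup>+t. ennreal (t * (ln (real n) * real n powr (- 1 - t))) \<partial>near_zero d
      \<partial>count_space ?A) =
    (\<integral>\<^sup>+t. \<integral>\<^sup>+n. ennreal (t * (ln (real n) * real n powr (- 1 - t))) \<partial>count_space ?A \<partial>near_zero d)"
    by (rule nn_integral_near_zero_swap [symmetric]) measurable
  also have "\<dots> = (\<integral>\<^sup>+t. ennreal t * log_zeta_level y k t \<partial>near_zero d)"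
    unfolding log_zeta_level_def
    by (intro nn_integral_cong)
       (auto simp: nn_integral_cmult [symmetric] ennreal_mult'' ennreal_mult' mult.assoc
             intro!: nn_integral_cong)
  finally show ?thesis .
qed

definition moment :: "real \<Rightarrow> real \<Rightarrow> nat \<Rightarrow> ennreal" where
  "moment d y k = (\<integral>\<^sup>+t. ennreal t * zeta_level y k t \<partial>near_zero d)"

text \<open>Origin of the ratio 2 between consecutive moments: the 2 on the left is the derivative
  of t^2, while t^2 * L_1 is about t on the right, so 2 X_k is about X_(k-1).\<close>

lemma moment_integral:
  assumes "0 \<le> d"
  shows "2 * moment d y k =
    (\<integral>\<^sup>+t. ennreal (t\<^sup>2) * log_zeta_level y k t \<partial>near_zero d) + ennreal (d\<^sup>2) * zeta_level y k d"
proof -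
  let ?A = "rough_level y k"
  have "2 * moment d y k = (\<integral>\<^sup>+t. 2 * (ennreal t * zeta_level y k t) \<partial>near_zero d)"
    unfolding moment_def by (rule nn_integral_cmult [symmetric]) measurable
  also have "\<dots> = (\<integral>\<^sup>+t. \<integral>\<^sup>+n. ennreal (2 * (t * real n powr (- 1 - t))) \<partial>count_space ?A \<partial>near_zero d)"
    unfolding zeta_level_def
    by (intro nn_integral_cong)
       (auto simp: nn_integral_cmult [symmetric] ennreal_mult'' ennreal_mult' mult.assoc
             intro!: nn_integral_cong)
  also have "\<dots> = (\<integral>\<^sup>+n. \<integral>\<^sup>+t. ennreal (2 * (t * real n powr (- 1 - t))) \<partial>near_zero d \<partial>count_space ?A)"
    by (rule nn_integral_near_zero_swap) measurable
  also have "\<dots> = (\<integral>\<^sup>+n. (\<integral>\<^sup>+t. ennreal (t\<^sup>2 * (ln (real n) * real n powr (- 1 - t))) \<partial>near_zero d)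
      + ennreal (d\<^sup>2) * ennreal (real n powr (- 1 - d)) \<partial>count_space ?A)"
    using assms by (intro nn_integral_cong)
      (simp add: powr_term_integral1 rough_level_pos ennreal_mult)
  also have "\<dots> = (\<integral>\<^sup>+n. \<integral>\<^sup>+t. ennreal (t\<^sup>2 * (ln (real n) * real n powr (- 1 - t))) \<partial>near_zero d
      \<partial>count_space ?A) + ennreal (d\<^sup>2) * zeta_level y k d"
    unfolding zeta_level_def by (subst nn_integral_add) (auto simp: nn_integral_cmult)
  also have "(\<integral>\<^sup>+n. \<integral>\<^sup>+t. ennreal (t\<^sup>2 * (ln (real n) * real n powr (- 1 - t))) \<partial>near_zero d
      \<partial>count_space ?A) =
    (\<integral>\<^sup>+t. \<integral>\<^sup>+n. ennreal (t\<^sup>2 * (ln (real n) * real n powr (- 1 - t))) \<partial>count_space ?A \<partial>near_zero d)"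
    by (rule nn_integral_near_zero_swap [symmetric]) measurable
  also have "\<dots> = (\<integral>\<^sup>+t. ennreal (t\<^sup>2) * log_zeta_level y k t \<partial>near_zero d)"
    unfolding log_zeta_level_def
    by (intro nn_integral_cong)
       (auto simp: nn_integral_cmult [symmetric] ennreal_mult'' ennreal_mult' mult.assoc
             intro!: nn_integral_cong)
  finally show ?thesis .
qed

lemma erdos_level_bounds:
  assumes "k > 0" "0 \<le> d"
  shows "(\<integral>\<^sup>+t. zeta_level y k t \<partial>near_zero d) \<le> erdos_level y k"
    and "erdos_level y k \<le> (\<integral>\<^sup>+t. zeta_level y k t \<partial>near_zero d) + 2 * zeta_level y k d"
proof -
  let ?A = "rough_level y k"
  have swap: "(\<integral>\<^sup>+t. zeta_level y k t \<partial>near_zero d) =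
      (\<integral>\<^sup>+n. \<integral>\<^sup>+t. ennreal (real n powr (- 1 - t)) \<partial>near_zero d \<partial>count_space ?A)"
    unfolding zeta_level_def by (rule nn_integral_near_zero_swap) measurable
  show "(\<integral>\<^sup>+t. zeta_level y k t \<partial>near_zero d) \<le> erdos_level y k"
    unfolding swap erdos_level_def using assms
    by (intro nn_integral_mono) (auto dest!: rough_level_gt_1 simp: reciprocal_n_log_n)
  have "erdos_level y k \<le> (\<integral>\<^sup>+n. (\<integral>\<^sup>+t. ennreal (real n powr (- 1 - t)) \<partial>near_zero d)
      + 2 * ennreal (real n powr (- 1 - d)) \<partial>count_space ?A)"
    unfolding erdos_level_def
  proof (rule nn_integral_mono)
    fix n assume "n \<in> space (count_space ?A)"
    then have n: "n > 1" using assms rough_level_gt_1 by auto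
    \<comment> \<open>The tail beyond d carries 1 / ln n, at most 1 / ln 2 < 2; this is the factor 2
      in front of the error term.\<close>
    have "1 / 2 \<le> ln (2 :: real)" using ln2_ge_two_thirds by simp
    also have "\<dots> \<le> ln (real n)" using n by simp
    finally have "real n powr (- 1 - d) / ln (real n) \<le> real n powr (- 1 - d) / (1 / 2)"
      by (intro divide_left_mono) auto
    then have "ennreal (real n powr (- 1 - d) / ln (real n)) \<le> 2 * ennreal (real n powr (- 1 - d))"
      by (subst ennreal_numeral [symmetric], subst ennreal_mult [symmetric]) (auto intro: ennreal_leI)
    then show "ennreal (1 / (real n * ln (real n))) \<le>
       (\<integral>\<^sup>+t. ennreal (real n powr (- 1 - t)) \<partial>near_zero d) + 2 * ennreal (real n powr (- 1 - d))"
      using n assms by (simp add: reciprocal_n_log_n [of n d] add_left_mono)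
  qed
  also have "\<dots> = (\<integral>\<^sup>+t. zeta_level y k t \<partial>near_zero d) + 2 * zeta_level y k d"
    unfolding swap unfolding zeta_level_def by (subst nn_integral_add) (auto simp: nn_integral_cmult)
  finally show "erdos_level y k \<le> (\<integral>\<^sup>+t. zeta_level y k t \<partial>near_zero d) + 2 * zeta_level y k d" .
qed

section \<open>The zeta function near its pole\<close>

definition zeta :: "real \<Rightarrow> ennreal" where
  "zeta t = (\<integral>\<^sup>+n. ennreal (real n powr (- 1 - t)) \<partial>count_space {0<..})"

definition log_zeta :: "real \<Rightarrow> ennreal" where
  "log_zeta t = (\<integral>\<^sup>+n. ennreal (ln (real n)) * ennreal (real n powr (- 1 - t)) \<partial>count_space {0<..})"

text \<open>This is -zeta'/zeta at 1 + t, with the sum over all powers of p evaluated as a geometric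
  series.\<close>

definition mangoldt_zeta :: "real \<Rightarrow> ennreal" where
  "mangoldt_zeta t = (\<integral>\<^sup>+p. ennreal (ln (real p) / (real p powr (1 + t) - 1)) \<partial>count_space {p. prime p})"

lemma nn_integral_count_space_greaterThan_0:
  "(\<integral>\<^sup>+n. f n \<partial>count_space {0<..}) = (\<Sum>n. f (Suc n))"
proof -
  have "(\<integral>\<^sup>+n. f n \<partial>count_space {0<..}) = (\<integral>\<^sup>+n. f (Suc n) \<partial>count_space UNIV)"
    by (rule nn_integral_bij_count_space [symmetric])
       (auto simp: bij_betw_def image_iff gr0_conv_Suc)
  then show ?thesis by (simp add: nn_integral_count_space_nat)
qed

text \<open>The integral test without improper integrals: \<open>F n\<close> plays the integral from
  n to infinity. For the upper bound it is enough that \<open>F\<close> is nonnegative; the lower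
  bound below needs \<open>F\<close> to tend to 0.\<close>

lemma suminf_ennreal_le_telescope:
  fixes f F :: "nat \<Rightarrow> real"
  assumes "\<And>n. 0 \<le> f n" "\<And>n. f n \<le> F n - F (Suc n)" "\<And>n. 0 \<le> F n"
  shows "(\<Sum>n. ennreal (f n)) \<le> ennreal (F 0)"
proof (rule suminf_le_const)
  fix m
  have "(\<Sum>n<m. f n) \<le> (\<Sum>n<m. F n - F (Suc n))"
    using assms by (intro sum_mono)
  also have "\<dots> \<le> F 0"
    using assms(3) [of m] by (simp add: sum_lessThan_telescope')
  finally show "(\<Sum>n<m. ennreal (f n)) \<le> ennreal (F 0)"
    by (simp add: assms sum_ennreal ennreal_leI)
qed simp

lemma suminf_ennreal_ge_telescope:
  fixes f F :: "nat \<Rightarrow> real"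
  assumes "\<And>n. 0 \<le> f n" "\<And>n. F n - F (Suc n) \<le> f n" "F \<longlonglongrightarrow> 0"
  shows "ennreal (F 0) \<le> (\<Sum>n. ennreal (f n))"
proof (rule LIMSEQ_le_const2)
  show "(\<lambda>m. ennreal (F 0 - F m)) \<longlonglongrightarrow> ennreal (F 0)"
    using assms(3) by (auto intro!: tendsto_ennrealI tendsto_eq_intros)
  show "\<exists>N. \<forall>m\<ge>N. ennreal (F 0 - F m) \<le> (\<Sum>n. ennreal (f n))"
  proof (intro exI allI impI)
    fix m
    have "F 0 - F m = (\<Sum>n<m. F n - F (Suc n))"
      by (simp add: sum_lessThan_telescope')
    also have "\<dots> \<le> (\<Sum>n<m. f n)"
      using assms by (intro sum_mono)
    finally have "ennreal (F 0 - F m) \<le> (\<Sum>n<m. ennreal (f n))"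
      by (simp add: assms sum_ennreal ennreal_leI)
    also have "\<dots> \<le> (\<Sum>n. ennreal (f n))"
      by (intro sum_le_suminf) auto
    finally show "ennreal (F 0 - F m) \<le> (\<Sum>n. ennreal (f n))" .
  qed
qed

text \<open>For a completely multiplicative weight the inner sum of the convolution factors as
  p^(-j(1+t)) times zeta, and the sum over j is geometric.\<close>

lemma zeta_mult_mangoldt:
  assumes t: "t > 0"
  shows "log_zeta t = mangoldt_zeta t * zeta t"
proof -
  have rough0: "rough 0 = {0<..}" and primes0: "primes_above 0 = {p. prime p}"
    by (auto simp: rough_def primes_above_def prime_gt_0_nat dvd_pos_nat)
  define \<phi> where "\<phi> n = ennreal (real n powr (- 1 - t))" for n :: nat
  have "log_zeta t = (\<integral>\<^sup>+p. \<integral>\<^sup>+j. ennreal (ln (real p)) * (\<integral>\<^sup>+m. \<phi> (p ^ j * m) \<partial>count_space {0<..})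
       \<partial>count_space {1..} \<partial>count_space {p. prime p})"
    unfolding log_zeta_def \<phi>_def [symmetric]
    using rough_log_convolution [where \<phi> = \<phi> and y = 0] by (simp add: rough0 primes0)
  also have "\<dots> = (\<integral>\<^sup>+p. ennreal (ln (real p) / (real p powr (1 + t) - 1)) * zeta t
      \<partial>count_space {p. prime p})"
  proof (rule nn_integral_cong)
    fix p :: nat assume "p \<in> space (count_space {p. prime p})"
    then have p: "p > 1" using prime_gt_1_nat by simp
    define x where "x = real p powr - (1 + t)"
    have x: "0 < x" "x < 1"
      using p t powr_less_mono [of "- (1 + t)" 0 "real p"] by (auto simp: x_def)
    have ppow: "\<phi> (p ^ j * m) = ennreal (x ^ j) * \<phi> m" for j m
    proof -
      have "real p powr - (real j * (1 + t)) = x ^ j"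
        using p by (simp add: x_def powr_powr powr_realpow [symmetric] algebra_simps)
      then show ?thesis
        using p x powr_prime_power_mult [of p j m t]
        by (simp add: \<phi>_def ennreal_mult del: of_nat_mult of_nat_power)
    qed
    have geo: "(\<Sum>n. ennreal (x ^ Suc n)) = ennreal (1 / (real p powr (1 + t) - 1))"
    proof -
      have "(\<lambda>n. x * x ^ n) sums (x * (1 / (1 - x)))"
        using x by (intro sums_mult geometric_sums) auto
      then have "(\<Sum>n. ennreal (x ^ Suc n)) = ennreal (x * (1 / (1 - x)))"
        using x by (intro suminf_ennreal_eq) auto
      also have "x * (1 / (1 - x)) = 1 / (real p powr (1 + t) - 1)"
        using x p t by (simp add: x_def powr_minus field_simps del: minus_add_distrib)
      finally show ?thesis .
    qed
    have "(\<integral>\<^sup>+j. ennreal (ln (real p)) * (\<integral>\<^sup>+m. \<phi> (p ^ j * m) \<partial>count_space {0<..}) \<partial>count_space {1..})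
      = (\<integral>\<^sup>+j. ennreal (ln (real p)) * zeta t * ennreal (x ^ j) \<partial>count_space {0<..})"
      unfolding ppow zeta_def \<phi>_def [symmetric]
      by (simp add: nn_integral_cmult nn_integral_multc atLeast_Suc_greaterThan, simp only: mult_ac)
    also have "\<dots> = ennreal (ln (real p)) * zeta t * (\<Sum>n. ennreal (x ^ Suc n))"
      by (subst nn_integral_cmult) (auto simp: nn_integral_count_space_greaterThan_0)
    also have "\<dots> = ennreal (ln (real p) / (real p powr (1 + t) - 1)) * zeta t"
      using p unfolding geo by (simp add: ennreal_mult' [symmetric] mult_ac mult.assoc [symmetric])
    finally show "(\<integral>\<^sup>+j. ennreal (ln (real p)) * (\<integral>\<^sup>+m. \<phi> (p ^ j * m) \<partial>count_space {0<..}) \<partial>count_space {1..})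
      = ennreal (ln (real p) / (real p powr (1 + t) - 1)) * zeta t" .
  qed
  also have "\<dots> = mangoldt_zeta t * zeta t"
    by (simp add: mangoldt_zeta_def nn_integral_multc)
  finally show ?thesis .
qed

lemma powr_minus_tendsto_0: "t > 0 \<Longrightarrow> (\<lambda>n. real (Suc n) powr - t) \<longlonglongrightarrow> 0"
  by (rule LIMSEQ_Suc) (intro tendsto_neg_powr filterlim_real_sequentially, simp_all)

lemma has_integral_powr_minus:
  fixes t a b :: real
  assumes "t > 0" "0 < a" "a \<le> b"
  shows "((\<lambda>x. x powr (- 1 - t)) has_integral (a powr - t / t - b powr - t / t)) {a..b}"
proof -
  have "((\<lambda>x. - (x powr - t / t)) has_real_derivative x powr (- 1 - t)) (at x)" if "x > 0" for x :: real
    using that assms by (auto intro!: derivative_eq_intros simp: minus_diff_commute)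
  then have "((\<lambda>x. x powr (- 1 - t)) has_integral (- (b powr - t / t) - - (a powr - t / t))) {a..b}"
    using assms
    by (intro fundamental_theorem_of_calculus)
       (simp_all add: has_real_derivative_iff_has_vector_derivative [symmetric]
         has_field_derivative_at_within)
  then show ?thesis by simp
qed

lemma zeta_le:
  assumes "t > 0"
  shows "zeta t \<le> ennreal (1 / t + 1)"
proof -
  have step: "real (Suc (Suc n)) powr (- 1 - t) \<le> real (Suc n) powr - t / t - real (Suc (Suc n)) powr - t / t" for n
  proof -
    have "((\<lambda>x. real (Suc (Suc n)) powr (- 1 - t)) has_integral
        (real (Suc (Suc n)) - real (Suc n)) * real (Suc (Suc n)) powr (- 1 - t)) {real (Suc n)..real (Suc (Suc n))}"
      using has_integral_const_real [of "real (Suc (Suc n)) powr (- 1 - t)" "real (Suc n)" "real (Suc (Suc n))"]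
      by simp
    moreover have "real (Suc (Suc n)) powr (- 1 - t) \<le> x powr (- 1 - t)"
      if "x \<in> {real (Suc n)..real (Suc (Suc n))}" for x
      using that assms by (intro powr_mono2') auto
    ultimately have "(real (Suc (Suc n)) - real (Suc n)) * real (Suc (Suc n)) powr (- 1 - t) \<le>
        real (Suc n) powr - t / t - real (Suc (Suc n)) powr - t / t"
      using assms by (intro has_integral_le [OF _ has_integral_powr_minus]) auto
    then show ?thesis by simp
  qed
  have "zeta t = ennreal 1 + (\<Sum>n. ennreal (real (Suc (Suc n)) powr (- 1 - t)))"
    unfolding zeta_def nn_integral_count_space_greaterThan_0
    by (subst suminf_offset [where i = 1]) auto
  also have "\<dots> \<le> ennreal 1 + ennreal (real (Suc 0) powr - t / t)"
    using assms by (intro add_left_mono suminf_ennreal_le_telescope step) auto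
  also have "\<dots> = ennreal (1 / t + 1)"
    using assms by (subst ennreal_plus [symmetric]) (auto simp: add.commute)
  finally show ?thesis .
qed

text \<open>By convexity the trapezoidal sums dominate the integral.\<close>

lemma zeta_ge:
  assumes "t > 0"
  shows "ennreal (1 / t + 1 / 2) \<le> zeta t"
proof -
  \<comment> \<open>The tail integral plus half of the next term: the difference of consecutive
    values is at most that term exactly when the trapezoid over one unit dominates the integral. The
    half term at n = 0 yields the 1/2.\<close>
  let ?F = "\<lambda>n. real (Suc n) powr - t / t + real (Suc n) powr (- 1 - t) / 2"
  have step: "?F n - ?F (Suc n) \<le> real (Suc n) powr (- 1 - t)" for n
  proof -
    let ?a = "real (Suc n)"
    have conv: "convex_on {0<..} (\<lambda>x. x powr (- 1 - t))"
      using assms by (intro convex_on_realI [where f' = "\<lambda>x. (- 1 - t) * x powr (- 1 - t - 1)"])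
        (auto intro!: derivative_eq_intros powr_mono2' mult_left_mono_neg simp: convex_real_interval)
    have le: "x powr (- 1 - t) \<le> (?a + 1 - x) * ?a powr (- 1 - t) + (x - ?a) * (?a + 1) powr (- 1 - t)"
      if "x \<in> {?a..?a + 1}" for x
      using convex_onD [OF conv, of "x - ?a" ?a "?a + 1"] that by (simp add: algebra_simps)
    let ?A = "?a powr (- 1 - t)" let ?B = "(?a + 1) powr (- 1 - t)"
    have "((\<lambda>x. (?a + 1 - x) * ?A + (x - ?a) * ?B) has_integral
        (((?a + 1) * (?a + 1) - (?a + 1)\<^sup>2 / 2) * ?A + ((?a + 1)\<^sup>2 / 2 - ?a * (?a + 1)) * ?B
          - (((?a + 1) * ?a - ?a\<^sup>2 / 2) * ?A + (?a\<^sup>2 / 2 - ?a * ?a) * ?B))) {?a..?a + 1}"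
      by (intro fundamental_theorem_of_calculus)
         (auto simp: has_real_derivative_iff_has_vector_derivative [symmetric]
               intro!: derivative_eq_intros)
    from has_integral_le [OF has_integral_powr_minus [of t ?a "?a + 1"] this le] assms
    have "?a powr - t / t - (?a + 1) powr - t / t \<le> ?A / 2 + ?B / 2"
      by (simp add: power2_eq_square field_simps)
    then show ?thesis by (simp add: add.commute)
  qed
  have "ennreal (?F 0) \<le> (\<Sum>n. ennreal (real (Suc n) powr (- 1 - t)))"
  proof (intro suminf_ennreal_ge_telescope step)
    show "?F \<longlonglongrightarrow> 0"
      using tendsto_add [OF tendsto_divide [OF powr_minus_tendsto_0 tendsto_const, of t t]
        tendsto_divide [OF powr_minus_tendsto_0 tendsto_const, of "1 + t" 2]] assms
      by simp
  qed auto
  then show ?thesis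
    by (simp add: zeta_def nn_integral_count_space_greaterThan_0)
qed

section \<open>The derivative and the logarithmic derivative of zeta\<close>

lemma has_integral_ln_powr_minus:
  fixes t a b :: real
  assumes "t > 0" "0 < a" "a \<le> b"
  shows "((\<lambda>x. ln x * x powr (- 1 - t)) has_integral
    (a powr - t * (ln a / t + 1 / t\<^sup>2) - b powr - t * (ln b / t + 1 / t\<^sup>2))) {a..b}"
proof -
  have "((\<lambda>x. - (x powr - t * (ln x / t + 1 / t\<^sup>2))) has_real_derivative ln x * x powr (- 1 - t)) (at x)"
    if "x > 0" for x :: real
  proof -
    have "((\<lambda>x. x powr - t) has_real_derivative - t * x powr (- 1 - t)) (at x)"
      using that assms by (auto intro!: derivative_eq_intros simp: minus_diff_commute)
    moreover have "((\<lambda>x. ln x / t + 1 / t\<^sup>2) has_real_derivative inverse x / t) (at x)"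
      using that assms by (auto intro!: derivative_eq_intros simp: field_simps)
    ultimately have "((\<lambda>x. - (x powr - t * (ln x / t + 1 / t\<^sup>2))) has_real_derivative
        - (- t * x powr (- 1 - t) * (ln x / t + 1 / t\<^sup>2) + inverse x / t * x powr - t)) (at x)"
      by (intro DERIV_minus DERIV_mult)
    moreover have "x powr - t = x * x powr (- 1 - t)"
      using that by (simp add: powr_mult_base)
    ultimately show ?thesis
      using that assms by (simp add: field_simps power2_eq_square)
  qed
  then have "((\<lambda>x. ln x * x powr (- 1 - t)) has_integral
      (- (b powr - t * (ln b / t + 1 / t\<^sup>2)) - - (a powr - t * (ln a / t + 1 / t\<^sup>2)))) {a..b}"
    using assms
    by (intro fundamental_theorem_of_calculus)
       (simp_all add: has_real_derivative_iff_has_vector_derivative [symmetric]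
         has_field_derivative_at_within)
  then show ?thesis by simp
qed

text \<open>The derivative has the sign of 1 - (1 + t) ln x, which is negative once x \<ge> e; 3 is
  the first integer beyond e.\<close>

lemma ln_powr_minus_antimono:
  fixes t a b :: real
  assumes "t > 0" "3 \<le> a" "a \<le> b"
  shows "ln b * b powr (- 1 - t) \<le> ln a * a powr (- 1 - t)"
proof (rule DERIV_nonpos_imp_nonincreasing [OF assms(3)])
  fix x assume "a \<le> x" "x \<le> b"
  then have x: "x \<ge> 3" using assms by simp
  have "exp 1 \<le> (3 :: real)" using exp_le by simp
  then have "1 \<le> ln x" using x by (subst ln_ge_iff) auto
  then have "1 - (1 + t) * ln x \<le> 0"
    using assms by (simp add: algebra_simps) (smt (verit) mult_nonneg_nonneg)
  moreover have "((\<lambda>x. ln x * x powr (- 1 - t)) has_real_derivative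
      x powr (- 2 - t) * (1 - (1 + t) * ln x)) (at x)"
  proof -
    have "((\<lambda>x. x powr (- 1 - t)) has_real_derivative (- 1 - t) * x powr (- 1 - t - 1)) (at x)"
      using x by (auto intro!: derivative_eq_intros)
    from DERIV_mult [OF DERIV_ln this] x
    have "((\<lambda>x. ln x * x powr (- 1 - t)) has_real_derivative
      inverse x * x powr (- 1 - t) + (- 1 - t) * x powr (- 1 - t - 1) * ln x) (at x)" by simp
    moreover have "inverse x * x powr (- 1 - t) = x powr (- 2 - t)" "- 1 - t - 1 = - 2 - t"
      using x by (simp_all add: powr_diff powr_minus field_simps power2_eq_square)
    ultimately show ?thesis by (auto elim!: DERIV_cong simp: ring_distribs)
  qed
  ultimately show "\<exists>y. ((\<lambda>x. ln x * x powr (- 1 - t)) has_real_derivative y) (at x) \<and> y \<le> 0"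
    by (intro exI conjI) (auto intro: mult_nonneg_nonpos)
qed

text \<open>Comparison with the integral works only from 3 on, where the summand decreases; the
  terms up to 3 and the integral over [1, 3] are bounded crudely. Constant errors are harmless,
  since division by zeta, which is about 1 / t, turns them into O(t).\<close>

lemma log_zeta_bounds:
  assumes "t > 0"
  shows "log_zeta t \<le> ennreal (1 / t\<^sup>2 + 2)" and "ennreal (1 / t\<^sup>2 - 4) \<le> log_zeta t"
proof -
  define f where "f x = ln x * x powr (- 1 - t)" for x :: real
  define G where "G x = x powr - t * (ln x / t + 1 / t\<^sup>2)" for x :: real
  have int: "(f has_integral (G a - G b)) {a..b}" if "0 < a" "a \<le> b" for a b
    using has_integral_ln_powr_minus [OF assms that] unfolding f_def G_def .
  have f_le: "f x \<le> (x - 1) / x" if "x \<ge> 1" for x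
  proof -
    have "f x \<le> (x - 1) * x powr - 1"
      unfolding f_def using that assms by (intro mult_mono powr_mono ln_le_minus_one) auto
    then show ?thesis using that by (simp add: powr_minus_divide)
  qed
  have f_nonneg: "0 \<le> f x" if "x \<ge> 1" for x using that by (simp add: f_def)
  have G_nonneg: "0 \<le> G x" if "x \<ge> 1" for x using that assms by (simp add: G_def)
  have step: "f (a + 1) \<le> G a - G (a + 1)" "G a - G (a + 1) \<le> f a" if "a \<ge> 3" for a
  proof -
    have "((\<lambda>x. f c) has_integral f c) {a..a + 1}" for c
      using has_integral_const_real [of "f c" a "a + 1"] by simp
    moreover have "f (a + 1) \<le> f x" "f x \<le> f a" if "x \<in> {a..a + 1}" for x
      using ln_powr_minus_antimono [OF assms] that \<open>a \<ge> 3\<close> by (auto simp: f_def)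
    ultimately show "f (a + 1) \<le> G a - G (a + 1)" "G a - G (a + 1) \<le> f a"
      using that int [of a "a + 1"] has_integral_le by (smt (verit))+
  qed
  have G1: "G 1 = 1 / t\<^sup>2" by (simp add: G_def)
  have G3: "G 3 \<le> G 1" "G 1 - G 3 \<le> 4"
  proof -
    show "G 3 \<le> G 1"
      using has_integral_nonneg [OF int [of 1 3]] f_nonneg by simp
    have "f x \<le> 2" if "x \<in> {1..3}" for x
      using order_trans [OF f_le [of x], of 2] that by (simp add: divide_le_eq)
    moreover have "((\<lambda>x. 2 :: real) has_integral 4) {1..3 :: real}"
      using has_integral_const_real [of "2 :: real" 1 3] by simp
    ultimately show "G 1 - G 3 \<le> 4"
      using has_integral_le [OF int [of 1 3]] by fastforce
  qed
  have series: "log_zeta t = (\<Sum>n. ennreal (f (real (Suc n))))"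
    unfolding log_zeta_def nn_integral_count_space_greaterThan_0 f_def
    by (simp add: ennreal_mult del: of_nat_Suc)
  have "log_zeta t = (\<Sum>n. ennreal (f (real n + 4))) + (\<Sum>n<3. ennreal (f (real (Suc n))))"
    unfolding series by (subst suminf_offset [where i = 3]) (simp_all add: add.commute)
  also have "\<dots> \<le> ennreal (G (real 0 + 3)) + (\<Sum>n<3. ennreal (f (real (Suc n))))"
  proof (intro add_right_mono suminf_ennreal_le_telescope [where F = "\<lambda>n. G (real n + 3)"])
    show "f (real n + 4) \<le> G (real n + 3) - G (real (Suc n) + 3)" for n
      using step(1) [of "real n + 3"] by (simp add: add.commute)
  qed (auto intro: f_nonneg G_nonneg)
  also have "(\<Sum>n<3. ennreal (f (real (Suc n)))) = ennreal (f 1 + f 2 + f 3)"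
    by (simp add: numeral_3_eq_3 f_nonneg ennreal_plus)
  also have "ennreal (G (real 0 + 3)) + ennreal (f 1 + f 2 + f 3) = ennreal (G 3 + (f 1 + f 2 + f 3))"
    by (simp add: f_nonneg G_nonneg ennreal_plus)
  also have "\<dots> \<le> ennreal (1 / t\<^sup>2 + 2)"
    using f_le [of 1] f_le [of 2] f_le [of 3] G3 G1 by (intro ennreal_leI) simp
  finally show "log_zeta t \<le> ennreal (1 / t\<^sup>2 + 2)" .
  have "(\<lambda>n. G (real n + 3)) \<longlonglongrightarrow> 0"
    unfolding G_def using assms by real_asymp
  then have "ennreal (G (real 0 + 3)) \<le> (\<Sum>n. ennreal (f (real n + 3)))"
  proof (intro suminf_ennreal_ge_telescope [where F = "\<lambda>n. G (real n + 3)"])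
    show "G (real n + 3) - G (real (Suc n) + 3) \<le> f (real n + 3)" for n
      using step(2) [of "real n + 3"] by (simp add: add.commute)
  qed (auto intro: f_nonneg)
  also have "\<dots> \<le> log_zeta t"
  proof -
    have "(\<Sum>n. ennreal (f (real (Suc n)))) =
        (\<Sum>n. ennreal (f (real (Suc (n + 2))))) + (\<Sum>n<2. ennreal (f (real (Suc n))))"
      by (rule suminf_offset) simp
    then show ?thesis
      unfolding series by (simp add: add.commute)
  qed
  finally have "ennreal (G 3) \<le> log_zeta t" by simp
  moreover have "ennreal (1 / t\<^sup>2 - 4) \<le> ennreal (G 3)"
    using G3 G1 by (intro ennreal_leI) simp
  ultimately show "ennreal (1 / t\<^sup>2 - 4) \<le> log_zeta t"
    by (rule order_trans [rotated])
qed

text \<open>The true expansion is 1 / t - gamma + O(t) with Euler's constant gamma. The constant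
  term matters here, because -1/2 enters the numerical inequality for rough numbers; in the lower
  bound \<open>mangoldt_zeta_ge\<close> any constant would do. The coefficient 3 makes the product
  with 1 / t + 1/2 exceed 1 / t^2 + 2.\<close>

lemma mangoldt_zeta_le:
  assumes "0 < t" "t \<le> 1"
  shows "mangoldt_zeta t \<le> ennreal (1 / t - 1 / 2 + 3 * t)"
proof -
  have "ennreal (1 / t + 1 / 2) * mangoldt_zeta t \<le> zeta t * mangoldt_zeta t"
    using zeta_ge assms by (intro mult_right_mono) auto
  also have "\<dots> = log_zeta t"
    using zeta_mult_mangoldt assms by (simp add: mult.commute)
  also have "\<dots> \<le> ennreal (1 / t\<^sup>2 + 2)"
    using log_zeta_bounds assms by auto
  finally have le: "ennreal (1 / t + 1 / 2) * mangoldt_zeta t \<le> ennreal (1 / t\<^sup>2 + 2)" .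
  have pos: "1 / t + 1 / 2 > 0" using assms by (simp add: add_pos_pos)
  have "mangoldt_zeta t = ennreal (1 / (1 / t + 1 / 2)) * (ennreal (1 / t + 1 / 2) * mangoldt_zeta t)"
    using pos by (simp add: mult.assoc [symmetric] ennreal_mult [symmetric])
  also have "\<dots> \<le> ennreal (1 / (1 / t + 1 / 2)) * ennreal (1 / t\<^sup>2 + 2)"
    by (intro mult_left_mono le) auto
  also have "\<dots> = ennreal ((1 / t\<^sup>2 + 2) / (1 / t + 1 / 2))"
    using pos by (subst ennreal_mult [symmetric]) auto
  also have "\<dots> \<le> ennreal (1 / t - 1 / 2 + 3 * t)"
  proof (rule ennreal_leI)
    have "(1 / t - 1 / 2 + 3 * t) * (1 / t + 1 / 2) = 1 / t\<^sup>2 + 11 / 4 + 3 * t / 2"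
      using assms by (simp add: field_simps power2_eq_square)
    then show "(1 / t\<^sup>2 + 2) / (1 / t + 1 / 2) \<le> 1 / t - 1 / 2 + 3 * t"
      using pos assms by (subst pos_divide_le_eq) auto
  qed
  finally show ?thesis .
qed

lemma mangoldt_zeta_ge:
  assumes "0 < t" "t \<le> 1"
  shows "ennreal (1 / t - 5) \<le> mangoldt_zeta t"
proof -
  have pos: "1 / t + 1 > 0" using assms by (simp add: add_pos_pos)
  have "ennreal (1 / t - 5) \<le> ennreal ((1 / t\<^sup>2 - 4) / (1 / t + 1))"
  proof (rule ennreal_leI)
    have "(1 / t - 5) * (1 / t + 1) = 1 / t\<^sup>2 - 4 / t - 5"
      using assms by (simp add: field_simps power2_eq_square)
    moreover have "1 / t \<ge> 1" using assms by simp
    ultimately show "1 / t - 5 \<le> (1 / t\<^sup>2 - 4) / (1 / t + 1)"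
      using pos by (subst pos_le_divide_eq) auto
  qed
  also have "\<dots> = ennreal (1 / (1 / t + 1)) * ennreal (1 / t\<^sup>2 - 4)"
    using pos by (simp add: ennreal_mult' [symmetric])
  also have "\<dots> \<le> ennreal (1 / (1 / t + 1)) * (ennreal (1 / t + 1) * mangoldt_zeta t)"
  proof (rule mult_left_mono)
    have "ennreal (1 / t\<^sup>2 - 4) \<le> zeta t * mangoldt_zeta t"
      using log_zeta_bounds zeta_mult_mangoldt assms by (simp add: mult.commute)
    also have "\<dots> \<le> ennreal (1 / t + 1) * mangoldt_zeta t"
      using zeta_le assms by (intro mult_right_mono) auto
    finally show "ennreal (1 / t\<^sup>2 - 4) \<le> ennreal (1 / t + 1) * mangoldt_zeta t" .
  qed simp
  also have "\<dots> = mangoldt_zeta t"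
    using pos by (simp add: mult.assoc [symmetric] ennreal_mult [symmetric])
  finally show ?thesis .
qed

section \<open>Sums over primes near the pole\<close>

lemma primes_above_eq: "primes_above y = {p \<in> {p. prime p}. real p > y}"
  by (auto simp: primes_above_def)

lemma prime_ge_2_real: "prime p \<Longrightarrow> (2 :: real) \<le> real p"
  using prime_ge_2_nat [of p] by simp

lemma prime_in_primes_above: "p \<in> primes_above y \<Longrightarrow> prime p"
  by (simp add: primes_above_def)

lemma nn_integral_count_space_mono_set:
  assumes "A \<subseteq> B"
  shows "(\<integral>\<^sup>+x. f x \<partial>count_space A) \<le> (\<integral>\<^sup>+x. f x \<partial>count_space B)"
proof -
  have "(\<integral>\<^sup>+x. f x \<partial>count_space A) = (\<integral>\<^sup>+x. f x * indicator A x \<partial>count_space B)"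
    using assms count_space_filter [where f = f and A = B and P = "\<lambda>x. x \<in> A"]
    by (simp add: Int_def [symmetric] Int_absorb1)
  also have "\<dots> \<le> (\<integral>\<^sup>+x. f x \<partial>count_space B)"
    by (intro nn_integral_mono) (auto simp: indicator_def)
  finally show ?thesis .
qed

lemma log_prime_zeta_mono:
  assumes "real i * (1 + s) \<le> real j * (1 + t)"
  shows "log_prime_zeta y j t \<le> log_prime_zeta y i s"
  unfolding log_prime_zeta_def using assms
  by (intro nn_integral_mono ennreal_leI mult_left_mono powr_mono)
     (auto dest!: prime_in_primes_above prime_ge_2_real)

lemma log_prime_zeta_antimono_set:
  "y \<le> y' \<Longrightarrow> log_prime_zeta y' j t \<le> log_prime_zeta y j t"
  unfolding log_prime_zeta_def
  by (intro nn_integral_count_space_mono_set) (auto simp: primes_above_def)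

lemma log_prime_zeta_1_le:
  assumes "0 < t" "t \<le> 1"
  shows "log_prime_zeta y 1 t \<le> ennreal (1 / t + 3)"
proof -
  have "log_prime_zeta y 1 t \<le> (\<integral>\<^sup>+p. ennreal (ln (real p) / (real p powr (1 + t) - 1)) \<partial>count_space (primes_above y))"
    unfolding log_prime_zeta_def
  proof (intro nn_integral_mono ennreal_leI)
    fix p assume "p \<in> space (count_space (primes_above y))"
    then have p: "2 \<le> real p" using prime_ge_2_real [OF prime_in_primes_above] by simp
    define q where "q = real p powr (1 + t)"
    have q: "q > 1"
      using powr_less_mono [of 0 "1 + t" "real p"] p assms by (simp add: q_def)
    have "real p powr - (real 1 * (1 + t)) = 1 / q"
      unfolding q_def of_nat_1 mult_1 by (rule powr_minus_divide)
    then show "ln (real p) * real p powr - (real 1 * (1 + t)) \<le> ln (real p) / (real p powr (1 + t) - 1)"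
      using p q unfolding q_def [symmetric] by (simp add: frac_le)
  qed
  also have "\<dots> \<le> mangoldt_zeta t"
    unfolding mangoldt_zeta_def
    by (intro nn_integral_count_space_mono_set) (auto simp: primes_above_def)
  also have "\<dots> \<le> ennreal (1 / t - 1 / 2 + 3 * t)"
    using assms by (rule mangoldt_zeta_le)
  also have "\<dots> \<le> ennreal (1 / t + 3)"
    using assms by (intro ennreal_leI) simp
  finally show ?thesis .
qed

text \<open>All but one of the j factors p^(-(1+t)) are replaced by their value at the least prime;
  the remaining factor keeps the sum over p convergent.\<close>

lemma log_prime_zeta_le_geometric:
  assumes b: "\<And>p. p \<in> primes_above y \<Longrightarrow> b \<le> real p" "b > 0" and t: "t \<ge> 0" and j: "j \<ge> 1"
  shows "log_prime_zeta y j t \<le> ennreal ((b powr - (1 + t)) ^ (j - 1)) * log_prime_zeta y 1 t"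
proof -
  have "log_prime_zeta y j t \<le>
    (\<integral>\<^sup>+p. ennreal ((b powr - (1 + t)) ^ (j - 1)) * ennreal (ln (real p) * real p powr - (real 1 * (1 + t)))
       \<partial>count_space (primes_above y))"
    unfolding log_prime_zeta_def
  proof (intro nn_integral_mono)
    fix p assume "p \<in> space (count_space (primes_above y))"
    then have p: "b \<le> real p" "2 \<le> real p"
      using b prime_ge_2_real [OF prime_in_primes_above] by auto
    have "real p powr - (real j * (1 + t)) =
        real p powr (real (j - 1) * - (1 + t)) * real p powr - (real 1 * (1 + t))"
      using j by (subst powr_add [symmetric]) (simp add: of_nat_diff algebra_simps)
    also have "real p powr (real (j - 1) * - (1 + t)) = (real p powr - (1 + t)) ^ (j - 1)"
      using p by (subst powr_power) (auto simp: mult.commute)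
    also have "\<dots> \<le> (b powr - (1 + t)) ^ (j - 1)"
      using p b t by (intro power_mono powr_mono2') auto
    finally have "real p powr - (real j * (1 + t)) \<le>
        (b powr - (1 + t)) ^ (j - 1) * real p powr - (real 1 * (1 + t))"
      by (simp add: mult_right_mono)
    then have "ln (real p) * real p powr - (real j * (1 + t)) \<le>
        (b powr - (1 + t)) ^ (j - 1) * (ln (real p) * real p powr - (real 1 * (1 + t)))"
      using p by (simp only: mult.left_commute [of _ "ln (real p)"]) (intro mult_left_mono, auto)
    then show "ennreal (ln (real p) * real p powr - (real j * (1 + t))) \<le>
        ennreal ((b powr - (1 + t)) ^ (j - 1)) * ennreal (ln (real p) * real p powr - (real 1 * (1 + t)))"
      using p by (subst ennreal_mult [symmetric]) (auto intro!: ennreal_leI)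
  qed
  then show ?thesis
    by (simp add: nn_integral_cmult log_prime_zeta_def)
qed

text \<open>Passing from -zeta'/zeta to L_1 loses the finitely many primes up to y and the higher
  prime powers, whose total is bounded uniformly down to t = 0. Hence L_1 has the full pole of zeta
  up to a constant.\<close>

lemma log_prime_zeta_ge:
  obtains H where "H \<ge> 0" "\<And>t. 0 < t \<Longrightarrow> t \<le> 1 \<Longrightarrow> ennreal (1 / t) \<le> log_prime_zeta y 1 t + ennreal H"
proof -
  define S where "S = {p. prime p \<and> real p \<le> y}"
  have "finite S"
    by (rule finite_subset [of _ "{..nat \<lfloor>y\<rfloor>}"]) (auto simp: S_def le_nat_floor)
  \<comment> \<open>The 6 bounds twice the sum of ln n / n^2, which covers the higher prime powers;
    the 5 is the constant in \<open>mangoldt_zeta_ge\<close>.\<close>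
  define H where "H = (\<Sum>p\<in>S. ln (real p)) + 6 + 5"
  have ln_nonneg: "0 \<le> ln (real p)" if "p \<in> S" for p
    using that prime_ge_2_real [of p] by (simp add: S_def)
  have H: "H \<ge> 0" by (auto simp: H_def intro!: add_nonneg_nonneg sum_nonneg ln_nonneg)
  have "ennreal (1 / t) \<le> log_prime_zeta y 1 t + ennreal H" if t: "0 < t" "t \<le> 1" for t
  proof -
    have "mangoldt_zeta t \<le> (\<integral>\<^sup>+p.
        ennreal (ln (real p) * real p powr - (real 1 * (1 + t))) * indicator {p. real p > y} p +
        (ennreal (ln (real p)) * indicator S p +
        2 * (ennreal (ln (real p)) * ennreal (real p powr (- 1 - 1)))) \<partial>count_space {p. prime p})"
      unfolding mangoldt_zeta_def
    proof (intro nn_integral_mono)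
      fix p assume "p \<in> space (count_space {p :: nat. prime p})"
      then have p: "prime p" "2 \<le> real p" using prime_ge_2_real by auto
      define q where "q = real p powr (1 + t)"
      have pq: "real p \<le> q"
        using powr_mono [of 1 "1 + t" "real p"] p t by (simp add: q_def)
      then have q: "2 \<le> q" using p by simp
      have "1 / (q - 1) = 1 / q + 1 / (q * (q - 1))"
        using q by (simp add: field_simps)
      also have "1 / (q * (q - 1)) \<le> 2 / (real p)\<^sup>2"
      proof -
        have "(real p)\<^sup>2 \<le> q * q"
          using pq p by (simp add: power2_eq_square mult_mono)
        also have "\<dots> \<le> q * (2 * (q - 1))"
          using q by (intro mult_left_mono) auto
        finally show ?thesis using q p by (simp add: field_simps)
      qed
      finally have "ln (real p) * (1 / (q - 1)) \<le> ln (real p) * (1 / q + 2 / (real p)\<^sup>2)"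
        using p by (intro mult_left_mono) auto
      moreover have "1 / q \<le> 1" using q by simp
      then have "ln (real p) * (1 / q) \<le> ln (real p) * 1" using p by (intro mult_left_mono) auto
      moreover have "real p powr (- 1 - 1) = 1 / (real p)\<^sup>2"
        using p by (simp add: powr_minus_divide)
      moreover have "real p powr - (1 + t) = 1 / q"
        unfolding q_def by (rule powr_minus_divide)
      ultimately show "ennreal (ln (real p) / (real p powr (1 + t) - 1)) \<le>
        ennreal (ln (real p) * real p powr - (real 1 * (1 + t))) * indicator {p. real p > y} p +
        (ennreal (ln (real p)) * indicator S p +
        2 * (ennreal (ln (real p)) * ennreal (real p powr (- 1 - 1))))"
        using p q
        by (auto simp: S_def indicator_def q_def [symmetric] distrib_left mult.commute [of _ 2]
              simp del: minus_add_distrib ennreal_plus ennreal_numeral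
              simp flip: ennreal_mult ennreal_plus ennreal_numeral intro!: ennreal_leI)
    qed
    also have "\<dots> = log_prime_zeta y 1 t +
        ((\<integral>\<^sup>+p. ennreal (ln (real p)) * indicator S p \<partial>count_space {p. prime p}) +
        2 * (\<integral>\<^sup>+p. ennreal (ln (real p)) * ennreal (real p powr (- 1 - 1)) \<partial>count_space {p. prime p}))"
      unfolding log_prime_zeta_def primes_above_eq count_space_filter
      by (subst nn_integral_add, simp, simp, subst nn_integral_add) (simp_all add: nn_integral_cmult)
    also have "(\<integral>\<^sup>+p. ennreal (ln (real p)) * indicator S p \<partial>count_space {p. prime p})
        = (\<Sum>p\<in>S. ennreal (ln (real p)) * indicator S p)"
      using \<open>finite S\<close> by (intro nn_integral_count_space') (auto simp: S_def)
    also have "\<dots> = ennreal (\<Sum>p\<in>S. ln (real p))"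
      by (simp add: sum_ennreal ln_nonneg)
    also have "(\<integral>\<^sup>+p. ennreal (ln (real p)) * ennreal (real p powr (- 1 - 1)) \<partial>count_space {p. prime p})
        \<le> log_zeta 1"
      unfolding log_zeta_def
      by (intro nn_integral_count_space_mono_set) (auto simp: prime_gt_0_nat)
    also have "log_zeta 1 \<le> ennreal 3"
      using log_zeta_bounds(1) [of 1] by simp
    finally have "mangoldt_zeta t \<le> log_prime_zeta y 1 t + (ennreal (\<Sum>p\<in>S. ln (real p)) + 2 * ennreal 3)"
      by (simp add: add_left_mono mult_left_mono)
    also have "ennreal (\<Sum>p\<in>S. ln (real p)) + 2 * ennreal 3 = ennreal (H - 5)"
      by (simp add: H_def ennreal_plus sum_nonneg ln_nonneg flip: ennreal_numeral ennreal_mult)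
    finally have "mangoldt_zeta t \<le> log_prime_zeta y 1 t + ennreal (H - 5)" .
    \<comment> \<open>\<open>ennreal\<close> sends negative numbers to 0, so the case 1 / t < 5 has
      to be treated separately.\<close>
    moreover have "ennreal (1 / t) \<le> ennreal (1 / t - 5) + ennreal 5"
    proof (cases "1 / t \<ge> 5")
      case True
      then show ?thesis by (subst ennreal_plus [symmetric]) auto
    next
      case False
      then have "ennreal (1 / t) \<le> ennreal 5" by (intro ennreal_leI) simp
      then show ?thesis by (rule add_increasing [rotated]) simp
    qed
    ultimately have "ennreal (1 / t) \<le> log_prime_zeta y 1 t + ennreal (H - 5) + ennreal 5"
      using mangoldt_zeta_ge [OF t] by (meson add_right_mono order_trans)
    also have "\<dots> = log_prime_zeta y 1 t + ennreal H"
      by (subst add.assoc, subst ennreal_plus [symmetric])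
         (auto simp: H_def sum_nonneg ln_nonneg)
    finally show ?thesis .
  qed
  with H show ?thesis by (rule that)
qed

section \<open>Higher prime powers and the numerical inequality\<close>

text \<open>
  The moments below decrease at most by a factor \<open>tail_ratio\<close> per level. The true factor tends
  to 2; the value 2.01 is close enough to 2 for the numerical inequality
  in \<open>log_prime_zeta_tail_weight_le\<close>.
\<close>

definition tail_ratio :: real where "tail_ratio = 201 / 100"

text \<open>With r = \<open>tail_ratio\<close>, the fraction is the sum of p^(-j) * r^(j-1) over j
  \<ge> 2. So this is the sum of L_j(0) * r^(j-1), an upper bound for the total of L_j(0) * X_(k-j)
  / X_(k-1). The geometric series converges for p > r, that is for all odd primes but not for
  2.\<close>

definition tail_weight :: "real \<Rightarrow> ennreal" where
  "tail_weight y = (\<integral>\<^sup>+p. ennreal (ln (real p) * (tail_ratio / (real p * (real p - tail_ratio))))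
     \<partial>count_space (primes_above y))"

lemma odd_prime_ge_3: "2 \<le> y \<Longrightarrow> p \<in> primes_above y \<Longrightarrow> 3 \<le> p"
  by (simp add: primes_above_def)

lemma sum_log_prime_zeta_le_tail_weight:
  assumes "2 \<le> y"
  shows "(\<Sum>j=2..k. log_prime_zeta y j 0 * ennreal (tail_ratio ^ (j - 1))) \<le> tail_weight y"
proof -
  have "(\<Sum>j=2..k. log_prime_zeta y j 0 * ennreal (tail_ratio ^ (j - 1))) =
     (\<integral>\<^sup>+p. (\<Sum>j=2..k. ennreal (ln (real p) * real p powr - (real j * (1 + 0))) * ennreal (tail_ratio ^ (j - 1)))
        \<partial>count_space (primes_above y))"
    by (simp add: log_prime_zeta_def nn_integral_sum nn_integral_multc)
  also have "\<dots> \<le> tail_weight y"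
    unfolding tail_weight_def
  proof (intro nn_integral_mono)
    fix p assume "p \<in> space (count_space (primes_above y))"
    then have p: "3 \<le> real p" using odd_prime_ge_3 [OF assms, of p] by simp
    define r where "r = tail_ratio"
    have r: "r > 0" "r < 3" by (simp_all add: r_def tail_ratio_def)
    define x where "x = r / real p"
    have x: "0 < x" "x < 1" using p r by (simp_all add: x_def)
    have "(\<Sum>j=2..k. real p powr - (real j * (1 + 0)) * r ^ (j - 1)) = (\<Sum>j=2..k. x ^ j / r)"
    proof (intro sum.cong refl)
      fix j assume "j \<in> {2..k}"
      then have "r ^ (j - 1) = r ^ j / r"
        using r by (simp add: power_diff)
      moreover have "real p powr - (real j * (1 + 0)) = 1 / real p ^ j"
        using p by (simp add: powr_minus_divide powr_realpow)
      ultimately show "real p powr - (real j * (1 + 0)) * r ^ (j - 1) = x ^ j / r"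
        by (simp add: x_def power_divide)
    qed
    also have "\<dots> = (\<Sum>j=2..k. x ^ j) / r" by (simp add: sum_divide_distrib)
    also have "(\<Sum>j=2..k. x ^ j) \<le> x\<^sup>2 / (1 - x)"
    proof (cases "k \<ge> 2")
      case True
      have "(\<Sum>j=2..k. x ^ j) = (x\<^sup>2 - x ^ Suc k) / (1 - x)"
        using sum_gp [of x 2 k] True x by simp
      then show ?thesis using x by (simp add: divide_right_mono)
    qed (use x in auto)
    also have "x\<^sup>2 / (1 - x) / r = r / (real p * (real p - r))"
      using p r by (simp add: x_def field_simps power2_eq_square)
    finally have "(\<Sum>j=2..k. real p powr - (real j * (1 + 0)) * r ^ (j - 1)) \<le> r / (real p * (real p - r))"
      using r by (simp add: divide_right_mono)
    then have "ln (real p) * (\<Sum>j=2..k. real p powr - (real j * (1 + 0)) * r ^ (j - 1)) \<le>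
        ln (real p) * (r / (real p * (real p - r)))"
      using p by (intro mult_left_mono) auto
    moreover have "(\<Sum>j=2..k. ennreal (ln (real p) * real p powr - (real j * (1 + 0))) * ennreal (r ^ (j - 1)))
       = ennreal (ln (real p) * (\<Sum>j=2..k. real p powr - (real j * (1 + 0)) * r ^ (j - 1)))"
      using p r by (simp add: ennreal_mult'' [symmetric] sum_ennreal sum_distrib_left mult.assoc)
    ultimately show "(\<Sum>j=2..k. ennreal (ln (real p) * real p powr - (real j * (1 + 0))) * ennreal (tail_ratio ^ (j - 1)))
       \<le> ennreal (ln (real p) * (tail_ratio / (real p * (real p - tail_ratio))))"
      unfolding r_def by (simp add: ennreal_leI)
  qed
  finally show ?thesis .
qed

lemma exp_1_ge: "(2718 / 1000 :: real) \<le> exp 1"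
proof -
  have "(\<Sum>n<8. 1 ^ n /\<^sub>R fact n) \<le> exp (1 :: real)"
    unfolding exp_def by (intro sum_le_suminf summable_exp_generic) auto
  then show ?thesis by (simp add: eval_nat_numeral fact_numeral)
qed

text \<open>Reduces a numerical bound for a logarithm to a comparison of rational powers.\<close>

lemma ln_le_by_powers:
  assumes "x > 0" "m > 0" "x ^ m \<le> (2718 / 1000) ^ n"
  shows "ln x \<le> real n / real m"
proof -
  have "x ^ m \<le> exp 1 ^ n"
    using assms(3) power_mono [OF exp_1_ge, of n] by simp
  then have "real m * ln x \<le> real n"
    using assms(1) ln_mono [of "x ^ m" "exp 1 ^ n"] by (simp add: ln_realpow)
  then show ?thesis using assms(2) by (simp add: field_simps)
qed

text \<open>Primes from 11 on are enlarged to all odd numbers. Since 2 / (x (x - 2)) = 1 / (x - 2) -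
  1 / x telescopes in steps of 2, summation by parts suggests ln x / (x - 2); the added 1 in the
  numerator absorbs the increment ln (x + 2) - ln x \<le> 2 / x.\<close>

lemma odd_tail_sum_le:
  "(\<Sum>n. ennreal (ln (real (2 * n + 11)) * (2 / (real (2 * n + 11) * (real (2 * n + 11) - 2)))))
     \<le> ennreal ((ln 11 + 1) / 9)"
proof -
  define F where "F n = (ln (real (2 * n + 11)) + 1) / (real (2 * n + 11) - 2)" for n
  have "(\<Sum>n. ennreal (ln (real (2 * n + 11)) * (2 / (real (2 * n + 11) * (real (2 * n + 11) - 2)))))
     \<le> ennreal (F 0)"
  proof (intro suminf_ennreal_le_telescope)
    fix n
    define x where "x = real (2 * n + 11)"
    have x: "x \<ge> 11" by (simp add: x_def)
    have next_x: "real (2 * Suc n + 11) = x + 2" by (simp add: x_def)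
    have "ln (x + 2) - ln x \<le> 2 / x"
      using ln_diff_le [of "x + 2" x] x by simp
    then have "(ln (x + 2) + 1) / x \<le> (ln x + 2 / x + 1) / x"
      using x by (intro divide_right_mono) auto
    also have "\<dots> = (ln x + 1) / x + 2 / (x * x)" using x by (simp add: field_simps)
    also have "2 / (x * x) \<le> 2 / (x * (x - 2))"
      using x by (intro divide_left_mono mult_left_mono mult_pos_pos) auto
    also have "(ln x + 1) / x + 2 / (x * (x - 2)) = (ln x + 1) / (x - 2) - ln x * (2 / (x * (x - 2)))"
    proof -
      have "x \<noteq> 0" "x - 2 \<noteq> 0" using x by auto
      then show ?thesis by (simp add: divide_simps) (simp add: algebra_simps)
    qed
    finally show "ln (real (2 * n + 11)) * (2 / (real (2 * n + 11) * (real (2 * n + 11) - 2)))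
        \<le> F n - F (Suc n)"
      unfolding F_def next_x x_def [symmetric] by simp
  qed (auto simp: F_def)
  then show ?thesis by (simp add: F_def)
qed

lemma nn_integral_count_space_Un_le:
  "(\<integral>\<^sup>+x. f x \<partial>count_space (A \<union> B)) \<le>
     (\<integral>\<^sup>+x. f x \<partial>count_space A) + (\<integral>\<^sup>+x. f x \<partial>count_space B)"
proof -
  have eq: "{x \<in> A \<union> B. x \<in> A} = A" "{x \<in> A \<union> B. x \<in> B} = B" by auto
  have "(\<integral>\<^sup>+x. f x \<partial>count_space (A \<union> B)) \<le>
      (\<integral>\<^sup>+x. f x * indicator {x. x \<in> A} x + f x * indicator {x. x \<in> B} x \<partial>count_space (A \<union> B))"
    by (intro nn_integral_mono) (auto simp: indicator_def)
  also have "\<dots> = (\<integral>\<^sup>+x. f x * indicator {x. x \<in> A} x \<partial>count_space (A \<union> B)) +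
      (\<integral>\<^sup>+x. f x * indicator {x. x \<in> B} x \<partial>count_space (A \<union> B))"
    by (rule nn_integral_add) auto
  also have "\<dots> = (\<integral>\<^sup>+x. f x \<partial>count_space A) + (\<integral>\<^sup>+x. f x \<partial>count_space B)"
    unfolding count_space_filter [symmetric] eq ..
  finally show ?thesis .
qed

text \<open>The primes 3, 5, 7 dominate and are kept exactly: 201/297, 201/1495 and 201/3493 are the
  values of r / (p (p - r)) for r = 2.01. From 11 on, replacing r by 2 costs at most a factor
  1.01.\<close>

lemma tail_weight_2_le:
  "tail_weight 2 \<le> ennreal (ln 3 * (201 / 297) + ln 5 * (201 / 1495) + ln 7 * (201 / 3493)
      + 101 / 100 * ((ln 11 + 1) / 9))"
proof -
  define f where "f n = ln (real n) * (tail_ratio / (real n * (real n - tail_ratio)))" for n :: nat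
  have prime_cases: "p \<in> {3, 5, 7} \<or> (\<exists>n. p = 2 * n + 11)" if "p \<in> primes_above 2" for p
  proof -
    have p: "prime p" "p > 2" using that by (auto simp: primes_above_def)
    then have "odd p" using prime_odd_nat by auto
    moreover have "p \<noteq> 9" using p by (auto simp: prime_nat_iff dest: spec [of _ 3])
    ultimately have "p \<in> {3, 5, 7} \<or> p \<ge> 11" using p by (auto elim!: oddE)
    moreover have "\<exists>n. p = 2 * n + 11" if "p \<ge> 11"
      using that \<open>odd p\<close> by presburger
    ultimately show ?thesis by blast
  qed
  have "tail_weight 2 \<le> (\<integral>\<^sup>+p. ennreal (f p) \<partial>count_space ({3, 5, 7} \<union> range (\<lambda>n. 2 * n + 11)))"
    unfolding tail_weight_def f_def [symmetric]
    using prime_cases by (intro nn_integral_count_space_mono_set) blast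
  also have "\<dots> \<le> (\<integral>\<^sup>+p. ennreal (f p) \<partial>count_space {3, 5, 7}) +
      (\<integral>\<^sup>+p. ennreal (f p) \<partial>count_space (range (\<lambda>n. 2 * n + 11)))"
    by (rule nn_integral_count_space_Un_le)
  also have "(\<integral>\<^sup>+p. ennreal (f p) \<partial>count_space {3, 5, 7}) = ennreal (f 3 + f 5 + f 7)"
    by (simp add: nn_integral_count_space_finite f_def tail_ratio_def ennreal_plus add.assoc)
  also have "(\<integral>\<^sup>+p. ennreal (f p) \<partial>count_space (range (\<lambda>n. 2 * n + 11))) =
      (\<Sum>n. ennreal (f (2 * n + 11)))"
    by (subst nn_integral_count_space_nat [symmetric], rule nn_integral_bij_count_space [symmetric])
       (auto simp: bij_betw_def inj_on_def)
  also have "\<dots> \<le> (\<Sum>n. ennreal (101 / 100) *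
      ennreal (ln (real (2 * n + 11)) * (2 / (real (2 * n + 11) * (real (2 * n + 11) - 2)))))"
  proof (intro suminf_le)
    fix n
    define x where "x = real (2 * n + 11)"
    have x: "x \<ge> 11" by (simp add: x_def)
    have "tail_ratio / (x * (x - tail_ratio)) \<le> 101 / 100 * (2 / (x * (x - 2)))"
      using x by (simp add: tail_ratio_def field_simps)
    then have "ln x * (tail_ratio / (x * (x - tail_ratio))) \<le> ln x * (101 / 100 * (2 / (x * (x - 2))))"
      using x by (intro mult_left_mono) auto
    then show "ennreal (f (2 * n + 11)) \<le> ennreal (101 / 100) *
      ennreal (ln (real (2 * n + 11)) * (2 / (real (2 * n + 11) * (real (2 * n + 11) - 2))))"
      unfolding f_def x_def [symmetric]
      using x by (subst ennreal_mult [symmetric]) (auto intro!: ennreal_leI)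
  qed auto
  also have "\<dots> \<le> ennreal (101 / 100) * ennreal ((ln 11 + 1) / 9)"
    by (subst ennreal_suminf_cmult) (intro mult_left_mono odd_tail_sum_le, simp)
  also have "ennreal (f 3 + f 5 + f 7) + \<dots> =
      ennreal (ln 3 * (201 / 297) + ln 5 * (201 / 1495) + ln 7 * (201 / 3493)
      + 101 / 100 * ((ln 11 + 1) / 9))"
    by (simp add: ennreal_mult [symmetric] ennreal_plus [symmetric] f_def tail_ratio_def
          del: ennreal_plus)
  finally show ?thesis by (simp add: add_left_mono)
qed

text \<open>Of the difference between -zeta'/zeta and L_1 over odd primes, only the prime 2 and the
  higher powers of 3, 5 and 7 are retained; that is enough for the numerical inequality.
  \<open>b p\<close> collects the powers p^j with j \<ge> 2, because 1 / (q - 1) = 1 / q + 1 / (q (q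
  - 1)).\<close>

lemma log_prime_zeta_2_le:
  assumes t: "0 < t" "t \<le> 1"
  defines "b \<equiv> \<lambda>p. ln p * (1 / (p powr (1 + t) * (p powr (1 + t) - 1)))"
  shows "log_prime_zeta 2 1 t + ennreal (ln 2 / (2 powr (1 + t) - 1) + (b 3 + b 5 + b 7))
    \<le> mangoldt_zeta t"
proof -
  define h where "h p = (if p = 2 then ln 2 / (2 powr (1 + t) - 1)
      else if p \<in> {3, 5, 7} then b (real p) else 0)" for p :: nat
  have gt: "1 < p powr (1 + t)" if "p > 1" for p :: real
    using powr_less_mono [of 0 "1 + t" p] that t by simp
  have h_nonneg: "0 \<le> h p" for p
    using gt by (auto simp: h_def b_def intro!: divide_nonneg_nonneg mult_nonneg_nonneg less_imp_le)
  have primes: "{2, 3, 5, 7} \<subseteq> {p :: nat. prime p}" by simp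
  have "(\<integral>\<^sup>+p. ennreal (h p) \<partial>count_space {p. prime p}) = (\<Sum>p\<in>{2, 3, 5, 7}. ennreal (h p))"
    using primes by (intro nn_integral_count_space') (auto simp: h_def)
  also have "\<dots> = ennreal (\<Sum>p\<in>{2, 3, 5, 7}. h p)"
    by (rule sum_ennreal) (rule h_nonneg)
  also have "(\<Sum>p\<in>{2, 3, 5, 7}. h p) = ln 2 / (2 powr (1 + t) - 1) + (b 3 + b 5 + b 7)"
    by (simp add: h_def)
  finally have "log_prime_zeta 2 1 t + ennreal (ln 2 / (2 powr (1 + t) - 1) + (b 3 + b 5 + b 7)) =
    (\<integral>\<^sup>+p. ennreal (ln (real p) * real p powr - (real 1 * (1 + t))) * indicator {p. real p > 2} p
      + ennreal (h p) \<partial>count_space {p. prime p})"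
    unfolding log_prime_zeta_def primes_above_eq count_space_filter
    by (subst nn_integral_add) simp_all
  also have "\<dots> \<le> mangoldt_zeta t"
    unfolding mangoldt_zeta_def
  proof (intro nn_integral_mono)
    fix p assume "p \<in> space (count_space {p :: nat. prime p})"
    then have p: "2 \<le> real p" using prime_ge_2_real by auto
    define q where "q = real p powr (1 + t)"
    have q: "q > 1" using gt p by (simp add: q_def)
    have inv: "real p powr - (1 + t) = 1 / q"
      unfolding q_def by (rule powr_minus_divide)
    have split: "ln (real p) / (q - 1) = ln (real p) * (1 / q) + ln (real p) * (1 / (q * (q - 1)))"
      using q by (simp add: field_simps)
    have "ln (real p) * (1 / (q * (q - 1))) \<ge> 0" using p q by simp
    then have "ln (real p) * (1 / q) * indicator {p. real p > 2} p + h p \<le> ln (real p) / (q - 1)"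
      using p split by (cases "p = 2") (auto simp: h_def b_def q_def)
    then have "ennreal (ln (real p) * (1 / q) * indicator {p. real p > 2} p + h p) \<le>
        ennreal (ln (real p) / (q - 1))"
      by (rule ennreal_leI)
    then show "ennreal (ln (real p) * real p powr - (real 1 * (1 + t))) * indicator {p. real p > 2} p
        + ennreal (h p) \<le> ennreal (ln (real p) / (real p powr (1 + t) - 1))"
      unfolding mult_1 of_nat_1 inv q_def [symmetric]
      using p q h_nonneg [of p] by (cases "real p > 2") (simp_all add: ennreal_plus)
  qed
  finally show ?thesis .
qed

text \<open>
  The positivity on which the monotonicity for rough numbers rests. At \<open>t = 0\<close>, with
  ratio 2 and Euler's constant bounded below by \<open>1/2\<close>, it says that the sum of \<open>ln p / (p - 1)\<close>
  over \<open>p \<le> y\<close> plus \<open>1/2\<close> exceeds the sum of \<open>ln p / ((p - 1) (p - 2))\<close> over \<open>p > y\<close>.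
\<close>

lemma log_prime_zeta_tail_weight_le:
  assumes "2 \<le> y"
  obtains d where "0 < d" "d \<le> 1"
    "\<And>t. 0 < t \<Longrightarrow> t \<le> d \<Longrightarrow>
       log_prime_zeta y 1 t + tail_weight y + ennreal (1 / 100) \<le> ennreal (1 / t)"
proof -
  define T where "T = ln 3 * (201 / 297) + ln 5 * (201 / 1495) + ln 7 * (201 / 3493)
      + 101 / 100 * ((ln 11 + 1) / 9 :: real)"
  define b where "b t p = ln p * (1 / (p powr (1 + t) * (p powr (1 + t) - 1)))" for t p :: real
  define g where "g t = 1 / 2 - 3 * t + (ln 2 / (2 powr (1 + t) - 1) + (b t 3 + b t 5 + b t 7))" for t :: real
  have T: "T \<ge> 0" by (simp add: T_def)
  \<comment> \<open>In truth about 1.463 against 1.503. The coefficients of ln 3, ln 5 and ln 7 are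
    larger in \<open>T\<close> than in \<open>g 0\<close>, so upper bounds for these logarithms and
    a lower bound for ln 2 suffice.\<close>
  have "T + 1 / 100 < g 0"
  proof -
    have g0: "g 0 = 1 / 2 + (ln 2 + (ln 3 / 6 + ln 5 / 20 + ln 7 / 42))"
      by (simp add: g_def b_def)
    have "ln 2 \<ge> (2 / 3 :: real)" by (rule ln2_ge_two_thirds)
    moreover have "ln 3 \<le> (11 / 10 :: real)"
      using ln_le_by_powers [of 3 10 11] by (simp add: power_divide)
    moreover have "ln 5 \<le> (13 / 8 :: real)"
      using ln_le_by_powers [of 5 8 13] by (simp add: power_divide)
    moreover have "ln 7 \<le> (2 :: real)"
      using ln_le_by_powers [of 7 1 2] by (simp add: power_divide)
    moreover have "ln 11 \<le> (12 / 5 :: real)"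
      using ln_le_by_powers [of 11 5 12] by (simp add: power_divide)
    ultimately show ?thesis unfolding T_def g0 by (simp add: field_simps)
  qed
  moreover have "(g \<longlongrightarrow> g 0) (at_right 0)"
    unfolding g_def b_def by (intro tendsto_intros) auto
  ultimately have "\<forall>\<^sub>F t in at_right 0. T + 1 / 100 < g t"
    by (auto simp: order_tendsto_iff)
  \<comment> \<open>For t < 1/6 the number 1/2 - 3t is positive, so it can be moved across the
    inequality inside \<open>ennreal\<close>.\<close>
  moreover have "\<forall>\<^sub>F t in at_right (0 :: real). t < 1 / 6"
    by (rule order_tendstoD(2) [of _ 0]) (auto intro: tendsto_eq_intros)
  ultimately have "\<forall>\<^sub>F t in at_right 0. T + 1 / 100 < g t \<and> t < 1 / 6"
    by (rule eventually_conj)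
  then obtain e where e: "e > 0" "\<And>t. 0 < t \<Longrightarrow> t < e \<Longrightarrow> T + 1 / 100 < g t \<and> t < 1 / 6"
    unfolding eventually_at_right_field by auto
  define d where "d = min (e / 2) 1"
  have d: "0 < d" "d \<le> 1" "d < e" using e(1) by (auto simp: d_def)
  have "log_prime_zeta y 1 t + tail_weight y + ennreal (1 / 100) \<le> ennreal (1 / t)"
    if t: "0 < t" "t \<le> d" for t
  proof -
    have et: "T + 1 / 100 < g t" "t < 1 / 6" using e(2) [of t] t d by auto
    have "tail_weight y \<le> tail_weight 2"
      unfolding tail_weight_def using assms
      by (intro nn_integral_count_space_mono_set) (auto simp: primes_above_def)
    also have "\<dots> \<le> ennreal T" unfolding T_def by (rule tail_weight_2_le)
    finally have "log_prime_zeta y 1 t + tail_weight y + ennreal (1 / 100)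
        \<le> log_prime_zeta 2 1 t + ennreal T + ennreal (1 / 100)"
      using log_prime_zeta_antimono_set [OF assms] by (intro add_mono) auto
    also have "\<dots> = log_prime_zeta 2 1 t + ennreal (T + 1 / 100)"
      using T by (simp add: add.assoc ennreal_plus)
    also have "\<dots> \<le> log_prime_zeta 2 1 t + ennreal (g t)"
      using et by (intro add_left_mono ennreal_leI) simp
    also have "ennreal (g t) = ennreal (ln 2 / (2 powr (1 + t) - 1) + (b t 3 + b t 5 + b t 7))
        + ennreal (1 / 2 - 3 * t)"
    proof -
      have "1 < p powr (1 + t)" if "p > 1" for p :: real
        using powr_less_mono [of 0 "1 + t" p] that t by simp
      then have "0 \<le> ln 2 / (2 powr (1 + t) - 1) + (b t 3 + b t 5 + b t 7)"
        unfolding b_def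
        by (intro add_nonneg_nonneg divide_nonneg_nonneg mult_nonneg_nonneg) (auto intro: less_imp_le)
      then show ?thesis
        using et by (subst ennreal_plus [symmetric]) (auto simp: g_def add.commute)
    qed
    also have "log_prime_zeta 2 1 t + \<dots> \<le> mangoldt_zeta t + ennreal (1 / 2 - 3 * t)"
      using log_prime_zeta_2_le [of t] t d
      unfolding add.assoc [symmetric] b_def by (intro add_right_mono) auto
    also have "\<dots> \<le> ennreal (1 / t - 1 / 2 + 3 * t) + ennreal (1 / 2 - 3 * t)"
      using t d by (intro add_right_mono mangoldt_zeta_le) auto
    also have "\<dots> = ennreal (1 / t)"
    proof -
      have "1 / t \<ge> 1" using t d by simp
      then show ?thesis using t et by (subst ennreal_plus [symmetric]) auto
    qed
    finally show ?thesis .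
  qed
  with d(1,2) show ?thesis by (rule that)
qed

text \<open>Read off from the inequality just proved at the single point t = d.\<close>

lemma tail_weight_finite:
  assumes "2 \<le> y"
  shows "tail_weight y < \<infinity>"
proof -
  obtain d where d: "0 < d" "\<And>t. 0 < t \<Longrightarrow> t \<le> d \<Longrightarrow>
       log_prime_zeta y 1 t + tail_weight y + ennreal (1 / 100) \<le> ennreal (1 / t)"
    using log_prime_zeta_tail_weight_le [OF assms] by blast
  have "tail_weight y \<le> log_prime_zeta y 1 d + (tail_weight y + ennreal (1 / 100))"
    by (intro add_increasing add_increasing2) auto
  also have "\<dots> \<le> ennreal (1 / d)"
    using d(2) [of d] d(1) by (simp only: add.assoc order_refl)
  finally show ?thesis by (rule le_less_trans) simp
qed

section \<open>Level sums\<close>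

lemma rough_level_0: "rough_level y 0 = {1}"
  by (auto simp: rough_level_def rough_def big_Omega_def prime_factorization_empty_iff)

lemma zeta_level_0 [simp]: "zeta_level y 0 t = 1"
  by (simp add: zeta_level_def rough_level_0 nn_integral_count_space_finite)

lemma zeta_level_antimono: "s \<le> t \<Longrightarrow> zeta_level y k t \<le> zeta_level y k s"
  unfolding zeta_level_def
  by (intro nn_integral_mono ennreal_leI powr_mono) (auto dest: rough_level_pos)

lemma zeta_level_finite: "t > 0 \<Longrightarrow> zeta_level y k t < \<infinity>"
proof -
  assume t: "t > 0"
  have "zeta_level y k t \<le> zeta t"
    unfolding zeta_level_def zeta_def
    by (intro nn_integral_count_space_mono_set) (auto dest: rough_level_pos)
  also have "\<dots> < \<infinity>" using zeta_le [OF t] by (rule le_less_trans) simp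
  finally show ?thesis .
qed

section \<open>Exponential decay of level sums away from the pole\<close>

lemma two_power_big_Omega_le:
  assumes "n > 0"
  shows "2 ^ big_Omega n \<le> n"
proof -
  have "2 ^ size A \<le> prod_mset A" if "\<And>p. p \<in># A \<Longrightarrow> 2 \<le> p" for A :: "nat multiset"
    using that by (induction A) (auto intro!: mult_mono)
  from this [of "prime_factorization n"] show ?thesis
    using assms by (auto simp: big_Omega_def prod_mset_prime_factorization_nat
        dest: in_prime_factors_imp_prime prime_ge_2_nat)
qed

text \<open>
  Replaces Newton's identities: a number of level \<open>k\<close> has logarithm at least \<open>k ln 2\<close>.
\<close>

lemma zeta_level_recursion:
  "of_nat k * zeta_level y k t \<le> 2 * (\<Sum>j=1..k. log_prime_zeta y j t * zeta_level y (k - j) t)"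
proof -
  have "of_nat k * zeta_level y k t =
      (\<integral>\<^sup>+n. of_nat k * ennreal (real n powr (- 1 - t)) \<partial>count_space (rough_level y k))"
    unfolding zeta_level_def by (simp add: nn_integral_cmult)
  also have "\<dots> \<le> (\<integral>\<^sup>+n. 2 * (ennreal (ln (real n)) * ennreal (real n powr (- 1 - t)))
      \<partial>count_space (rough_level y k))"
  proof (intro nn_integral_mono)
    fix n assume "n \<in> space (count_space (rough_level y k))"
    then have n: "n > 0" "2 ^ k \<le> n"
      using two_power_big_Omega_le [of n] by (auto simp: rough_level_def rough_def)
    have "real k * ln 2 = ln (real (2 ^ k))" by (simp add: ln_realpow)
    also have "\<dots> \<le> ln (real n)" using n by (subst ln_le_cancel_iff) (simp_all only: of_nat_le_iff of_nat_0_less_iff, simp)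
    finally have "real k \<le> 2 * ln (real n)"
      using ln2_ge_two_thirds mult_left_mono [of "1 / 2" "ln (2 :: real)" "real k"] by simp
    then have "of_nat k \<le> 2 * ennreal (ln (real n))"
      using n by (subst ennreal_numeral [symmetric], subst ennreal_mult [symmetric])
        (auto simp: ennreal_of_nat_eq_real_of_nat intro!: ennreal_leI)
    then show "of_nat k * ennreal (real n powr (- 1 - t)) \<le>
        2 * (ennreal (ln (real n)) * ennreal (real n powr (- 1 - t)))"
      unfolding mult.assoc [symmetric] by (intro mult_right_mono) auto
  qed
  also have "\<dots> = 2 * log_zeta_level y k t"
    unfolding log_zeta_level_def by (rule nn_integral_cmult) simp
  finally show ?thesis unfolding log_zeta_level_eq .
qed

text \<open>With equality in the recursion the generating function would be a multiple of (1 - q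
  x)^(-K), so z k grows at most like q^k times a power of k, and any r > q leaves room for that
  power. Concretely, the induction closes as soon as k exceeds K times the geometric sum of q / r;
  the constant C takes care of the finitely many earlier k.\<close>

lemma recursion_decay:
  fixes z :: "nat \<Rightarrow> real"
  assumes z: "\<And>k. 0 \<le> z k" and K: "0 \<le> K" and q: "0 < q" "q < r"
    and rec: "\<And>k. real k * z k \<le> K * (\<Sum>j=1..k. q ^ j * z (k - j))"
  obtains C where "0 \<le> C" "\<And>k. z k \<le> C * r ^ k"
proof -
  define x where "x = q / r"
  have r: "r > 0" using q by simp
  have x: "0 < x" "x < 1" using q by (simp_all add: x_def)
  define s where "s = 1 / (1 - x)"
  have geo: "(\<Sum>j=1..k. x ^ j) \<le> s" for k
  proof -
    have "(\<Sum>j=1..k. x ^ j) \<le> (\<Sum>j<Suc k. x ^ j)"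
      using x by (intro sum_mono2) auto
    also have "\<dots> = (1 - x ^ Suc k) / (1 - x)"
      using x by (subst sum_gp_strict) auto
    also have "\<dots> \<le> s" using x by (simp add: s_def divide_right_mono)
    finally show ?thesis .
  qed
  obtain N :: nat where N: "K * s \<le> real N" using real_arch_simple by blast
  define C where "C = (\<Sum>k\<le>N. z k / r ^ k)"
  have C: "0 \<le> C" unfolding C_def using z r by (intro sum_nonneg) auto
  have "z k \<le> C * r ^ k" for k
  proof (induction k rule: less_induct)
    case (less k)
    show ?case
    proof (cases "k \<le> N")
      case True
      then have "z k / r ^ k \<le> C"
        unfolding C_def using z r by (intro member_le_sum) auto
      then show ?thesis using r by (simp add: field_simps)
    next
      case False
      have "real k * z k \<le> K * (\<Sum>j=1..k. q ^ j * (C * r ^ (k - j)))"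
        using less.IH q K
        by (intro order_trans [OF rec] mult_left_mono sum_mono) auto
      also have "(\<Sum>j=1..k. q ^ j * (C * r ^ (k - j))) = (\<Sum>j=1..k. C * r ^ k * x ^ j)"
      proof (intro sum.cong refl)
        fix j assume "j \<in> {1..k}"
        then have "r ^ k = r ^ j * r ^ (k - j)" by (simp add: power_add [symmetric])
        then show "q ^ j * (C * r ^ (k - j)) = C * r ^ k * x ^ j"
          using r by (simp add: x_def power_divide)
      qed
      also have "K * \<dots> = C * r ^ k * (K * (\<Sum>j=1..k. x ^ j))"
        by (simp add: sum_distrib_left mult_ac)
      also have "\<dots> \<le> C * r ^ k * (K * s)"
        using C r K geo by (intro mult_left_mono) auto
      also have "\<dots> \<le> C * r ^ k * real k"
        using C r N False by (intro mult_left_mono) auto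
      finally have "real k * z k \<le> real k * (C * r ^ k)" by (simp add: mult_ac)
      then show ?thesis using False by simp
    qed
  qed
  with C show ?thesis by (rule that)
qed

text \<open>The condition on b is met by 3 for every t > 0 and by 2 at t = 1, where the value is
  1/4. The rate 2/5 lies above 1/3, as the recursion requires, and below 1 /
  \<open>tail_ratio\<close>, so that the result is negligible against the moments of odd
  integers.\<close>

lemma zeta_level_decay:
  assumes t: "0 < t" "t \<le> 1"
    and b: "\<And>p. p \<in> primes_above y \<Longrightarrow> b \<le> real p" "b > 0" "b powr - (1 + t) \<le> 1 / 3"
  obtains C where "0 \<le> C" "\<And>k. zeta_level y k t \<le> ennreal (C * (2 / 5) ^ k)"
proof -
  define z where "z k = enn2real (zeta_level y k t)" for k
  have z: "zeta_level y k t = ennreal (z k)" for k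
    unfolding z_def using zeta_level_finite [of t y k] t by simp
  define L where "L = 1 / t + 3"
  have L: "L \<ge> 0" using t by (simp add: L_def)
  have Lj: "log_prime_zeta y j t \<le> ennreal (3 * L * (1 / 3) ^ j)" if "j \<ge> 1" for j
  proof -
    have "log_prime_zeta y j t \<le> ennreal ((b powr - (1 + t)) ^ (j - 1)) * log_prime_zeta y 1 t"
      using b t that by (intro log_prime_zeta_le_geometric) auto
    also have "\<dots> \<le> ennreal ((1 / 3) ^ (j - 1)) * ennreal L"
      unfolding L_def using b t by (intro mult_mono ennreal_leI power_mono log_prime_zeta_1_le) auto
    also have "\<dots> = ennreal (3 * L * (1 / 3) ^ j)"
      using that L by (cases j) (simp_all add: ennreal_mult [symmetric] mult_ac)
    finally show ?thesis .
  qed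
  have "real k * z k \<le> 6 * L * (\<Sum>j=1..k. (1 / 3) ^ j * z (k - j))" for k
  proof -
    have "ennreal (real k * z k) = of_nat k * zeta_level y k t"
      by (simp add: z ennreal_of_nat_eq_real_of_nat ennreal_mult')
    also have "\<dots> \<le> 2 * (\<Sum>j=1..k. log_prime_zeta y j t * zeta_level y (k - j) t)"
      by (rule zeta_level_recursion)
    also have "\<dots> \<le> 2 * (\<Sum>j=1..k. ennreal (3 * L * (1 / 3) ^ j) * ennreal (z (k - j)))"
      unfolding z by (intro mult_left_mono sum_mono mult_right_mono Lj) auto
    also have "(\<Sum>j=1..k. ennreal (3 * L * (1 / 3) ^ j) * ennreal (z (k - j))) =
        (\<Sum>j=1..k. ennreal (3 * L * (1 / 3) ^ j * z (k - j)))"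
      using L by (intro sum.cong refl ennreal_mult [symmetric]) (auto simp: z_def)
    also have "\<dots> = ennreal (\<Sum>j=1..k. 3 * L * (1 / 3) ^ j * z (k - j))"
      using L by (intro sum_ennreal) (auto simp: z_def)
    also have "2 * \<dots> = ennreal (2 * (\<Sum>j=1..k. 3 * L * (1 / 3) ^ j * z (k - j)))"
      by (subst ennreal_mult') auto
    also have "2 * (\<Sum>j=1..k. 3 * L * (1 / 3) ^ j * z (k - j)) = 6 * L * (\<Sum>j=1..k. (1 / 3) ^ j * z (k - j))"
      by (simp add: sum_distrib_left mult_ac)
    finally show ?thesis
      using L by (subst (asm) ennreal_le_iff) (auto intro!: mult_nonneg_nonneg sum_nonneg simp: z_def)
  qed
  then obtain C where "0 \<le> C" "\<And>k. z k \<le> C * (2 / 5) ^ k"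
    using recursion_decay [of z "6 * L" "1 / 3" "2 / 5"] L by (auto simp: z_def)
  then show ?thesis by (intro that [of C]) (auto simp: z intro: ennreal_leI)
qed

lemma odd_zeta_level_decay:
  assumes "2 \<le> y" "0 < t" "t \<le> 1"
  obtains C where "0 \<le> C" "\<And>k. zeta_level y k t \<le> ennreal (C * (2 / 5) ^ k)"
proof (rule zeta_level_decay [of t y 3])
  have "(3 :: real) powr - (1 + t) \<le> 3 powr - 1"
    using assms by (intro powr_mono) auto
  then show "(3 :: real) powr - (1 + t) \<le> 1 / 3"
    by (simp add: powr_minus_divide del: minus_add_distrib)
qed (use assms odd_prime_ge_3 in auto)

lemma zeta_level_1_decay:
  obtains C where "0 \<le> C" "\<And>k. zeta_level y k 1 \<le> ennreal (C * (2 / 5) ^ k)"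
proof (rule zeta_level_decay [of 1 y 2])
  show "(2 :: real) powr - (1 + 1) \<le> 1 / 3"
    by (simp add: powr_minus_divide del: minus_add_distrib)
qed (use prime_ge_2_real [OF prime_in_primes_above] in auto)

section \<open>Finiteness and elementary estimates of the moments\<close>

lemma nn_integral_log_zeta_level:
  assumes [measurable]: "g \<in> borel_measurable borel"
  shows "(\<integral>\<^sup>+t. g t * log_zeta_level y k t \<partial>near_zero d) =
    (\<Sum>j=1..k. \<integral>\<^sup>+t. g t * log_prime_zeta y j t * zeta_level y (k - j) t \<partial>near_zero d)"
  unfolding log_zeta_level_eq sum_distrib_left mult.assoc
  by (rule nn_integral_sum) (auto intro!: measurable_near_zero)

text \<open>Integration by parts expresses level k by lower levels, and the factor t cancels the
  pole: t * L_j \<le> t * L_1 \<le> 1 + 3t \<le> 4. Induction on the level then gives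
  convergence.\<close>

lemma zeta_level_integral_finite: "(\<integral>\<^sup>+t. zeta_level y k t \<partial>near_zero 1) < \<infinity>"
proof (induction k rule: less_induct)
  case (less k)
  show ?case
  proof (cases "k = 0")
    case True
    then show ?thesis by (simp add: near_zero_def space_restrict_space emeasure_restrict_space)
  next
    case False
    have "(\<integral>\<^sup>+t. ennreal t * log_prime_zeta y j t * zeta_level y (k - j) t \<partial>near_zero 1) < \<infinity>"
      if j: "j \<in> {1..k}" for j
    proof -
      have "(\<integral>\<^sup>+t. ennreal t * log_prime_zeta y j t * zeta_level y (k - j) t \<partial>near_zero 1)
          \<le> (\<integral>\<^sup>+t. 4 * zeta_level y (k - j) t \<partial>near_zero 1)"
      proof (intro nn_integral_mono mult_right_mono)
        fix t assume "t \<in> space (near_zero 1)"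
        then have t: "0 < t" "t \<le> 1" by auto
        have "log_prime_zeta y j t \<le> log_prime_zeta y 1 t"
          using j t by (intro log_prime_zeta_mono) (simp add: mult_right_mono)
        also have "\<dots> \<le> ennreal (1 / t + 3)" using t by (rule log_prime_zeta_1_le)
        finally have "ennreal t * log_prime_zeta y j t \<le> ennreal t * ennreal (1 / t + 3)"
          by (rule mult_left_mono) simp
        also have "\<dots> = ennreal (t * (1 / t + 3))"
          using t by (simp add: ennreal_mult)
        also have "t * (1 / t + 3) = 1 + 3 * t"
          using t by (simp add: distrib_left)
        also have "\<dots> \<le> ennreal 4" using t by (intro ennreal_leI) simp
        finally show "ennreal t * log_prime_zeta y j t \<le> 4" by simp
      qed simp
      also have "\<dots> = 4 * (\<integral>\<^sup>+t. zeta_level y (k - j) t \<partial>near_zero 1)"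
        by (rule nn_integral_cmult) (auto intro!: measurable_near_zero)
      also have "\<dots> < \<infinity>"
        using less.IH [of "k - j"] j by (auto simp: ennreal_mult_less_top)
      finally show ?thesis .
    qed
    then have "(\<integral>\<^sup>+t. ennreal t * log_zeta_level y k t \<partial>near_zero 1) < \<infinity>"
      by (subst nn_integral_log_zeta_level) (auto simp: ennreal_sum_less_top)
    then show ?thesis
      using zeta_level_finite [of 1 y k] by (simp add: zeta_level_integral)
  qed
qed

lemma erdos_level_finite: "k > 0 \<Longrightarrow> erdos_level y k < \<infinity>"
  using erdos_level_bounds(2) [of k 1 y] zeta_level_integral_finite [of y k] zeta_level_finite [of 1 y k]
  by (auto simp: ennreal_mult_less_top elim!: le_less_trans)

lemma nn_integral_near_zero_mono:
  assumes "d \<le> e" "f \<in> borel_measurable borel"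
  shows "(\<integral>\<^sup>+t. f t \<partial>near_zero d) \<le> (\<integral>\<^sup>+t. f t \<partial>near_zero e)"
  unfolding nn_integral_near_zero using assms
  by (intro nn_integral_mono) (auto simp: indicator_def)

lemma moment_finite:
  assumes "d \<le> 1"
  shows "moment d y k < \<infinity>"
proof -
  have "moment d y k \<le> moment 1 y k"
    unfolding moment_def using assms by (intro nn_integral_near_zero_mono) auto
  also have "\<dots> \<le> (\<integral>\<^sup>+t. zeta_level y k t \<partial>near_zero 1)"
    unfolding moment_def
  proof (intro nn_integral_mono)
    fix t assume "t \<in> space (near_zero 1)"
    then have "ennreal t \<le> ennreal 1" by (intro ennreal_leI) simp
    then have "ennreal t * zeta_level y k t \<le> ennreal 1 * zeta_level y k t"
      by (rule mult_right_mono) simp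
    then show "ennreal t * zeta_level y k t \<le> zeta_level y k t" by simp
  qed
  also have "\<dots> < \<infinity>" by (rule zeta_level_integral_finite)
  finally show ?thesis .
qed

lemma moment_0:
  assumes "0 \<le> d"
  shows "2 * moment d y 0 = ennreal (d\<^sup>2)"
  using moment_integral [OF assms, of y 0] by (simp add: log_zeta_level_eq)

text \<open>Precise estimates hold only for a small cut-off d. This transfers them to the fixed
  cut-off 1 at the price of a term that is exponentially smaller than the moments.\<close>

lemma moment_1_le:
  assumes "0 < d" "d \<le> 1"
  shows "moment d y k \<le> moment 1 y k" "moment 1 y k \<le> moment d y k + zeta_level y k d"
proof -
  show "moment d y k \<le> moment 1 y k"
    unfolding moment_def using assms by (intro nn_integral_near_zero_mono) auto
  have "moment 1 y k \<le> (\<integral>\<^sup>+t. ennreal t * zeta_level y k t * indicator {0<..d} t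
      + zeta_level y k d * indicator {0<..1} t \<partial>lborel)"
    unfolding moment_def nn_integral_near_zero
  proof (intro nn_integral_mono)
    fix t :: real
    show "ennreal t * zeta_level y k t * indicator {0<..1} t \<le>
        ennreal t * zeta_level y k t * indicator {0<..d} t + zeta_level y k d * indicator {0<..1} t"
    proof (cases "d < t \<and> t \<le> 1")
      case True
      then have "ennreal t * zeta_level y k t \<le> ennreal 1 * zeta_level y k d"
        by (intro mult_mono ennreal_leI zeta_level_antimono) auto
      then show ?thesis using True assms by simp
    qed (auto simp: indicator_def)
  qed
  also have "\<dots> = moment d y k + zeta_level y k d"
    unfolding moment_def nn_integral_near_zero
    by (subst nn_integral_add) (auto simp: nn_integral_cmult)
  finally show "moment 1 y k \<le> moment d y k + zeta_level y k d" .
qed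

text \<open>Insert 1 / t \<le> L_1 + H into t = t^2 * (1 / t) and keep only j = 1 in the
  convolution. \<open>H\<close> is chosen before \<open>d\<close>, so that a small \<open>d\<close>
  brings the ratio as close to 2 as desired.\<close>

lemma moment_ratio_lower:
  obtains H where "H \<ge> 0" "\<And>d k. 0 < d \<Longrightarrow> d \<le> 1 \<Longrightarrow>
    moment d y k \<le> 2 * moment d y (Suc k) + ennreal (H * d) * moment d y k"
proof -
  obtain H where H: "H \<ge> 0"
    "\<And>t. 0 < t \<Longrightarrow> t \<le> 1 \<Longrightarrow> ennreal (1 / t) \<le> log_prime_zeta y 1 t + ennreal H"
    using log_prime_zeta_ge by blast
  have "moment d y k \<le> 2 * moment d y (Suc k) + ennreal (H * d) * moment d y k"
    if d: "0 < d" "d \<le> 1" for d k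
  proof -
    have "moment d y k \<le> (\<integral>\<^sup>+t. ennreal (t\<^sup>2) * log_prime_zeta y 1 t * zeta_level y k t
        + ennreal (H * d) * (ennreal t * zeta_level y k t) \<partial>near_zero d)"
      unfolding moment_def
    proof (intro nn_integral_mono)
      fix t assume "t \<in> space (near_zero d)"
      then have t: "0 < t" "t \<le> d" "t \<le> 1" using d by auto
      have "ennreal t = ennreal (t\<^sup>2) * ennreal (1 / t)"
        using t by (subst ennreal_mult [symmetric]) (auto simp: power2_eq_square)
      also have "\<dots> \<le> ennreal (t\<^sup>2) * (log_prime_zeta y 1 t + ennreal H)"
        using t by (intro mult_left_mono H) auto
      also have "\<dots> = ennreal (t\<^sup>2) * log_prime_zeta y 1 t + ennreal (t\<^sup>2 * H)"
        using H by (simp add: distrib_left ennreal_mult)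
      also have "t\<^sup>2 * H \<le> H * d * t"
        using t H by (simp add: power2_eq_square mult_ac mult_mono)
      then have "ennreal (t\<^sup>2 * H) \<le> ennreal (H * d) * ennreal t"
        using t H d by (subst ennreal_mult [symmetric]) (auto intro!: ennreal_leI)
      finally have "ennreal t \<le> ennreal (t\<^sup>2) * log_prime_zeta y 1 t + ennreal (H * d) * ennreal t"
        by (simp add: add_left_mono)
      then have "ennreal t * zeta_level y k t \<le>
          (ennreal (t\<^sup>2) * log_prime_zeta y 1 t + ennreal (H * d) * ennreal t) * zeta_level y k t"
        by (rule mult_right_mono) simp
      then show "ennreal t * zeta_level y k t \<le> ennreal (t\<^sup>2) * log_prime_zeta y 1 t * zeta_level y k t
        + ennreal (H * d) * (ennreal t * zeta_level y k t)"
        by (simp add: distrib_right mult.assoc)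
    qed
    also have "\<dots> = (\<integral>\<^sup>+t. ennreal (t\<^sup>2) * log_prime_zeta y 1 t * zeta_level y k t \<partial>near_zero d)
        + ennreal (H * d) * moment d y k"
      unfolding moment_def
      by (subst nn_integral_add) (auto simp: nn_integral_cmult intro!: measurable_near_zero nn_integral_cmult)
    also have "(\<integral>\<^sup>+t. ennreal (t\<^sup>2) * log_prime_zeta y 1 t * zeta_level y k t \<partial>near_zero d)
       \<le> (\<integral>\<^sup>+t. ennreal (t\<^sup>2) * log_zeta_level y (Suc k) t \<partial>near_zero d)"
      by (subst nn_integral_log_zeta_level, simp)
         (rule order_trans [OF _ member_le_sum [of 1]], auto)
    also have "\<dots> \<le> 2 * moment d y (Suc k)"
      using d by (simp add: moment_integral)
    finally show ?thesis by (simp add: add_right_mono)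
  qed
  with H(1) show ?thesis by (rule that)
qed

section \<open>Rough numbers\<close>

text \<open>Serves both integrations by parts: g t = t with c = 1, and g t = t^2 with c = d, where
  the extra d makes the tail small. The term j = 1 is kept exact because of its pole; for j \<ge> 2
  the value at t = 0 is a good enough bound.\<close>

lemma nn_integral_near_zero_tail:
  assumes y: "2 \<le> y" and g [measurable]: "g \<in> borel_measurable borel"
    and g_le: "\<And>t. 0 < t \<Longrightarrow> t \<le> d \<Longrightarrow> g t \<le> c * ennreal t"
    and ratio: "\<And>j. 2 \<le> j \<Longrightarrow> j \<le> Suc k \<Longrightarrow>
       moment d y (Suc k - j) \<le> ennreal (tail_ratio ^ (j - 1)) * moment d y k"
  shows "(\<integral>\<^sup>+t. g t * log_zeta_level y (Suc k) t \<partial>near_zero d) \<le>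
    (\<integral>\<^sup>+t. g t * log_prime_zeta y 1 t * zeta_level y k t \<partial>near_zero d)
      + c * (tail_weight y * moment d y k)"
proof -
  have term_le: "(\<integral>\<^sup>+t. g t * log_prime_zeta y j t * zeta_level y (Suc k - j) t \<partial>near_zero d) \<le>
      c * (log_prime_zeta y j 0 * ennreal (tail_ratio ^ (j - 1)) * moment d y k)"
    if j: "j \<in> {2..Suc k}" for j
  proof -
    have "(\<integral>\<^sup>+t. g t * log_prime_zeta y j t * zeta_level y (Suc k - j) t \<partial>near_zero d) \<le>
        (\<integral>\<^sup>+t. c * log_prime_zeta y j 0 * (ennreal t * zeta_level y (Suc k - j) t) \<partial>near_zero d)"
    proof (intro nn_integral_mono)
      fix t assume "t \<in> space (near_zero d)"
      then have t: "0 < t" "t \<le> d" by auto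
      then have "log_prime_zeta y j t \<le> log_prime_zeta y j 0"
        by (intro log_prime_zeta_mono mult_left_mono) auto
      then have "g t * log_prime_zeta y j t * zeta_level y (Suc k - j) t
          \<le> c * ennreal t * log_prime_zeta y j 0 * zeta_level y (Suc k - j) t"
        using g_le t by (intro mult_mono) auto
      then show "g t * log_prime_zeta y j t * zeta_level y (Suc k - j) t
          \<le> c * log_prime_zeta y j 0 * (ennreal t * zeta_level y (Suc k - j) t)"
        by (simp add: mult_ac)
    qed
    also have "\<dots> = c * log_prime_zeta y j 0 * moment d y (Suc k - j)"
      unfolding moment_def by (rule nn_integral_cmult) (auto intro!: measurable_near_zero)
    also have "\<dots> \<le> c * log_prime_zeta y j 0 * (ennreal (tail_ratio ^ (j - 1)) * moment d y k)"
      using j ratio by (intro mult_left_mono) auto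
    finally show ?thesis by (simp add: mult.assoc)
  qed
  have split: "{1..Suc k} = insert 1 {2..Suc k}" by auto
  have "(\<integral>\<^sup>+t. g t * log_zeta_level y (Suc k) t \<partial>near_zero d) =
    (\<integral>\<^sup>+t. g t * log_prime_zeta y 1 t * zeta_level y k t \<partial>near_zero d) +
    (\<Sum>j=2..Suc k. \<integral>\<^sup>+t. g t * log_prime_zeta y j t * zeta_level y (Suc k - j) t \<partial>near_zero d)"
    by (simp only: nn_integral_log_zeta_level [OF g] split) simp
  also have "(\<Sum>j=2..Suc k. \<integral>\<^sup>+t. g t * log_prime_zeta y j t * zeta_level y (Suc k - j) t \<partial>near_zero d) \<le>
      (\<Sum>j=2..Suc k. c * (log_prime_zeta y j 0 * ennreal (tail_ratio ^ (j - 1)) * moment d y k))"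
    by (intro sum_mono term_le)
  also have "\<dots> = c * ((\<Sum>j=2..Suc k. log_prime_zeta y j 0 * ennreal (tail_ratio ^ (j - 1))) * moment d y k)"
    by (simp only: sum_distrib_left sum_distrib_right)
  also have "\<dots> \<le> c * (tail_weight y * moment d y k)"
    by (intro mult_left_mono mult_right_mono sum_log_prime_zeta_le_tail_weight y) auto
  finally show ?thesis by (simp add: add_left_mono)
qed

definition rmoment :: "real \<Rightarrow> real \<Rightarrow> nat \<Rightarrow> real" where
  "rmoment d y k = enn2real (moment d y k)"

lemma ennreal_rmoment: "d \<le> 1 \<Longrightarrow> ennreal (rmoment d y k) = moment d y k"
  unfolding rmoment_def using moment_finite [of d y k] by simp

lemma rmoment_nonneg [simp]: "0 \<le> rmoment d y k"
  by (simp add: rmoment_def)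

text \<open>The first and third estimates bracket the ratio of consecutive moments near 2, with
  \<open>H\<close> and \<open>\<tau>\<close> independent of \<open>d\<close>. The fourth is the
  descent itself: the surplus 1/100 in the numerical inequality becomes a gain of a hundredth of the
  moment.\<close>

lemma small_moment_estimates:
  assumes y: "2 \<le> y"
  obtains d0 H \<tau> where "0 < d0" "d0 \<le> 1" "0 \<le> H" "0 \<le> \<tau>"
    "\<And>d k. 0 < d \<Longrightarrow> d \<le> d0 \<Longrightarrow> (1 - H * d) * rmoment d y k \<le> 2 * rmoment d y (Suc k)"
    "\<And>d k. 0 < d \<Longrightarrow> d \<le> d0 \<Longrightarrow> rmoment d y k \<le> tail_ratio * rmoment d y (Suc k)"
    "\<And>d k. 0 < d \<Longrightarrow> d \<le> d0 \<Longrightarrow>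
        2 * rmoment d y (Suc k) \<le> (1 + \<tau> * d) * rmoment d y k + enn2real (zeta_level y (Suc k) d)"
    "\<And>d k. 0 < d \<Longrightarrow> d \<le> d0 \<Longrightarrow> 0 < k \<Longrightarrow>
        erdos_level y (Suc k) + ennreal (rmoment d y k / 100) \<le>
        erdos_level y k + 3 * zeta_level y (Suc k) d"
proof -
  obtain d1 where d1: "0 < d1" "d1 \<le> 1"
    "\<And>t. 0 < t \<Longrightarrow> t \<le> d1 \<Longrightarrow>
       log_prime_zeta y 1 t + tail_weight y + ennreal (1 / 100) \<le> ennreal (1 / t)"
    using log_prime_zeta_tail_weight_le [OF y] by blast
  obtain H where H: "H \<ge> 0" "\<And>d k. 0 < d \<Longrightarrow> d \<le> 1 \<Longrightarrow>
    moment d y k \<le> 2 * moment d y (Suc k) + ennreal (H * d) * moment d y k"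
    using moment_ratio_lower [of y] by blast
  define \<tau> where "\<tau> = enn2real (tail_weight y)"
  have \<tau>: "0 \<le> \<tau>" "tail_weight y = ennreal \<tau>"
    using tail_weight_finite [OF y] by (simp_all add: \<tau>_def)
  \<comment> \<open>With H * d \<le> 1/250 the ratio is at most 2 / (1 - 1/250) = 500/249, which is
    below 201/100.\<close>
  define d0 where "d0 = min d1 (1 / (250 * (H + 1)))"
  have d0: "0 < d0" "d0 \<le> 1" "d0 \<le> d1" using d1 H(1) by (auto simp: d0_def)
  have Hd: "H * d \<le> 1 / 250" if "0 < d" "d \<le> d0" for d
  proof -
    have "H * d \<le> (H + 1) * (1 / (250 * (H + 1)))"
      using that H(1) by (intro mult_mono) (auto simp: d0_def)
    also have "\<dots> = 1 / 250" using H(1) by (simp add: field_simps)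
    finally show ?thesis .
  qed
  have lower: "(1 - H * d) * rmoment d y k \<le> 2 * rmoment d y (Suc k)" if d: "0 < d" "d \<le> d0" for d k
  proof -
    have "ennreal (rmoment d y k) \<le> 2 * ennreal (rmoment d y (Suc k)) + ennreal (H * d) * ennreal (rmoment d y k)"
      using H(2) [of d k] d d0 by (simp add: ennreal_rmoment)
    also have "\<dots> = ennreal (2 * rmoment d y (Suc k) + H * d * rmoment d y k)"
      using d H(1) by (simp add: ennreal_plus ennreal_mult)
    finally have "rmoment d y k \<le> 2 * rmoment d y (Suc k) + H * d * rmoment d y k"
      using d H(1) by (subst (asm) ennreal_le_iff) auto
    then show ?thesis by (simp add: algebra_simps)
  qed
  have step: "rmoment d y k \<le> tail_ratio * rmoment d y (Suc k)" if d: "0 < d" "d \<le> d0" for d k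
  proof -
    have "(1 - 1 / 250) * rmoment d y k \<le> (1 - H * d) * rmoment d y k"
      using Hd [OF d] by (intro mult_right_mono) auto
    then have "(1 - 1 / 250) * rmoment d y k \<le> 2 * rmoment d y (Suc k)"
      using lower [OF d, of k] by linarith
    then have "rmoment d y k \<le> 500 / 249 * rmoment d y (Suc k)"
      by (simp add: field_simps)
    also have "\<dots> \<le> tail_ratio * rmoment d y (Suc k)"
      by (intro mult_right_mono) (auto simp: tail_ratio_def)
    finally show ?thesis .
  qed
  have iterate: "rmoment d y k \<le> tail_ratio ^ i * rmoment d y (k + i)" if d: "0 < d" "d \<le> d0" for d k i
  proof (induction i)
    case (Suc i)
    note Suc
    also have "tail_ratio ^ i * rmoment d y (k + i) \<le> tail_ratio ^ i * (tail_ratio * rmoment d y (Suc (k + i)))"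
      using step [OF d, of "k + i"] by (intro mult_left_mono) (auto simp: tail_ratio_def)
    finally show ?case by (simp add: mult_ac)
  qed simp
  have ratio: "moment d y (Suc k - j) \<le> ennreal (tail_ratio ^ (j - 1)) * moment d y k"
    if d: "0 < d" "d \<le> d0" and j: "2 \<le> j" "j \<le> Suc k" for d k j
  proof -
    have "ennreal (rmoment d y (Suc k - j)) \<le> ennreal (tail_ratio ^ (j - 1) * rmoment d y (Suc k - j + (j - 1)))"
      by (intro ennreal_leI iterate d)
    also have "Suc k - j + (j - 1) = k" using j by simp
    finally show ?thesis
      using d d0 by (simp add: ennreal_mult ennreal_rmoment tail_ratio_def)
  qed
  have upper: "2 * rmoment d y (Suc k) \<le> (1 + \<tau> * d) * rmoment d y k + enn2real (zeta_level y (Suc k) d)"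
    if d: "0 < d" "d \<le> d0" for d k
  proof -
    have "2 * moment d y (Suc k) =
        (\<integral>\<^sup>+t. ennreal (t\<^sup>2) * log_zeta_level y (Suc k) t \<partial>near_zero d) + ennreal (d\<^sup>2) * zeta_level y (Suc k) d"
      using d by (intro moment_integral) auto
    also have "\<dots> \<le> (\<integral>\<^sup>+t. ennreal (t\<^sup>2) * log_prime_zeta y 1 t * zeta_level y k t \<partial>near_zero d)
      + ennreal d * (tail_weight y * moment d y k) + 1 * zeta_level y (Suc k) d"
    proof (intro add_mono mult_right_mono nn_integral_near_zero_tail y)
      show "ennreal (t\<^sup>2) \<le> ennreal d * ennreal t" if "0 < t" "t \<le> d" for t
        using that d by (subst ennreal_mult [symmetric])
          (auto intro!: ennreal_leI mult_right_mono simp: power2_eq_square)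
      have "d\<^sup>2 \<le> 1" using d d0 by (intro power_le_one) auto
      then show "ennreal (d\<^sup>2) \<le> 1" using ennreal_leI by fastforce
    qed (use d ratio in auto)
    also have "(\<integral>\<^sup>+t. ennreal (t\<^sup>2) * log_prime_zeta y 1 t * zeta_level y k t \<partial>near_zero d) \<le> moment d y k"
      unfolding moment_def
    proof (intro nn_integral_mono mult_right_mono)
      fix t assume "t \<in> space (near_zero d)"
      then have t: "0 < t" "t \<le> d1" using d d0 by auto
      have "log_prime_zeta y 1 t \<le> log_prime_zeta y 1 t + tail_weight y + ennreal (1 / 100)"
        by (simp add: add.assoc add_increasing2)
      also have "\<dots> \<le> ennreal (1 / t)" by (rule d1 t)+
      finally have "ennreal (t\<^sup>2) * log_prime_zeta y 1 t \<le> ennreal (t\<^sup>2) * ennreal (1 / t)"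
        by (rule mult_left_mono) simp
      also have "\<dots> = ennreal t"
        using t by (subst ennreal_mult [symmetric]) (auto simp: power2_eq_square)
      finally show "ennreal (t\<^sup>2) * log_prime_zeta y 1 t \<le> ennreal t" .
    qed simp
    finally have "2 * moment d y (Suc k) \<le> moment d y k + ennreal d * (tail_weight y * moment d y k)
        + zeta_level y (Suc k) d"
      by (simp add: add_right_mono)
    also have "\<dots> = ennreal ((1 + \<tau> * d) * rmoment d y k + enn2real (zeta_level y (Suc k) d))"
    proof -
      have m: "moment d y k = ennreal (rmoment d y k)" using d d0 by (simp add: ennreal_rmoment)
      have z: "zeta_level y (Suc k) d = ennreal (enn2real (zeta_level y (Suc k) d))"
        using zeta_level_finite [of d y "Suc k"] d by simp
      show ?thesis
        using d \<tau>(1) by (subst z, unfold m \<tau>(2))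
          (simp add: ennreal_mult [symmetric] ennreal_plus [symmetric] algebra_simps del: ennreal_plus)
    qed
    finally have "ennreal (2 * rmoment d y (Suc k)) \<le>
        ennreal ((1 + \<tau> * d) * rmoment d y k + enn2real (zeta_level y (Suc k) d))"
      using d d0 by (simp add: ennreal_mult ennreal_rmoment)
    then show ?thesis
      using d \<tau>(1) by (subst (asm) ennreal_le_iff) auto
  qed
  \<comment> \<open>The coefficient 3 collects 2 from cutting the integral off at d and 1 from the
    boundary term of the integration by parts.\<close>
  have main: "erdos_level y (Suc k) + ennreal (rmoment d y k / 100) \<le>
        erdos_level y k + 3 * zeta_level y (Suc k) d" if d: "0 < d" "d \<le> d0" and k: "0 < k" for d k
  proof -
    have "erdos_level y (Suc k) + ennreal (rmoment d y k / 100) \<le>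
        (\<integral>\<^sup>+t. zeta_level y (Suc k) t \<partial>near_zero d) + 2 * zeta_level y (Suc k) d + ennreal (1 / 100) * moment d y k"
      using d d0 erdos_level_bounds(2) [of "Suc k" d y]
      by (intro add_mono) (auto simp: ennreal_rmoment [symmetric] ennreal_mult [symmetric])
    also have "(\<integral>\<^sup>+t. zeta_level y (Suc k) t \<partial>near_zero d) =
        (\<integral>\<^sup>+t. ennreal t * log_zeta_level y (Suc k) t \<partial>near_zero d) + ennreal d * zeta_level y (Suc k) d"
      using d by (intro zeta_level_integral) auto
    also have "\<dots> \<le> (\<integral>\<^sup>+t. ennreal t * log_prime_zeta y 1 t * zeta_level y k t \<partial>near_zero d)
        + 1 * (tail_weight y * moment d y k) + 1 * zeta_level y (Suc k) d"
    proof (intro add_mono mult_right_mono nn_integral_near_zero_tail y)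
      show "ennreal d \<le> 1" using d d0 ennreal_leI [of d 1] by simp
    qed (use d ratio in auto)
    finally have "erdos_level y (Suc k) + ennreal (rmoment d y k / 100) \<le>
        (\<integral>\<^sup>+t. ennreal t * log_prime_zeta y 1 t * zeta_level y k t \<partial>near_zero d)
        + tail_weight y * moment d y k + zeta_level y (Suc k) d
        + 2 * zeta_level y (Suc k) d + ennreal (1 / 100) * moment d y k"
      by (simp add: add_right_mono)
    also have "\<dots> = (\<integral>\<^sup>+t. ennreal t * log_prime_zeta y 1 t * zeta_level y k t \<partial>near_zero d)
        + tail_weight y * moment d y k + ennreal (1 / 100) * moment d y k + (1 + 2) * zeta_level y (Suc k) d"
      unfolding distrib_right by (simp only: mult_1 add_ac)
    also have "(\<integral>\<^sup>+t. ennreal t * log_prime_zeta y 1 t * zeta_level y k t \<partial>near_zero d)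
        + tail_weight y * moment d y k + ennreal (1 / 100) * moment d y k =
      (\<integral>\<^sup>+t. ennreal t * (log_prime_zeta y 1 t + tail_weight y + ennreal (1 / 100)) * zeta_level y k t \<partial>near_zero d)"
    proof -
      have "(\<integral>\<^sup>+t. ennreal t * (log_prime_zeta y 1 t + tail_weight y + ennreal (1 / 100)) * zeta_level y k t \<partial>near_zero d)
        = (\<integral>\<^sup>+t. ennreal t * log_prime_zeta y 1 t * zeta_level y k t +
           tail_weight y * (ennreal t * zeta_level y k t) + ennreal (1 / 100) * (ennreal t * zeta_level y k t) \<partial>near_zero d)"
        by (intro nn_integral_cong) (simp add: distrib_left distrib_right mult_ac)
      then show ?thesis
        unfolding moment_def
        by (simp add: nn_integral_add nn_integral_cmult measurable_near_zero)
    qed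
    \<comment> \<open>The bracket is at most 1 / t, so the factor t cancels it and the integrand
      collapses to level k.\<close>
    also have "\<dots> \<le> (\<integral>\<^sup>+t. zeta_level y k t \<partial>near_zero d)"
    proof (intro nn_integral_mono)
      fix t assume "t \<in> space (near_zero d)"
      then have t: "0 < t" "t \<le> d1" using d d0 by auto
      have "ennreal t * (log_prime_zeta y 1 t + tail_weight y + ennreal (1 / 100)) \<le> ennreal t * ennreal (1 / t)"
        by (intro mult_left_mono d1 t) simp
      also have "\<dots> = 1" using t by (subst ennreal_mult [symmetric]) auto
      finally have "ennreal t * (log_prime_zeta y 1 t + tail_weight y + ennreal (1 / 100)) * zeta_level y k t
          \<le> 1 * zeta_level y k t"
        by (rule mult_right_mono) simp
      then show "ennreal t * (log_prime_zeta y 1 t + tail_weight y + ennreal (1 / 100)) * zeta_level y k t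
          \<le> zeta_level y k t" by simp
    qed
    also have "\<dots> \<le> erdos_level y k" using d k by (intro erdos_level_bounds) auto
    finally show ?thesis by (simp add: add_right_mono)
  qed
  show ?thesis
    by (rule that [OF d0(1,2) H(1) \<tau>(1) lower step upper main])
qed

section \<open>Boundary errors against moments\<close>

lemma rmoment_lower:
  assumes "0 < d" "\<And>k. rmoment d y k \<le> tail_ratio * rmoment d y (Suc k)" "d \<le> 1"
  shows "d\<^sup>2 / 2 \<le> tail_ratio ^ k * rmoment d y k"
proof (induction k)
  case 0
  have "ennreal (2 * rmoment d y 0) = ennreal (d\<^sup>2)"
    using moment_0 [of d y] assms by (simp add: ennreal_mult ennreal_rmoment)
  then show ?case by (simp add: ennreal_inj)
next
  case (Suc k)
  note Suc
  also have "tail_ratio ^ k * rmoment d y k \<le> tail_ratio ^ k * (tail_ratio * rmoment d y (Suc k))"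
    by (intro mult_left_mono assms) (simp add: tail_ratio_def)
  finally show ?case by (simp add: mult_ac)
qed

text \<open>The moments are at least a constant times 2.01^(-k), and 2/5 * 2.01 = 0.804 < 1.\<close>

lemma decay_over_rmoment:
  assumes "0 < d" "\<And>k. rmoment d y k \<le> tail_ratio * rmoment d y (Suc k)" "d \<le> 1"
  shows "rmoment d y k > 0" "(\<lambda>k. (2 / 5) ^ k / rmoment d y k) \<longlonglongrightarrow> 0"
proof -
  have lower: "d\<^sup>2 / 2 \<le> tail_ratio ^ k * rmoment d y k" for k
    by (rule rmoment_lower [OF assms])
  have d2: "d\<^sup>2 / 2 > 0" using assms by simp
  have pos: "rmoment d y k > 0" for k
    using lower [of k] d2 rmoment_nonneg [of d y k] by (cases "rmoment d y k = 0") (auto simp: order_less_le)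
  then show "rmoment d y k > 0" .
  show "(\<lambda>k. (2 / 5) ^ k / rmoment d y k) \<longlonglongrightarrow> 0"
  proof (rule tendsto_sandwich [OF always_eventually always_eventually])
    show "\<forall>k. 0 \<le> (2 / 5) ^ k / rmoment d y k" by simp
    show "\<forall>k. (2 / 5) ^ k / rmoment d y k \<le> 2 / d\<^sup>2 * (2 / 5 * tail_ratio) ^ k"
    proof
      fix k
      have "(2 / 5) ^ k * (d\<^sup>2 / 2) \<le> (2 / 5) ^ k * (tail_ratio ^ k * rmoment d y k)"
        using lower by (intro mult_left_mono) auto
      then show "(2 / 5) ^ k / rmoment d y k \<le> 2 / d\<^sup>2 * (2 / 5 * tail_ratio) ^ k"
        using pos [of k] d2 assms(1) by (simp add: field_simps power_mult_distrib)
    qed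
    have "(\<lambda>k. (2 / 5 * tail_ratio) ^ k) \<longlonglongrightarrow> 0"
      by (rule LIMSEQ_realpow_zero) (auto simp: tail_ratio_def)
    from tendsto_mult_right_zero [OF this]
    show "(\<lambda>k. 2 / d\<^sup>2 * (2 / 5 * tail_ratio) ^ k) \<longlonglongrightarrow> 0" .
  qed simp
qed

text \<open>The gain of a hundredth of the moment eventually beats the boundary error of order
  (2/5)^k. A single fixed d suffices.\<close>

lemma erdos_level_rough_decreasing:
  assumes y: "2 \<le> y"
  shows "\<forall>\<^sub>F k in sequentially. erdos_level y (Suc k) < erdos_level y k"
proof -
  obtain d where d: "0 < d" "d \<le> 1"
    "\<And>k. rmoment d y k \<le> tail_ratio * rmoment d y (Suc k)"
    "\<And>k. 0 < k \<Longrightarrow> erdos_level y (Suc k) + ennreal (rmoment d y k / 100) \<le>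
        erdos_level y k + 3 * zeta_level y (Suc k) d"
    using small_moment_estimates [OF y] by (metis order_refl)
  obtain C where C: "0 \<le> C" "\<And>k. zeta_level y k d \<le> ennreal (C * (2 / 5) ^ k)"
    using odd_zeta_level_decay [OF y d(1,2)] by blast
  note decay = decay_over_rmoment [OF d(1,3,2)]
  have "\<forall>\<^sub>F k in sequentially. 3 * C * ((2 / 5) ^ k / rmoment d y k) < 1 / 100"
    using tendsto_mult_right_zero [OF decay(2)] by (rule order_tendstoD) simp
  then show ?thesis
    using eventually_gt_at_top [of 0]
  proof eventually_elim
    case (elim k)
    have "3 * zeta_level y (Suc k) d \<le> 3 * ennreal (C * (2 / 5) ^ Suc k)"
      by (intro mult_left_mono C) simp
    also have "\<dots> = ennreal (3 * (C * (2 / 5) ^ Suc k))"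
      by (subst ennreal_mult') auto
    also have "\<dots> < ennreal (rmoment d y k / 100)"
    proof (rule ennreal_lessI)
      have "3 * (C * (2 / 5) ^ Suc k) \<le> 3 * C * (2 / 5) ^ k"
        using C(1) by (simp add: mult_left_mono)
      also have "\<dots> < rmoment d y k / 100"
        using elim(1) decay(1) [of k] by (simp add: field_simps)
      finally show "3 * (C * (2 / 5) ^ Suc k) < rmoment d y k / 100" .
    qed (use decay(1) in simp)
    finally have less: "3 * zeta_level y (Suc k) d < ennreal (rmoment d y k / 100)" .
    have fin: "erdos_level y (Suc k) < \<infinity>" "erdos_level y k < \<infinity>"
      using erdos_level_finite elim(2) by auto
    show ?case
    proof (rule ccontr)
      assume "\<not> ?case"
      then have "erdos_level y k + 3 * zeta_level y (Suc k) d
          < erdos_level y (Suc k) + ennreal (rmoment d y k / 100)"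
        using less fin by (intro ennreal_add_left_cancel_less [THEN iffD2, THEN less_le_trans]) 
          (auto intro: add_right_mono)
      then show False using d(4) [OF elim(2)] by simp
    qed
  qed
qed

section \<open>All integers\<close>

text \<open>Here \<open>rough_level 1\<close> is the set of all integers of a level and
  \<open>rough_level 2\<close> that of the odd ones. Halving an even integer lowers the level by
  one; iterating this separates the power of 2.\<close>

lemma rough_level_1_Suc:
  "(\<integral>\<^sup>+n. f n \<partial>count_space (rough_level 1 (Suc k))) =
    (\<integral>\<^sup>+n. f (2 * n) \<partial>count_space (rough_level 1 k)) + (\<integral>\<^sup>+n. f n \<partial>count_space (rough_level 2 (Suc k)))"
proof -
  have Omega: "big_Omega (2 * n) = Suc (big_Omega n)" if "n > 0" for n
    using that big_Omega_mult [of 2 n] big_Omega_prime_power [of 2 1] by simp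
  have rough1: "n \<in> rough_level 1 k \<longleftrightarrow> n > 0 \<and> big_Omega n = k" for n k
    by (auto simp: rough_level_def rough_def dest: prime_gt_1_nat)
  have rough2: "n \<in> rough_level 2 k \<longleftrightarrow> n > 0 \<and> odd n \<and> big_Omega n = k" for n k
  proof -
    have "odd n \<longleftrightarrow> (\<forall>p. prime p \<and> p dvd n \<longrightarrow> real p > 2)"
    proof
      assume "odd n"
      then have "2 < p" if "prime p" "p dvd n" for p
        using that prime_ge_2_nat [of p] by (cases "p = 2") auto
      then show "\<forall>p. prime p \<and> p dvd n \<longrightarrow> real p > 2" by fastforce
    next
      assume "\<forall>p. prime p \<and> p dvd n \<longrightarrow> real p > 2"
      then show "odd n" using two_is_prime_nat by fastforce
    qed
    then show ?thesis by (auto simp: rough_level_def rough_def)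
  qed
  have "(\<integral>\<^sup>+n. f n \<partial>count_space (rough_level 1 (Suc k))) =
    (\<integral>\<^sup>+n. f n * indicator {n. even n} n + f n * indicator {n. odd n} n \<partial>count_space (rough_level 1 (Suc k)))"
    by (intro nn_integral_cong) (auto simp: indicator_def)
  also have "\<dots> = (\<integral>\<^sup>+n. f n \<partial>count_space {n \<in> rough_level 1 (Suc k). even n}) +
      (\<integral>\<^sup>+n. f n \<partial>count_space {n \<in> rough_level 1 (Suc k). odd n})"
    unfolding count_space_filter by (rule nn_integral_add) auto
  also have "{n \<in> rough_level 1 (Suc k). odd n} = rough_level 2 (Suc k)"
    by (auto simp: rough1 rough2)
  also have "(\<integral>\<^sup>+n. f n \<partial>count_space {n \<in> rough_level 1 (Suc k). even n}) =
      (\<integral>\<^sup>+n. f (2 * n) \<partial>count_space (rough_level 1 k))"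
    by (rule nn_integral_bij_count_space [symmetric])
       (auto simp: bij_betw_def inj_on_def rough1 Omega elim!: evenE)
  finally show ?thesis .
qed

section \<open>Splitting off the powers of 2\<close>

definition euler2 :: "real \<Rightarrow> ennreal" where
  "euler2 t = ennreal (2 powr (- 1 - t))"

lemma euler2_measurable [measurable]: "euler2 \<in> borel_measurable borel"
  unfolding euler2_def by measurable

lemma zeta_level_1_Suc:
  "zeta_level 1 (Suc k) t = euler2 t * zeta_level 1 k t + zeta_level 2 (Suc k) t"
  unfolding zeta_level_def rough_level_1_Suc
  by (simp add: euler2_def powr_mult ennreal_mult nn_integral_cmult)

lemma zeta_level_1_eq:
  "zeta_level 1 k t = (\<Sum>m\<le>k. euler2 t ^ m * zeta_level 2 (k - m) t)"
proof (induction k)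
  case (Suc k)
  have "(\<Sum>m\<le>Suc k. euler2 t ^ m * zeta_level 2 (Suc k - m) t) =
      zeta_level 2 (Suc k) t + (\<Sum>m\<le>k. euler2 t ^ Suc m * zeta_level 2 (k - m) t)"
    by (subst sum.atMost_Suc_shift) simp
  also have "(\<Sum>m\<le>k. euler2 t ^ Suc m * zeta_level 2 (k - m) t) = euler2 t * zeta_level 1 k t"
    unfolding Suc.IH by (simp add: sum_distrib_left mult.assoc)
  finally show ?case by (simp add: zeta_level_1_Suc add.commute)
qed simp

lemma sum_euler2_zeta_level_1:
  "(\<Sum>j=1..k. euler2 t ^ j * zeta_level 1 (k - j) t) =
     (\<Sum>m\<le>k. of_nat m * (euler2 t ^ m * zeta_level 2 (k - m) t))"
proof (induction k)
  case (Suc k)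
  have "(\<Sum>j=1..Suc k. euler2 t ^ j * zeta_level 1 (Suc k - j) t) =
      (\<Sum>j=0..k. euler2 t ^ Suc j * zeta_level 1 (k - j) t)"
    using sum.shift_bounds_cl_Suc_ivl [of "\<lambda>j. euler2 t ^ j * zeta_level 1 (Suc k - j) t" 0 k] by simp
  also have "\<dots> = euler2 t * (zeta_level 1 k t + (\<Sum>j=1..k. euler2 t ^ j * zeta_level 1 (k - j) t))"
    by (simp add: sum.atLeast_Suc_atMost sum_distrib_left distrib_left mult.assoc)
  also have "\<dots> = (\<Sum>m\<le>k. of_nat (Suc m) * (euler2 t ^ Suc m * zeta_level 2 (k - m) t))"
    unfolding Suc.IH unfolding zeta_level_1_eq sum.distrib [symmetric] sum_distrib_left
    by (intro sum.cong refl) (simp add: distrib_left distrib_right mult_ac)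
  also have "\<dots> = (\<Sum>m\<le>Suc k. of_nat m * (euler2 t ^ m * zeta_level 2 (Suc k - m) t))"
    by (subst sum.atMost_Suc_shift) simp
  finally show ?case .
qed simp

lemma log_prime_zeta_1_ge_euler2:
  "ennreal (ln 2) * euler2 t ^ j \<le> log_prime_zeta 1 j t"
proof -
  have "(2 powr (- 1 - t)) ^ j = 2 powr - (real j * (1 + t))"
    by (subst powr_power) (auto simp: algebra_simps)
  then have "ennreal (ln 2) * euler2 t ^ j =
      (\<integral>\<^sup>+p. ennreal (ln (real p) * real p powr - (real j * (1 + t))) \<partial>count_space {2})"
    by (simp add: nn_integral_count_space_finite euler2_def ennreal_power ennreal_mult)
  also have "\<dots> \<le> log_prime_zeta 1 j t"
    unfolding log_prime_zeta_def
    by (intro nn_integral_count_space_mono_set) (auto simp: primes_above_def)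
  finally show ?thesis .
qed

text \<open>
  \<open>weight m k\<close> is the contribution to the moment at level \<open>m + k\<close> of the integers \<open>2 ^ m * q\<close>
  with \<open>q\<close> odd. All weights of the same level \<open>m + k\<close> with \<open>m\<close> bounded are asymptotically equal,
  see \<open>weight_tendsto\<close>.
\<close>

definition weight :: "nat \<Rightarrow> nat \<Rightarrow> ennreal" where
  "weight m k = (\<integral>\<^sup>+t. ennreal t * (euler2 t ^ m * zeta_level 2 k t) \<partial>near_zero 1)"

lemma euler2_bounds:
  assumes "0 < t" "t \<le> d"
  shows "euler2 t \<le> ennreal (1 / 2)" "ennreal (2 powr (- 1 - d)) \<le> euler2 t"
proof -
  have "2 powr (- 1 - t) \<le> 2 powr (- 1 :: real)"
    using assms by (intro powr_mono) auto
  then show "euler2 t \<le> ennreal (1 / 2)"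
    unfolding euler2_def by (intro ennreal_leI) (simp add: powr_minus_divide)
  show "ennreal (2 powr (- 1 - d)) \<le> euler2 t"
    unfolding euler2_def using assms by (intro ennreal_leI powr_mono) auto
qed

lemma weight_le: "weight m k \<le> ennreal ((1 / 2) ^ m) * moment 1 2 k"
proof -
  have "weight m k \<le> (\<integral>\<^sup>+t. ennreal ((1 / 2) ^ m) * (ennreal t * zeta_level 2 k t) \<partial>near_zero 1)"
    unfolding weight_def
  proof (intro nn_integral_mono)
    fix t assume "t \<in> space (near_zero 1)"
    then have "euler2 t ^ m \<le> ennreal ((1 / 2) ^ m)"
      by (subst ennreal_power [symmetric], simp) (intro power_mono euler2_bounds(1) [of t 1], auto)
    then show "ennreal t * (euler2 t ^ m * zeta_level 2 k t)
        \<le> ennreal ((1 / 2) ^ m) * (ennreal t * zeta_level 2 k t)"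
      by (simp add: mult.left_commute [of "ennreal t"] mult_right_mono)
  qed
  also have "\<dots> = ennreal ((1 / 2) ^ m) * moment 1 2 k"
    unfolding moment_def by (rule nn_integral_cmult) (auto intro!: measurable_near_zero)
  finally show ?thesis .
qed

lemma weight_ge:
  assumes "0 < d" "d \<le> 1"
  shows "ennreal ((2 powr (- 1 - d)) ^ m) * moment d 2 k \<le> weight m k"
proof -
  have "ennreal ((2 powr (- 1 - d)) ^ m) * moment d 2 k =
      (\<integral>\<^sup>+t. ennreal ((2 powr (- 1 - d)) ^ m) * (ennreal t * zeta_level 2 k t) \<partial>near_zero d)"
    unfolding moment_def by (rule nn_integral_cmult [symmetric]) (auto intro!: measurable_near_zero)
  also have "\<dots> \<le> (\<integral>\<^sup>+t. ennreal t * (euler2 t ^ m * zeta_level 2 k t) \<partial>near_zero d)"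
  proof (intro nn_integral_mono)
    fix t assume "t \<in> space (near_zero d)"
    then have "ennreal ((2 powr (- 1 - d)) ^ m) \<le> euler2 t ^ m"
      using power_mono [OF euler2_bounds(2) [of t d], of m] by (simp add: ennreal_power)
    then show "ennreal ((2 powr (- 1 - d)) ^ m) * (ennreal t * zeta_level 2 k t)
        \<le> ennreal t * (euler2 t ^ m * zeta_level 2 k t)"
      by (simp add: mult.left_commute [of "ennreal t"] mult_right_mono)
  qed
  also have "\<dots> \<le> weight m k"
    unfolding weight_def using assms by (intro nn_integral_near_zero_mono) auto
  finally show ?thesis .
qed

text \<open>Level k + 1 is bounded below by the term j = 1 and the powers of 2; level k is bounded
  above through 1 \<le> t * L_1 + t * H. Both bounds contain the integral of t * L_1 * Z_k, which is
  passed from one to the other without subtraction. The cut-off can be 1, since all primes satisfy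
  p^(-2) \<le> 1/4.\<close>

lemma erdos_level_1_step:
  obtains H where "0 \<le> H" "\<And>k. 0 < k \<Longrightarrow>
    erdos_level 1 k + (\<Sum>m\<le>k. ennreal (ln 2 * real m) * weight (Suc m) (k - m)) \<le>
    erdos_level 1 (Suc k) + (\<Sum>m\<le>k. ennreal H * weight (Suc m) (k - m)) + 2 * zeta_level 1 k 1"
proof -
  obtain H where H: "H \<ge> 0"
    "\<And>t. 0 < t \<Longrightarrow> t \<le> 1 \<Longrightarrow> ennreal (1 / t) \<le> log_prime_zeta 1 1 t + ennreal H"
    using log_prime_zeta_ge [of 1] by blast
  have "erdos_level 1 k + (\<Sum>m\<le>k. ennreal (ln 2 * real m) * weight (Suc m) (k - m)) \<le>
    erdos_level 1 (Suc k) + (\<Sum>m\<le>k. ennreal (4 * H) * weight (Suc m) (k - m)) + 2 * zeta_level 1 k 1"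
    if k: "0 < k" for k
  proof -
    define I where "I = (\<integral>\<^sup>+t. ennreal t * log_prime_zeta 1 1 t * zeta_level 1 k t \<partial>near_zero 1)"
    have lower: "I + (\<Sum>m\<le>k. ennreal (ln 2 * real m) * weight (Suc m) (k - m)) \<le> erdos_level 1 (Suc k)"
    proof -
      have "I + (\<Sum>m\<le>k. ennreal (ln 2 * real m) * weight (Suc m) (k - m)) =
        (\<integral>\<^sup>+t. ennreal t * log_prime_zeta 1 1 t * zeta_level 1 k t + (\<Sum>m\<le>k. ennreal (ln 2 * real m) *
          (ennreal t * (euler2 t ^ Suc m * zeta_level 2 (k - m) t))) \<partial>near_zero 1)"
        unfolding I_def weight_def
        by (simp add: nn_integral_add nn_integral_sum nn_integral_cmult measurable_near_zero del: power_Suc)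
      also have "\<dots> \<le> (\<integral>\<^sup>+t. ennreal t * log_zeta_level 1 (Suc k) t \<partial>near_zero 1)"
      proof (intro nn_integral_mono)
        fix t :: real
        have "(\<Sum>m\<le>k. ennreal (ln 2 * real m) * (ennreal t * (euler2 t ^ Suc m * zeta_level 2 (k - m) t))) =
          ennreal t * (ennreal (ln 2) * (euler2 t * (\<Sum>j=1..k. euler2 t ^ j * zeta_level 1 (k - j) t)))"
          unfolding sum_euler2_zeta_level_1 sum_distrib_left
          by (intro sum.cong refl) (simp add: ennreal_mult ennreal_of_nat_eq_real_of_nat mult_ac)
        also have "ennreal (ln 2) * (euler2 t * (\<Sum>j=1..k. euler2 t ^ j * zeta_level 1 (k - j) t)) =
            (\<Sum>j=1..k. ennreal (ln 2) * euler2 t ^ Suc j * zeta_level 1 (k - j) t)"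
          by (simp add: sum_distrib_left mult.assoc)
        also have "\<dots> \<le> (\<Sum>j=1..k. log_prime_zeta 1 (Suc j) t * zeta_level 1 (k - j) t)"
          by (intro sum_mono mult_right_mono log_prime_zeta_1_ge_euler2) simp
        also have "\<dots> = (\<Sum>j=2..Suc k. log_prime_zeta 1 j t * zeta_level 1 (Suc k - j) t)"
          using sum.shift_bounds_cl_Suc_ivl [of "\<lambda>j. log_prime_zeta 1 j t * zeta_level 1 (Suc k - j) t" 1 k]
          by (simp add: numeral_2_eq_2)
        finally have "ennreal t * log_prime_zeta 1 1 t * zeta_level 1 k t +
          (\<Sum>m\<le>k. ennreal (ln 2 * real m) * (ennreal t * (euler2 t ^ Suc m * zeta_level 2 (k - m) t))) \<le>
          ennreal t * (log_prime_zeta 1 1 t * zeta_level 1 k t +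
            (\<Sum>j=2..Suc k. log_prime_zeta 1 j t * zeta_level 1 (Suc k - j) t))"
          by (simp add: distrib_left mult.assoc add_left_mono mult_left_mono)
        also have "\<dots> = ennreal t * log_zeta_level 1 (Suc k) t"
        proof -
          have "{1..Suc k} = insert 1 {2..Suc k}" by auto
          then show ?thesis by (simp only: log_zeta_level_eq) simp
        qed
        finally show "ennreal t * log_prime_zeta 1 1 t * zeta_level 1 k t +
          (\<Sum>m\<le>k. ennreal (ln 2 * real m) * (ennreal t * (euler2 t ^ Suc m * zeta_level 2 (k - m) t))) \<le>
          ennreal t * log_zeta_level 1 (Suc k) t" .
      qed
      also have "\<dots> \<le> (\<integral>\<^sup>+t. zeta_level 1 (Suc k) t \<partial>near_zero 1)"
        by (simp add: zeta_level_integral)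
      also have "\<dots> \<le> erdos_level 1 (Suc k)" by (intro erdos_level_bounds) auto
      finally show ?thesis .
    qed
    have "erdos_level 1 k \<le> (\<integral>\<^sup>+t. zeta_level 1 k t \<partial>near_zero 1) + 2 * zeta_level 1 k 1"
      using k by (intro erdos_level_bounds) auto
    also have "(\<integral>\<^sup>+t. zeta_level 1 k t \<partial>near_zero 1) \<le>
      (\<integral>\<^sup>+t. ennreal t * log_prime_zeta 1 1 t * zeta_level 1 k t + (\<Sum>m\<le>k. ennreal (4 * H) *
          (ennreal t * (euler2 t ^ Suc m * zeta_level 2 (k - m) t))) \<partial>near_zero 1)"
    proof (intro nn_integral_mono)
      fix t assume "t \<in> space (near_zero 1)"
      then have t: "0 < t" "t \<le> 1" by auto
      have "1 = ennreal t * ennreal (1 / t)"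
        using t by (subst ennreal_mult [symmetric]) auto
      also have "\<dots> \<le> ennreal t * (log_prime_zeta 1 1 t + ennreal H)"
        by (intro mult_left_mono H t) simp
      finally have "1 * zeta_level 1 k t \<le> ennreal t * (log_prime_zeta 1 1 t + ennreal H) * zeta_level 1 k t"
        by (rule mult_right_mono) simp
      then have "zeta_level 1 k t \<le> ennreal t * log_prime_zeta 1 1 t * zeta_level 1 k t
          + ennreal H * (ennreal t * (1 * zeta_level 1 k t))"
        by (simp add: distrib_left distrib_right mult_ac)
      also have "\<dots> \<le> ennreal t * log_prime_zeta 1 1 t * zeta_level 1 k t
          + ennreal H * (ennreal t * (4 * euler2 t * zeta_level 1 k t))"
      proof (intro add_left_mono mult_left_mono mult_right_mono)
        \<comment> \<open>Inserting a factor 2^(-1-t), which is at least 1/4 for t \<le> 1, puts the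
          loss on the same weights of level k + 1 as the gain.\<close>
        have "1 = 4 * ennreal (2 powr (- 1 - 1))"
          by (simp add: powr_minus_divide flip: ennreal_numeral ennreal_mult)
        also have "\<dots> \<le> 4 * euler2 t"
          by (intro mult_left_mono euler2_bounds t) simp
        finally show "1 \<le> 4 * euler2 t" .
      qed auto
      also have "ennreal H * (ennreal t * (4 * euler2 t * zeta_level 1 k t)) =
          (\<Sum>m\<le>k. ennreal (4 * H) * (ennreal t * (euler2 t ^ Suc m * zeta_level 2 (k - m) t)))"
        unfolding zeta_level_1_eq sum_distrib_left using H(1)
        by (intro sum.cong refl) (simp add: ennreal_mult mult_ac)
      finally show "zeta_level 1 k t \<le> ennreal t * log_prime_zeta 1 1 t * zeta_level 1 k t +
        (\<Sum>m\<le>k. ennreal (4 * H) * (ennreal t * (euler2 t ^ Suc m * zeta_level 2 (k - m) t)))" .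
    qed
    also have "\<dots> = I + (\<Sum>m\<le>k. ennreal (4 * H) * weight (Suc m) (k - m))"
      unfolding I_def weight_def
      by (simp add: nn_integral_add nn_integral_sum nn_integral_cmult measurable_near_zero del: power_Suc)
    finally have "erdos_level 1 k + (\<Sum>m\<le>k. ennreal (ln 2 * real m) * weight (Suc m) (k - m)) \<le>
      I + (\<Sum>m\<le>k. ennreal (4 * H) * weight (Suc m) (k - m)) + 2 * zeta_level 1 k 1
        + (\<Sum>m\<le>k. ennreal (ln 2 * real m) * weight (Suc m) (k - m))"
      by (simp add: add_right_mono)
    also have "\<dots> = (I + (\<Sum>m\<le>k. ennreal (ln 2 * real m) * weight (Suc m) (k - m))) +
        (\<Sum>m\<le>k. ennreal (4 * H) * weight (Suc m) (k - m)) + 2 * zeta_level 1 k 1"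
      by (simp only: add_ac)
    also have "\<dots> \<le> erdos_level 1 (Suc k) + (\<Sum>m\<le>k. ennreal (4 * H) * weight (Suc m) (k - m)) + 2 * zeta_level 1 k 1"
      by (intro add_right_mono lower)
    finally show ?thesis .
  qed
  with H(1) show ?thesis by (intro that [of "4 * H"]) auto
qed

text \<open>The order of choices matters: first d, small enough to bring 1 - H d and 1 + \<tau> d
  close to 1, and only then k, large enough to absorb the error, whose constant \<open>C\<close>
  depends on d.\<close>

lemma ratio_tendsto_2:
  fixes X :: "nat \<Rightarrow> real" and H \<tau> d0 r :: real
  assumes pos: "\<And>k. X k > 0" and small: "(\<lambda>k. r ^ k / X k) \<longlonglongrightarrow> 0"
    and d0: "0 < d0" and r: "0 < r"
    and est: "\<And>d. 0 < d \<Longrightarrow> d \<le> d0 \<Longrightarrow> \<exists>C\<ge>0. \<forall>k. (1 - H * d) * X k \<le> 2 * X (Suc k) + C * r ^ Suc k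
        \<and> 2 * X (Suc k) \<le> (1 + \<tau> * d) * X k + C * r ^ Suc k"
  shows "(\<lambda>k. X k / X (Suc k)) \<longlonglongrightarrow> 2"
proof (rule order_tendstoI)
  have small': "(\<lambda>k. C * (r ^ Suc k / X (Suc k))) \<longlonglongrightarrow> 0" for C
    using tendsto_mult_right_zero [OF LIMSEQ_Suc [OF small]] by simp
  have near: "\<forall>\<^sub>F d in at_right 0. 0 < d \<and> d \<le> d0 \<and> P d" if "\<forall>\<^sub>F d in at_right 0. P d" for P
    using eventually_at_right_less [of 0] eventually_at_right_field [of "\<lambda>d. d \<le> d0" 0] that d0
    by (auto elim: eventually_elim2 intro: exI [of _ d0] eventually_conj)
  fix a :: real
  {
    assume "a < 2"
    moreover have "((\<lambda>d. 2 - a * (1 + \<tau> * d)) \<longlongrightarrow> 2 - a * (1 + \<tau> * 0)) (at_right 0)"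
      by (intro tendsto_intros)
    ultimately have "\<forall>\<^sub>F d in at_right 0. 0 < 2 - a * (1 + \<tau> * d)"
      by (intro order_tendstoD) auto
    moreover have "((\<lambda>d. 1 + \<tau> * d) \<longlongrightarrow> 1 + \<tau> * 0) (at_right 0)"
      by (intro tendsto_intros)
    then have "\<forall>\<^sub>F d in at_right 0. 0 < 1 + \<tau> * d"
      by (intro order_tendstoD) auto
    ultimately have "\<forall>\<^sub>F d in at_right 0. 0 < d \<and> d \<le> d0 \<and> (0 < 2 - a * (1 + \<tau> * d) \<and> 0 < 1 + \<tau> * d)"
      by (intro near eventually_conj)
    then obtain d where d: "0 < d" "d \<le> d0" "0 < 2 - a * (1 + \<tau> * d)" "0 < 1 + \<tau> * d"
      using eventually_happens trivial_limit_at_right_real by (metis (mono_tags, lifting))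
    obtain C where C: "\<And>k. 2 * X (Suc k) \<le> (1 + \<tau> * d) * X k + C * r ^ Suc k"
      using est [OF d(1,2)] by blast
    have "\<forall>\<^sub>F k in sequentially. C * (r ^ Suc k / X (Suc k)) < 2 - a * (1 + \<tau> * d)"
      using small' d(3) by (rule order_tendstoD)
    then show "\<forall>\<^sub>F k in sequentially. a < X k / X (Suc k)"
    proof eventually_elim
      case (elim k)
      have "2 * X (Suc k) / X (Suc k) \<le> ((1 + \<tau> * d) * X k + C * r ^ Suc k) / X (Suc k)"
        by (intro divide_right_mono C less_imp_le pos)
      then have "2 \<le> (1 + \<tau> * d) * (X k / X (Suc k)) + C * (r ^ Suc k / X (Suc k))"
        using pos [of "Suc k"] by (simp add: add_divide_distrib)
      then have "(1 + \<tau> * d) * a < (1 + \<tau> * d) * (X k / X (Suc k))"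
        using elim by (simp add: mult.commute)
      then show ?case using d(4) by (simp only: mult_less_cancel_left_pos)
    qed
  }
  {
    assume "2 < a"
    moreover have "((\<lambda>d. a * (1 - H * d) - 2) \<longlongrightarrow> a * (1 - H * 0) - 2) (at_right 0)"
      by (intro tendsto_intros)
    ultimately have "\<forall>\<^sub>F d in at_right 0. 0 < a * (1 - H * d) - 2"
      by (intro order_tendstoD) auto
    moreover have "((\<lambda>d. 1 - H * d) \<longlongrightarrow> 1 - H * 0) (at_right 0)"
      by (intro tendsto_intros)
    then have "\<forall>\<^sub>F d in at_right 0. 0 < 1 - H * d"
      by (intro order_tendstoD) auto
    ultimately have "\<forall>\<^sub>F d in at_right 0. 0 < d \<and> d \<le> d0 \<and> (0 < a * (1 - H * d) - 2 \<and> 0 < 1 - H * d)"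
      by (intro near eventually_conj)
    then obtain d where d: "0 < d" "d \<le> d0" "0 < a * (1 - H * d) - 2" "0 < 1 - H * d"
      using eventually_happens trivial_limit_at_right_real by (metis (mono_tags, lifting))
    obtain C where C: "\<And>k. (1 - H * d) * X k \<le> 2 * X (Suc k) + C * r ^ Suc k"
      using est [OF d(1,2)] by blast
    have "\<forall>\<^sub>F k in sequentially. C * (r ^ Suc k / X (Suc k)) < a * (1 - H * d) - 2"
      using small' d(3) by (rule order_tendstoD)
    then show "\<forall>\<^sub>F k in sequentially. X k / X (Suc k) < a"
    proof eventually_elim
      case (elim k)
      have "(1 - H * d) * X k / X (Suc k) \<le> (2 * X (Suc k) + C * r ^ Suc k) / X (Suc k)"
        by (intro divide_right_mono C less_imp_le pos)
      then have "(1 - H * d) * (X k / X (Suc k)) \<le> 2 + C * (r ^ Suc k / X (Suc k))"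
        using pos [of "Suc k"] by (simp add: add_divide_distrib)
      then have "(1 - H * d) * (X k / X (Suc k)) < (1 - H * d) * a"
        using elim by (simp add: mult.commute)
      then show ?case using d(4) by (simp only: mult_less_cancel_left_pos)
    qed
  }
qed

lemma rmoment_odd_ratio:
  shows "\<And>k. rmoment 1 2 k > 0"
    and "(\<lambda>k. (2 / 5) ^ k / rmoment 1 2 k) \<longlonglongrightarrow> 0"
    and "(\<lambda>k. rmoment 1 2 k / rmoment 1 2 (Suc k)) \<longlonglongrightarrow> 2"
proof -
  obtain d0 H \<tau> where d0: "0 < d0" "d0 \<le> 1" and H: "0 \<le> H" and \<tau>: "0 \<le> \<tau>"
    and lower: "\<And>d k. 0 < d \<Longrightarrow> d \<le> d0 \<Longrightarrow> (1 - H * d) * rmoment d 2 k \<le> 2 * rmoment d 2 (Suc k)"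
    and step: "\<And>d k. 0 < d \<Longrightarrow> d \<le> d0 \<Longrightarrow> rmoment d 2 k \<le> tail_ratio * rmoment d 2 (Suc k)"
    and upper: "\<And>d k. 0 < d \<Longrightarrow> d \<le> d0 \<Longrightarrow>
        2 * rmoment d 2 (Suc k) \<le> (1 + \<tau> * d) * rmoment d 2 k + enn2real (zeta_level 2 (Suc k) d)"
    using small_moment_estimates [of 2] by (metis order_refl)
  have compare: "rmoment d 2 k \<le> rmoment 1 2 k"
    "rmoment 1 2 k \<le> rmoment d 2 k + enn2real (zeta_level 2 k d)" if d: "0 < d" "d \<le> 1" for d k
  proof -
    show "rmoment d 2 k \<le> rmoment 1 2 k"
      unfolding rmoment_def using moment_1_le(1) [OF d] moment_finite [of 1 2 k]
      by (intro enn2real_mono) auto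
    have "ennreal (rmoment 1 2 k) \<le> ennreal (rmoment d 2 k + enn2real (zeta_level 2 k d))"
      using moment_1_le(2) [OF d, of 2 k] zeta_level_finite [of d 2 k] d
      by (simp add: ennreal_rmoment ennreal_plus)
    then show "rmoment 1 2 k \<le> rmoment d 2 k + enn2real (zeta_level 2 k d)"
      by (subst (asm) ennreal_le_iff) auto
  qed
  have decay: "\<exists>C\<ge>0. \<forall>k. enn2real (zeta_level 2 k d) \<le> C * (2 / 5) ^ k" if d: "0 < d" "d \<le> 1" for d
  proof -
    obtain C where "0 \<le> C" "\<And>k. zeta_level 2 k d \<le> ennreal (C * (2 / 5) ^ k)"
      using odd_zeta_level_decay [of 2 d] d by auto
    then show ?thesis by (intro exI [of _ C]) (auto intro!: enn2real_leI)
  qed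
  note d0_decay = decay_over_rmoment [OF d0(1) step [OF d0(1) order_refl] d0(2)]
  show pos: "rmoment 1 2 k > 0" for k
    using d0_decay(1) compare(1) [OF d0] by (rule less_le_trans)
  show small: "(\<lambda>k. (2 / 5) ^ k / rmoment 1 2 k) \<longlonglongrightarrow> 0"
  proof (rule tendsto_sandwich [OF always_eventually always_eventually tendsto_const d0_decay(2)])
    show "\<forall>k. 0 \<le> (2 / 5) ^ k / rmoment 1 2 k" by simp
    show "\<forall>k. (2 / 5) ^ k / rmoment 1 2 k \<le> (2 / 5) ^ k / rmoment d0 2 k"
      using compare(1) [OF d0] d0_decay(1) by (intro allI divide_left_mono) (auto intro!: mult_pos_pos pos)
  qed
  show "(\<lambda>k. rmoment 1 2 k / rmoment 1 2 (Suc k)) \<longlonglongrightarrow> 2"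
  proof (rule ratio_tendsto_2 [OF pos small d0(1)])
    fix d assume d: "0 < d" "d \<le> d0"
    then have d1: "d \<le> 1" using d0 by simp
    obtain C where C: "C \<ge> 0" "\<And>k. enn2real (zeta_level 2 k d) \<le> C * (2 / 5) ^ k"
      using decay [OF d(1) d1] by blast
    \<comment> \<open>The constant 4 C covers both directions: the lower estimate loses C (2/5)^k =
      5/2 * C (2/5)^(k+1), the upper one 3 C (2/5)^(k+1).\<close>
    have "(1 - H * d) * rmoment 1 2 k \<le> 2 * rmoment 1 2 (Suc k) + (4 * C) * (2 / 5) ^ Suc k \<and>
        2 * rmoment 1 2 (Suc k) \<le> (1 + \<tau> * d) * rmoment 1 2 k + (4 * C) * (2 / 5) ^ Suc k" for k
    proof
      have Ck: "0 \<le> C * (2 / 5) ^ k" using C(1) by simp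
      show "(1 - H * d) * rmoment 1 2 k \<le> 2 * rmoment 1 2 (Suc k) + (4 * C) * (2 / 5) ^ Suc k"
      proof (cases "1 - H * d \<ge> 0")
        case True
        have "(1 - H * d) * rmoment 1 2 k \<le> (1 - H * d) * (rmoment d 2 k + C * (2 / 5) ^ k)"
          using True C(2) [of k] compare(2) [OF d(1) d1, of k] by (intro mult_left_mono) auto
        also have "\<dots> \<le> 2 * rmoment d 2 (Suc k) + 1 * (C * (2 / 5) ^ k)"
          unfolding distrib_left using H d Ck by (intro add_mono lower mult_right_mono) auto
        finally show ?thesis
          using compare(1) [OF d(1) d1, of "Suc k"] Ck by simp
      next
        case False
        then have "(1 - H * d) * rmoment 1 2 k \<le> 0" by (intro mult_nonpos_nonneg) auto
        also have "0 \<le> 2 * rmoment 1 2 (Suc k) + (4 * C) * (2 / 5) ^ Suc k" using C(1) by simp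
        finally show ?thesis .
      qed
      have "2 * rmoment 1 2 (Suc k) \<le> 2 * (rmoment d 2 (Suc k) + C * (2 / 5) ^ Suc k)"
        using C(2) [of "Suc k"] compare(2) [OF d(1) d1, of "Suc k"] by argo
      also have "\<dots> \<le> (1 + \<tau> * d) * rmoment d 2 k + 3 * (C * (2 / 5) ^ Suc k)"
        using upper [OF d, of k] C(2) [of "Suc k"] by argo
      also have "\<dots> \<le> (1 + \<tau> * d) * rmoment 1 2 k + (4 * C) * (2 / 5) ^ Suc k"
        using compare(1) [OF d(1) d1] \<tau> d C(1)
        by (intro add_mono mult_left_mono) (auto simp: mult_right_mono)
      finally show "2 * rmoment 1 2 (Suc k) \<le> (1 + \<tau> * d) * rmoment 1 2 k + (4 * C) * (2 / 5) ^ Suc k" .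
    qed
    then show "\<exists>C\<ge>0. \<forall>k. (1 - H * d) * rmoment 1 2 k \<le> 2 * rmoment 1 2 (Suc k) + C * (2 / 5) ^ Suc k \<and>
        2 * rmoment 1 2 (Suc k) \<le> (1 + \<tau> * d) * rmoment 1 2 k + C * (2 / 5) ^ Suc k"
      using C(1) by (intro exI [of _ "4 * C"]) simp
  qed simp
qed

lemma weight_finite: "weight m k < \<infinity>"
  using weight_le [of m k] moment_finite [of 1 2 k]
  by (auto simp: ennreal_mult_less_top elim!: le_less_trans)

lemma rmoment_odd_ratio_shift:
  "(\<lambda>k. rmoment 1 2 k / rmoment 1 2 (k + m)) \<longlonglongrightarrow> 2 ^ m"
proof (induction m)
  case 0
  have "rmoment 1 2 k / rmoment 1 2 (k + 0) = 1" for k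
    using rmoment_odd_ratio(1) [of k] by simp
  then show ?case by simp
next
  case (Suc m)
  have "(\<lambda>k. rmoment 1 2 (k + m) / rmoment 1 2 (Suc (k + m))) \<longlonglongrightarrow> 2"
    using LIMSEQ_ignore_initial_segment [OF rmoment_odd_ratio(3), of m] by simp
  from tendsto_mult [OF Suc this]
  have "(\<lambda>k. rmoment 1 2 k / rmoment 1 2 (k + m) * (rmoment 1 2 (k + m) / rmoment 1 2 (Suc (k + m))))
      \<longlonglongrightarrow> 2 ^ Suc m" by (simp add: mult.commute)
  moreover have "rmoment 1 2 k / rmoment 1 2 (k + m) * (rmoment 1 2 (k + m) / rmoment 1 2 (Suc (k + m)))
      = rmoment 1 2 k / rmoment 1 2 (k + Suc m)" for k
    using rmoment_odd_ratio(1) [of "k + m"] by simp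
  ultimately show ?case by (simp only:)
qed

text \<open>On the small t that dominate the moment, the factor 2^(-m(1+t)) is nearly 2^(-m), and
  X_k is about 2^m * X_(k+m). The upper bound holds with 2^(-m) throughout; the lower bound needs a
  cut-off d with 2^(-1-d) close to 1/2.\<close>

lemma weight_tendsto:
  "(\<lambda>k. enn2real (weight m k) / rmoment 1 2 (k + m)) \<longlonglongrightarrow> 1"
proof (rule order_tendstoI)
  note pos = rmoment_odd_ratio(1)
  fix a :: real
  {
    assume "1 < a"
    have le: "enn2real (weight m k) / rmoment 1 2 (k + m) \<le> (1 / 2) ^ m * (rmoment 1 2 k / rmoment 1 2 (k + m))" for k
    proof -
      have "enn2real (weight m k) \<le> enn2real (ennreal ((1 / 2) ^ m) * moment 1 2 k)"
        using weight_le [of m k] moment_finite [of 1 2 k]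
        by (intro enn2real_mono) (auto simp: ennreal_mult_less_top)
      also have "\<dots> = (1 / 2) ^ m * rmoment 1 2 k"
        by (simp add: enn2real_mult rmoment_def)
      finally show ?thesis
        using pos [of "k + m"] by (simp add: divide_right_mono)
    qed
    have "(\<lambda>k. (1 / 2) ^ m * (rmoment 1 2 k / rmoment 1 2 (k + m))) \<longlonglongrightarrow> (1 / 2) ^ m * 2 ^ m"
      by (intro tendsto_intros rmoment_odd_ratio_shift)
    also have "(1 / 2) ^ m * 2 ^ m = (1 :: real)"
      by (simp add: power_mult_distrib [symmetric])
    finally have "\<forall>\<^sub>F k in sequentially. (1 / 2) ^ m * (rmoment 1 2 k / rmoment 1 2 (k + m)) < a"
      using \<open>1 < a\<close> by (rule order_tendstoD)
    then show "\<forall>\<^sub>F k in sequentially. enn2real (weight m k) / rmoment 1 2 (k + m) < a"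
      by eventually_elim (use le in \<open>auto intro: le_less_trans\<close>)
  }
  {
    assume "a < 1"
    moreover have "((\<lambda>d. (2 powr (- 1 - d)) ^ m * 2 ^ m :: real) \<longlongrightarrow> (2 powr (- 1 - 0)) ^ m * 2 ^ m) (at_right 0)"
      by (intro tendsto_intros) auto
    moreover have "(2 powr (- 1 - 0)) ^ m * 2 ^ m = (1 :: real)"
      by (simp add: powr_minus_divide power_divide)
    ultimately have "\<forall>\<^sub>F d in at_right 0. a < (2 powr (- 1 - d)) ^ m * 2 ^ m"
      by (intro order_tendstoD(1)) (simp_all only:)
    then obtain e where e: "e > 0" "\<And>d. 0 < d \<Longrightarrow> d < e \<Longrightarrow> a < (2 powr (- 1 - d)) ^ m * 2 ^ m"
      unfolding eventually_at_right_field by auto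
    define d where "d = min (e / 2) 1"
    have d: "0 < d" "d \<le> 1" "a < (2 powr (- 1 - d)) ^ m * 2 ^ m"
      using e by (auto simp: d_def min_def)
    define c where "c = (2 powr (- 1 - d)) ^ m"
    have c: "c \<ge> 0" by (simp add: c_def)
    obtain C where C: "0 \<le> C" "\<And>k. zeta_level 2 k d \<le> ennreal (C * (2 / 5) ^ k)"
      using odd_zeta_level_decay [of 2 d] d by auto
    have ge: "c * (rmoment 1 2 k / rmoment 1 2 (k + m))
        - c * C * (5 / 2) ^ m * ((2 / 5) ^ (k + m) / rmoment 1 2 (k + m))
        \<le> enn2real (weight m k) / rmoment 1 2 (k + m)" for k
    proof -
      have "ennreal (rmoment 1 2 k) \<le> ennreal (rmoment d 2 k) + ennreal (C * (2 / 5) ^ k)"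
        using order_trans [OF moment_1_le(2) [OF d(1,2), of 2 k] add_left_mono [OF C(2)]] d
        by (simp add: ennreal_rmoment)
      also have "\<dots> = ennreal (rmoment d 2 k + C * (2 / 5) ^ k)"
        using C(1) by (intro ennreal_plus [symmetric]) auto
      finally have "rmoment 1 2 k \<le> rmoment d 2 k + C * (2 / 5) ^ k"
        using C(1) by (subst (asm) ennreal_le_iff) auto
      then have "c * rmoment 1 2 k - c * C * (2 / 5) ^ k \<le> c * rmoment d 2 k"
        using mult_left_mono [of _ _ c] c by (fastforce simp: algebra_simps)
      also have "\<dots> = enn2real (ennreal c * moment d 2 k)"
        using c by (simp add: enn2real_mult rmoment_def)
      also have "\<dots> \<le> enn2real (weight m k)"
        unfolding c_def using weight_ge [OF d(1,2)] weight_finite by (intro enn2real_mono) auto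
      \<comment> \<open>The exponent is raised to k + m to match the moment in the
        denominator.\<close>
      also have "c * C * (2 / 5) ^ k = c * C * (5 / 2) ^ m * (2 / 5) ^ (k + m)"
        by (simp add: power_add power_mult_distrib [symmetric] mult_ac)
      finally show ?thesis
        using divide_right_mono [of _ _ "rmoment 1 2 (k + m)"] pos [of "k + m"]
        by (fastforce simp: diff_divide_distrib)
    qed
    have "(\<lambda>k. c * (rmoment 1 2 k / rmoment 1 2 (k + m))
        - c * C * (5 / 2) ^ m * ((2 / 5) ^ (k + m) / rmoment 1 2 (k + m)))
      \<longlonglongrightarrow> c * 2 ^ m - c * C * (5 / 2) ^ m * 0"
      by (intro tendsto_intros rmoment_odd_ratio_shift LIMSEQ_ignore_initial_segment [OF rmoment_odd_ratio(2)])
    then have "\<forall>\<^sub>F k in sequentially. a < c * (rmoment 1 2 k / rmoment 1 2 (k + m))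
        - c * C * (5 / 2) ^ m * ((2 / 5) ^ (k + m) / rmoment 1 2 (k + m))"
      using d(3) by (intro order_tendstoD) (auto simp: c_def)
    then show "\<forall>\<^sub>F k in sequentially. a < enn2real (weight m k) / rmoment 1 2 (k + m)"
      by eventually_elim (use ge in \<open>auto intro: less_le_trans\<close>)
  }
qed

text \<open>Gain minus loss is a sum of weights with coefficients \<open>c m\<close>, negative for
  small m. Convergence of the weights is known only for fixed m, so the sum is cut at a fixed
  \<open>M\<close>: up to \<open>M\<close> the weights are asymptotically equal and only the sum of
  the coefficients counts, beyond \<open>M\<close> every term is nonnegative and is dropped.\<close>

lemma erdos_level_1_increasing:
  "\<forall>\<^sub>F k in sequentially. erdos_level 1 k < erdos_level 1 (Suc k)"
proof -
  define w where "w m k = enn2real (weight m k)" for m k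
  have w: "weight m k = ennreal (w m k)" "0 \<le> w m k" for m k
    unfolding w_def using weight_finite [of m k] by simp_all
  define X where "X = rmoment 1 2"
  have X: "X k > 0" for k unfolding X_def by (rule rmoment_odd_ratio)
  obtain H where H: "0 \<le> H" "\<And>k. 0 < k \<Longrightarrow>
    erdos_level 1 k + (\<Sum>m\<le>k. ennreal (ln 2 * real m) * weight (Suc m) (k - m)) \<le>
    erdos_level 1 (Suc k) + (\<Sum>m\<le>k. ennreal H * weight (Suc m) (k - m)) + 2 * zeta_level 1 k 1"
    using erdos_level_1_step by blast
  obtain C where C: "0 \<le> C" "\<And>k. zeta_level 1 k 1 \<le> ennreal (C * (2 / 5) ^ k)"
    using zeta_level_1_decay by blast
  define c where "c m = ln 2 * real m - H" for m
  \<comment> \<open>The mean of ln 2 * m over m \<le> M exceeds M / 4 > H, which makes the sum of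
    the coefficients positive; and for m > M one has ln 2 * m > m / 2 > H.\<close>
  obtain M :: nat where M: "4 * H < real M" using reals_Archimedean2 by blast
  have half: "1 / 2 < ln (2 :: real)" using ln2_ge_two_thirds by simp
  have c_nonneg: "0 \<le> c m" if "m > M" for m
  proof -
    have "H \<le> 1 / 2 * real m" using that M H(1) by simp
    also have "\<dots> \<le> ln 2 * real m" using half by (intro mult_right_mono) auto
    finally show ?thesis by (simp add: c_def)
  qed
  have sum_c_pos: "0 < (\<Sum>m\<le>M. c m)"
  proof -
    have gauss: "(\<Sum>m\<le>n. real m) = real n * (real n + 1) / 2" for n
      by (induction n) (simp_all add: field_simps)
    have "(\<Sum>m\<le>M. c m) = ln 2 * (real M * (real M + 1) / 2) - (real M + 1) * H"
      unfolding c_def sum_subtractf sum_distrib_left [symmetric] gauss by simp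
    also have "\<dots> = (real M + 1) * (ln 2 * real M / 2 - H)" by (simp add: algebra_simps)
    also have "\<dots> > 0"
    proof (rule mult_pos_pos)
      have "H < 1 / 2 * real M / 2" using M by simp
      also have "\<dots> \<le> ln 2 * real M / 2"
        using half by (intro divide_right_mono mult_right_mono) auto
      finally show "0 < ln 2 * real M / 2 - H" by simp
    qed simp
    finally show ?thesis .
  qed
  have "(\<lambda>k. w (Suc m) (k - m) / X (Suc k)) \<longlonglongrightarrow> 1" for m
    by (rule LIMSEQ_offset [where k = m])
       (use weight_tendsto [of "Suc m"] in \<open>simp add: w_def X_def\<close>)
  \<comment> \<open>The coefficient 5 C at index k + 1 is 2 C at index k, the error term of
    \<open>erdos_level_1_step\<close>.\<close>
  then have "(\<lambda>k. (\<Sum>m\<le>M. c m * (w (Suc m) (k - m) / X (Suc k))) - 5 * C * ((2 / 5) ^ Suc k / X (Suc k)))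
      \<longlonglongrightarrow> (\<Sum>m\<le>M. c m * 1) - 5 * C * 0"
    using LIMSEQ_Suc [OF rmoment_odd_ratio(2)] by (intro tendsto_intros) (simp_all add: X_def)
  then have "\<forall>\<^sub>F k in sequentially. 0 < (\<Sum>m\<le>M. c m * (w (Suc m) (k - m) / X (Suc k)))
      - 5 * C * ((2 / 5) ^ Suc k / X (Suc k))"
    using sum_c_pos by (intro order_tendstoD) auto
  then show ?thesis
    using eventually_ge_at_top [of "Suc M"]
  proof eventually_elim
    case (elim k)
    have "(\<Sum>m\<le>M. c m * (w (Suc m) (k - m) / X (Suc k))) - 5 * C * ((2 / 5) ^ Suc k / X (Suc k))
        = ((\<Sum>m\<le>M. c m * w (Suc m) (k - m)) - 2 * C * (2 / 5) ^ k) / X (Suc k)"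
      by (simp add: sum_divide_distrib diff_divide_distrib)
    then have "2 * C * (2 / 5) ^ k < (\<Sum>m\<le>M. c m * w (Suc m) (k - m))"
      using elim(1) X [of "Suc k"] by (simp add: zero_less_divide_iff)
    also have "\<dots> \<le> (\<Sum>m\<le>k. c m * w (Suc m) (k - m))"
      using elim(2) c_nonneg w(2) by (intro sum_mono2) auto
    finally have pos: "2 * C * (2 / 5) ^ k < (\<Sum>m\<le>k. c m * w (Suc m) (k - m))" .
    define f where "f k = enn2real (erdos_level 1 k)" for k
    have f: "erdos_level 1 k = ennreal (f k)" "erdos_level 1 (Suc k) = ennreal (f (Suc k))"
      unfolding f_def using erdos_level_finite [of _ 1] elim(2) by simp_all
    have f_nonneg: "0 \<le> f k" for k by (simp add: f_def)
    have sums: "(\<Sum>m\<le>k. ennreal (g m) * weight (Suc m) (k - m)) = ennreal (\<Sum>m\<le>k. g m * w (Suc m) (k - m))"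
      if "\<And>m. 0 \<le> g m" for g :: "nat \<Rightarrow> real"
    proof -
      have "(\<Sum>m\<le>k. ennreal (g m) * weight (Suc m) (k - m)) = (\<Sum>m\<le>k. ennreal (g m * w (Suc m) (k - m)))"
        by (intro sum.cong refl) (simp add: w ennreal_mult that)
      also have "\<dots> = ennreal (\<Sum>m\<le>k. g m * w (Suc m) (k - m))"
        by (intro sum_ennreal mult_nonneg_nonneg that w)
      finally show ?thesis .
    qed
    have nonneg: "0 \<le> (\<Sum>m\<le>k. g m * w (Suc m) (k - m))" if "\<And>m. 0 \<le> g m" for g :: "nat \<Rightarrow> real"
      by (intro sum_nonneg mult_nonneg_nonneg that w)
    have "2 * zeta_level 1 k 1 \<le> 2 * ennreal (C * (2 / 5) ^ k)"
      by (intro mult_left_mono C) simp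
    also have "\<dots> = ennreal (2 * (C * (2 / 5) ^ k))"
      by (subst ennreal_mult') auto
    finally have "erdos_level 1 k + (\<Sum>m\<le>k. ennreal (ln 2 * real m) * weight (Suc m) (k - m)) \<le>
      erdos_level 1 (Suc k) + (\<Sum>m\<le>k. ennreal H * weight (Suc m) (k - m)) + ennreal (2 * (C * (2 / 5) ^ k))"
      using H(2) [of k] elim(2) by (meson add_left_mono order_trans less_le_trans zero_less_Suc)
    then have "ennreal (f k + (\<Sum>m\<le>k. ln 2 * real m * w (Suc m) (k - m))) \<le>
      ennreal (f (Suc k) + (\<Sum>m\<le>k. H * w (Suc m) (k - m)) + 2 * (C * (2 / 5) ^ k))"
      using H(1) C(1) sums [of "\<lambda>m. ln 2 * real m"] sums [of "\<lambda>_. H"]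
        nonneg [of "\<lambda>m. ln 2 * real m"] nonneg [of "\<lambda>_. H"]
      by (simp add: f f_nonneg ennreal_plus)
    then have "f k + (\<Sum>m\<le>k. ln 2 * real m * w (Suc m) (k - m)) \<le>
      f (Suc k) + (\<Sum>m\<le>k. H * w (Suc m) (k - m)) + 2 * (C * (2 / 5) ^ k)"
      using H(1) C(1) nonneg [of "\<lambda>_. H"] f_nonneg
      by (subst (asm) ennreal_le_iff) auto
    moreover have "(\<Sum>m\<le>k. c m * w (Suc m) (k - m)) =
        (\<Sum>m\<le>k. ln 2 * real m * w (Suc m) (k - m)) - (\<Sum>m\<le>k. H * w (Suc m) (k - m))"
      unfolding c_def by (simp add: left_diff_distrib sum_subtractf)
    ultimately have "f k < f (Suc k)" using pos by (simp add: mult.assoc)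
    then show ?case unfolding f using f_nonneg by (intro ennreal_lessI) (auto intro: le_less_trans)
  qed
qed

section \<open>Return to the real-valued series\<close>

lemma infsum_eq_nn_integral_count_space:
  fixes f :: "'a \<Rightarrow> real"
  assumes "\<And>x. x \<in> A \<Longrightarrow> 0 \<le> f x" "(\<integral>\<^sup>+x. ennreal (f x) \<partial>count_space A) < \<infinity>"
  shows "infsum f A = enn2real (\<integral>\<^sup>+x. ennreal (f x) \<partial>count_space A)"
proof -
  have "integrable (count_space A) f"
    using assms by (intro integrableI_nonneg) (auto simp: AE_count_space)
  then have "infsum f A = infsetsum f A"
    by (intro infsetsum_infsum [symmetric]) (simp add: Infinite_Set_Sum.abs_summable_on_def)
  also have "\<dots> = enn2real (\<integral>\<^sup>+x. ennreal (f x) \<partial>count_space A)"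
    unfolding infsetsum_def using assms
    by (intro integral_eq_nn_integral) (auto simp: AE_count_space)
  finally show ?thesis .
qed

lemma enn2real_less_mono:
  assumes "a < b" "b < \<infinity>"
  shows "enn2real a < enn2real b"
  using assms by (cases a rule: ennreal_cases; cases b rule: ennreal_cases) (auto simp: ennreal_less_iff)

lemma f_sum_rough_eq:
  assumes "k > 0"
  shows "f_sum_rough k y = enn2real (erdos_level y k)"
proof -
  have "{n. n > 0 \<and> big_Omega n = k \<and> (\<forall>p. prime p \<and> p dvd n \<longrightarrow> real p > y)} = rough_level y k"
    by (auto simp: rough_level_def rough_def)
  then show ?thesis
    unfolding f_sum_rough_def erdos_level_def
    using erdos_level_finite [OF assms, of y] rough_level_gt_1 [OF _ assms, of _ y]
    by (subst infsum_eq_nn_integral_count_space) (auto simp: erdos_level_def less_imp_le)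
qed

lemma f_sum_eq:
  assumes "k > 0"
  shows "f_sum k = enn2real (erdos_level 1 k)"
proof -
  have "{n. n > 0 \<and> big_Omega n = k} =
      {n. n > 0 \<and> big_Omega n = k \<and> (\<forall>p. prime p \<and> p dvd n \<longrightarrow> real p > 1)}"
    by (auto dest: prime_gt_1_nat)
  then show ?thesis
    using f_sum_rough_eq [OF assms, of 1] by (simp add: f_sum_def f_sum_rough_def)
qed

theorem theorem1p1:
  fixes y :: real
  assumes "y \<ge> 2"
  shows "\<forall>\<^sub>F k in sequentially.
           f_sum (k - 1) < f_sum k \<and> f_sum_rough (k - 1) y > f_sum_rough k y"
proof -
  \<comment> \<open>Shifting to \<open>Suc k\<close> resolves the truncated subtraction, and k > 0
    keeps both levels positive, where the series agree with \<open>erdos_level\<close>.\<close>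
  have "\<forall>\<^sub>F k in sequentially. f_sum (Suc k - 1) < f_sum (Suc k) \<and>
      f_sum_rough (Suc k - 1) y > f_sum_rough (Suc k) y"
    using erdos_level_1_increasing erdos_level_rough_decreasing [OF assms] eventually_gt_at_top [of 0]
  proof eventually_elim
    case (elim k)
    then show ?case
      using erdos_level_finite [of k] erdos_level_finite [of "Suc k"]
      by (simp add: f_sum_eq f_sum_rough_eq enn2real_less_mono)
  qed
  then show ?thesis by (subst (asm) eventually_sequentially_Suc)
qed

end
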